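(* Let $P,Q$ be probability distributions in $\mathcal P$, let $X_1,\ldots,X_m$ be i.i.d. $P$ and, independently, $Y_1,\ldots,Y_n$ i.i.d. $Q$. Let $m\to\infty$, $n\to\infty$, with $N=m+n$, $p_m=m/N$, and $p_m\to p\in(0,1)$ with $$p_m-p=O(N^{-1/2}).$$ Put $q=1-p$ and $\bar P=pP+qQ$, and assume $\bar P\in\mathcal P$. Assume that the estimator sequence $\hat\theta$ is asymptotically linear under $P$, under $Q$ and under $\bar P$, that is, for each $R\in\{P,Q,\bar P\}$ there is a function $f_R$ such that, when $V_1,V_2,\ldots$ are i.i.d. $R$, $$r^{1/2}\bigl[\hat\theta_r(V_1,\ldots,V_r)-\theta(R)\bigr]=\frac1{\sqrt r}\sum_{i=1}^r f_R(V_i)+o_R(1)\qquad (r\to\infty),$$ where $E_R f_R(V_1)=0$ and $0<\sigma^2(R)\equiv E_R f_R^2(V_1)<\infty$. Further assume that, for each $R\in\{P,Q,\bar P\}$, $\hat\sigma_r(V_1,\ldots,V_r)\to\sigma(R)$ in probability as $r\to\infty$ when $V_1,V_2,\ldots$ are i.i.d. $R$. Let $$T_{m,n}=N^{1/2}\bigl[\hat\theta_m(X_1,\ldots,X_m)-\hat\theta_n(Y_1,\ldots,Y_n)\bigr],$$ $$V_{m,n}=\sqrt{\frac Nm\hat\sigma_m^2(X_1,\ldots,X_m)+\frac Nn\hat\sigma_n^2(Y_1,\ldots,Y_n)},\qquad S_{m,n}=\frac{T_{m,n}}{V_{m,n}}.$$ Then the permutation distribution $\hat R^S_{m,n}$ of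 $S_{m,n}$ satisfies $$\sup_t\bigl|\hat R^S_{m,n}(t)-\Phi(t)\bigr|\to0\quad\text{in probability}.$$
   Context: $\mathcal P$ is a space of probability distributions and $\theta(\cdot)$ is a real-valued parameter defined on $\mathcal P$. For every sample size $r$, $\hat\theta_r$ and $\hat\sigma_r$ are real-valued functions of $r$ observations. $o_R(1)$ denotes a term converging to $0$ in probability when sampling i.i.d. from $R$; $\sigma(R)$ is the positive square root of $\sigma^2(R)$. $\Phi$ is the standard normal c.d.f. It is not assumed that $\theta(P)=\theta(Q)$. Write $Z=(Z_1,\ldots,Z_N)=(X_1,\ldots,X_m,Y_1,\ldots,Y_n)$ and let $\mathbf G_N$ be the set of all permutations of $\{1,\ldots,N\}$. For a statistic $S_{m,n}=S_{m,n}(Z_1,\ldots,Z_N)$, the permutation distribution is the random c.d.f. $$\hat R^S_{m,n}(t)=\frac1{N!}\sum_{\pi\in\mathbf G_N} I\{S_{m,n}(Z_{\pi(1)},\ldots,Z_{\pi(N)})\le t\},$$ i.e. the whole statistic (numerator and denominator) is recomputed on each permuted data set, with the first $m$ coordinates playing the role of the $X$'s and the last $n$ that of the $Y$'s. *)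

theory Defs
  imports "HOL-Probability.Probability" "HOL-Combinatorics.Permutations" "HOL-Library.Landau_Symbols"
begin

definition mixture :: "real \<Rightarrow> 'a measure \<Rightarrow> 'a measure \<Rightarrow> 'a measure" where
  "mixture p P Q = measure_of (space P) (sets P)
     (\<lambda>A. ennreal p * emeasure P A + ennreal (1 - p) * emeasure Q A)"

lemma space_mixture [simp]: "space (mixture p P Q) = space P"
  and sets_mixture [simp]: "sets (mixture p P Q) = sets P"
  by (simp_all add: mixture_def)

lemma emeasure_mixture:
  assumes "sets Q = sets P" and A: "A \<in> sets P"
  shows "emeasure (mixture p P Q) A = ennreal p * emeasure P A + ennreal (1 - p) * emeasure Q A"
  unfolding mixture_def
proof (rule emeasure_measure_of_sigma)
  show "sigma_algebra (space P) (sets P)" ..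
  show "positive (sets P) (\<lambda>A. ennreal p * emeasure P A + ennreal (1 - p) * emeasure Q A)"
    by (simp add: positive_def)
  show "countably_additive (sets P) (\<lambda>A. ennreal p * emeasure P A + ennreal (1 - p) * emeasure Q A)"
  proof (rule countably_additiveI)
    fix B :: "nat \<Rightarrow> 'a set"
    assume B: "range B \<subseteq> sets P" "disjoint_family B"
    then have "(\<Sum>i. emeasure P (B i)) = emeasure P (\<Union>i. B i)"
      and "(\<Sum>i. emeasure Q (B i)) = emeasure Q (\<Union>i. B i)"
      using assms(1) by (auto intro!: suminf_emeasure)
    then show "(\<Sum>i. ennreal p * emeasure P (B i) + ennreal (1 - p) * emeasure Q (B i)) =
        ennreal p * emeasure P (\<Union>i. B i) + ennreal (1 - p) * emeasure Q (\<Union>i. B i)"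
      by (simp flip: suminf_add)
  qed
qed (rule A)

lemma prob_space_mixture:
  assumes "prob_space P" "prob_space Q" "sets Q = sets P" "0 \<le> p" "p \<le> 1"
  shows "prob_space (mixture p P Q)"
proof
  have "space Q = space P"
    using assms(3) by (rule sets_eq_imp_space_eq)
  then have "emeasure P (space P) = 1" "emeasure Q (space P) = 1"
    using prob_space.emeasure_space_1[OF assms(1)] prob_space.emeasure_space_1[OF assms(2)]
    by simp_all
  then show "emeasure (mixture p P Q) (space (mixture p P Q)) = 1"
    using assms(3-5) by (simp add: emeasure_mixture flip: ennreal_plus)
qed

text \<open>Convergence in probability to a constant. The \<open>k\<close>-th random variable may live on its own
  probability space, and is required to be measurable.\<close>

definition tendsto_prob ::
    "(nat \<Rightarrow> 'w measure) \<Rightarrow> (nat \<Rightarrow> 'w \<Rightarrow> real) \<Rightarrow> real \<Rightarrow> bool" where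
  "tendsto_prob \<Omega> W c \<longleftrightarrow>
     (\<forall>k. W k \<in> borel_measurable (\<Omega> k)) \<and>
     (\<forall>\<epsilon>>0. (\<lambda>k. measure (\<Omega> k) {\<omega> \<in> space (\<Omega> k). \<epsilon> < \<bar>W k \<omega> - c\<bar>}) \<longlonglongrightarrow> 0)"

text \<open>Observations are numbered from \<open>0\<close>: a sample of size \<open>r\<close> is a function on \<open>{..<r}\<close>, extended
  by \<open>undefined\<close> as in \<open>PiM {..<r}\<close>, and an estimator is a family, indexed by the sample size, of
  functions of such samples. An infinite i.i.d. sequence with law \<open>R\<close> is the coordinate process on
  \<open>iid_space R\<close>.\<close>

type_synonym 'a estimator = "nat \<Rightarrow> (nat \<Rightarrow> 'a) \<Rightarrow> real"

abbreviation iid_space :: "'a measure \<Rightarrow> (nat \<Rightarrow> 'a) measure" where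
  "iid_space R \<equiv> PiM UNIV (\<lambda>_. R)"

definition asymptotically_linear ::
    "'a estimator \<Rightarrow> ('a measure \<Rightarrow> real) \<Rightarrow> 'a measure \<Rightarrow> ('a \<Rightarrow> real) \<Rightarrow> bool" where
  "asymptotically_linear \<theta>h \<theta> R f \<longleftrightarrow>
     integrable R f \<and> (\<integral>x. f x \<partial>R) = 0 \<and>
     integrable R (\<lambda>x. (f x)\<^sup>2) \<and> 0 < (\<integral>x. (f x)\<^sup>2 \<partial>R) \<and>
     tendsto_prob (\<lambda>_. iid_space R)
       (\<lambda>r v. sqrt (real r) * (\<theta>h r (restrict v {..<r}) - \<theta> R) - (\<Sum>i<r. f (v i)) / sqrt (real r)) 0"

definition consistent_at :: "'a estimator \<Rightarrow> 'a measure \<Rightarrow> real \<Rightarrow> bool" where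
  "consistent_at \<sigma>h R s \<longleftrightarrow> tendsto_prob (\<lambda>_. iid_space R) (\<lambda>r v. \<sigma>h r (restrict v {..<r})) s"

text \<open>In a combined sample \<open>z\<close> of size \<open>m + n\<close>, the first \<open>m\<close> coordinates play the role of the
  \<open>X\<close>'s and the last \<open>n\<close> that of the \<open>Y\<close>'s.\<close>

definition first_sample :: "nat \<Rightarrow> (nat \<Rightarrow> 'a) \<Rightarrow> nat \<Rightarrow> 'a" where
  "first_sample m z = (\<lambda>i\<in>{..<m}. z i)"

definition second_sample :: "nat \<Rightarrow> nat \<Rightarrow> (nat \<Rightarrow> 'a) \<Rightarrow> nat \<Rightarrow> 'a" where
  "second_sample m n z = (\<lambda>j\<in>{..<n}. z (m + j))"

definition pooled :: "nat \<Rightarrow> (nat \<Rightarrow> 'a) \<Rightarrow> (nat \<Rightarrow> 'a) \<Rightarrow> nat \<Rightarrow> 'a" where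
  "pooled m x y i = (if i < m then x i else y (i - m))"

definition T_stat :: "'a estimator \<Rightarrow> nat \<Rightarrow> nat \<Rightarrow> (nat \<Rightarrow> 'a) \<Rightarrow> real" where
  "T_stat \<theta>h m n z =
     sqrt (real (m + n)) * (\<theta>h m (first_sample m z) - \<theta>h n (second_sample m n z))"

definition V_stat :: "'a estimator \<Rightarrow> nat \<Rightarrow> nat \<Rightarrow> (nat \<Rightarrow> 'a) \<Rightarrow> real" where
  "V_stat \<sigma>h m n z =
     sqrt (real (m + n) / real m * (\<sigma>h m (first_sample m z))\<^sup>2 +
           real (m + n) / real n * (\<sigma>h n (second_sample m n z))\<^sup>2)"

text \<open>Where the denominator vanishes, the value is \<open>0\<close> by the convention \<open>x / 0 = 0\<close>.\<close>

definition S_stat :: "'a estimator \<Rightarrow> 'a estimator \<Rightarrow> nat \<Rightarrow> nat \<Rightarrow> (nat \<Rightarrow> 'a) \<Rightarrow> real" where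
  "S_stat \<theta>h \<sigma>h m n z = T_stat \<theta>h m n z / V_stat \<sigma>h m n z"

definition perm_cdf :: "nat \<Rightarrow> ((nat \<Rightarrow> 'a) \<Rightarrow> real) \<Rightarrow> (nat \<Rightarrow> 'a) \<Rightarrow> real \<Rightarrow> real" where
  "perm_cdf N S z t = (\<Sum>\<pi> | \<pi> permutes {..<N}. of_bool (S (\<lambda>i. z (\<pi> i)) \<le> t)) / fact N"

end

theory Submission
  imports Defs "HOL-Real_Asymp.Real_Asymp"
begin

text \<open>Only the behaviour of the estimators under the mixture \<open>p P + (1 - p) Q\<close> matters. The first \<open>m\<close> entries of
  a uniformly permuted pooled sample carry a hypergeometric number of labels \<open>P\<close>; as
  \<open>m/N - p = O(1 / sqrt N)\<close>, its probabilities are at most a constant times the binomial ones, which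
  belong to an i.i.d. sample from the mixture. Hence the errors of the linear approximation and of the variance
  estimator, being negligible for i.i.d. samples from the mixture, are negligible for the permuted sample
  (and likewise for the last \<open>n\<close> entries), and the statistic may be replaced by a linear one.

  For the linear statistic the pooled sample is coupled with an i.i.d. sample from the mixture that differs from it
  in \<open>O(sqrt N)\<close> places; since the coefficients sum to \<open>0\<close>, averaging over permutations shows
  that this changes the statistic by a negligible amount in mean square. For the i.i.d. sample, the
  expectation of the characteristic function of the permutation distribution and that of its squared modulus are
  products of characteristic functions, and they show that it converges to the normal one in mean square.\<close>

section \<open>Averages over permutations\<close>

text \<open>The permuted first sample and an i.i.d. sample from the mixture do not have close laws:
  without replacement, the variance of the number of labels \<open>P\<close> is smaller by a factor
  that stays away from 1. Only domination holds. It carries over events of vanishing probability,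
  but not a limit law; this is why the linear part needs a coupling of its own. The domination
  constant bounds \<open>Bernstein (N - r) (m - b) p / Bernstein N m p\<close>. Both terms live on
  the scale 1 / sqrt N: N - r is a fixed fraction of N, and m is within O(sqrt N) of N p. Ratios of
  neighbouring binomial probabilities give the bound without Stirling's formula. The influence
  function of the mixture need not have mean 0 under \<open>P\<close> or under \<open>Q\<close>. As
  constants cancel in the linear statistic, second moments under \<open>P\<close> and
  \<open>Q\<close> are all that has to be controlled, and these are finite because both have
  positive weight in the mixture.\<close>

definition perm_avg :: "nat \<Rightarrow> ((nat \<Rightarrow> nat) \<Rightarrow> 'b) \<Rightarrow> 'b::real_normed_field" where
  "perm_avg N F = (\<Sum>\<pi> | \<pi> permutes {..<N}. F \<pi>) / fact N"

lemma card_perms: "card {\<pi>. \<pi> permutes {..<N}} = fact N"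
  by (simp add: card_permutations[where n=N])

lemma finite_perms [simp]: "finite {\<pi>. \<pi> permutes {..<N::nat}}"
  by (simp add: finite_permutations)

lemma perm_avg_const [simp]: "perm_avg N (\<lambda>_. c) = c"
  by (simp add: perm_avg_def card_perms)

lemma perm_avg_add: "perm_avg N (\<lambda>\<pi>. F \<pi> + G \<pi>) = perm_avg N F + perm_avg N G"
  by (simp add: perm_avg_def sum.distrib add_divide_distrib)

lemma perm_avg_diff: "perm_avg N (\<lambda>\<pi>. F \<pi> - G \<pi>) = perm_avg N F - perm_avg N G"
  by (simp add: perm_avg_def sum_subtractf diff_divide_distrib)

lemma perm_avg_cmult: "perm_avg N (\<lambda>\<pi>. c * F \<pi>) = c * perm_avg N F"
  by (simp add: perm_avg_def sum_distrib_left)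

lemma perm_avg_sum: "perm_avg N (\<lambda>\<pi>. \<Sum>i\<in>A. F i \<pi>) = (\<Sum>i\<in>A. perm_avg N (F i))"
  unfolding perm_avg_def by (subst sum.swap) (simp add: sum_divide_distrib)

lemma perm_avg_mono:
  fixes F G :: "(nat \<Rightarrow> nat) \<Rightarrow> real"
  assumes "\<And>\<pi>. \<pi> permutes {..<N} \<Longrightarrow> F \<pi> \<le> G \<pi>"
  shows "perm_avg N F \<le> perm_avg N G"
  unfolding perm_avg_def using assms by (intro divide_right_mono sum_mono) auto

lemma perm_avg_nonneg:
  fixes F :: "(nat \<Rightarrow> nat) \<Rightarrow> real"
  assumes "\<And>\<pi>. \<pi> permutes {..<N} \<Longrightarrow> 0 \<le> F \<pi>"
  shows "0 \<le> perm_avg N F"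
  using perm_avg_mono[of N "\<lambda>_. 0" F] assms by simp

lemma perm_avg_cong:
  assumes "\<And>\<pi>. \<pi> permutes {..<N} \<Longrightarrow> F \<pi> = G \<pi>"
  shows "perm_avg N F = perm_avg N G"
  unfolding perm_avg_def using assms by (intro arg_cong2[where f="(/)"] sum.cong) auto

lemma norm_perm_avg_le: "norm (perm_avg N F) \<le> perm_avg N (\<lambda>\<pi>. norm (F \<pi>))"
  unfolding perm_avg_def by (simp add: norm_divide divide_right_mono norm_sum)

lemma perm_avg_compose_right:
  assumes "\<tau> permutes {..<N}"
  shows "perm_avg N (\<lambda>\<pi>. F (\<pi> \<circ> \<tau>)) = perm_avg N F"
  unfolding perm_avg_def using sum_permutations_compose_right[OF assms, of F] by simp

lemma perm_avg_compose_left: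
  assumes "\<tau> permutes {..<N}"
  shows "perm_avg N (\<lambda>\<pi>. F (\<tau> \<circ> \<pi>)) = perm_avg N F"
  unfolding perm_avg_def using setum_permutations_compose_left[OF assms, of F] by simp

lemma sum_permutes_eq:
  assumes "\<pi> permutes {..<N}"
  shows "(\<Sum>i<N. g (\<pi> i)) = (\<Sum>i<N. g i)"
  using sum.permute[OF assms, of g] by (simp add: comp_def)

text \<open>Composing with a transposition shows that all positions have the same average, and the
  sum over all positions does not depend on the permutation.\<close>

lemma perm_avg_component:
  fixes g :: "nat \<Rightarrow> real"
  assumes "i < N"
  shows "perm_avg N (\<lambda>\<pi>. g (\<pi> i)) = (\<Sum>k<N. g k) / N"
proof -
  have eq: "perm_avg N (\<lambda>\<pi>. g (\<pi> j)) = perm_avg N (\<lambda>\<pi>. g (\<pi> i))" if "j < N" for j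
    using perm_avg_compose_right[OF permutes_swap_id[of i "{..<N}" j], of "\<lambda>\<pi>. g (\<pi> i)"] assms that
    by simp
  have "(\<Sum>j<N. perm_avg N (\<lambda>\<pi>. g (\<pi> j))) = (\<Sum>j<N. perm_avg N (\<lambda>\<pi>. g (\<pi> i)))"
    using eq by (intro sum.cong) auto
  then have "real N * perm_avg N (\<lambda>\<pi>. g (\<pi> i)) = (\<Sum>j<N. perm_avg N (\<lambda>\<pi>. g (\<pi> j)))"
    by simp
  also have "\<dots> = perm_avg N (\<lambda>\<pi>. \<Sum>j<N. g (\<pi> j))"
    by (simp add: perm_avg_sum)
  also have "\<dots> = perm_avg N (\<lambda>\<pi>. \<Sum>j<N. g j)"
    by (intro perm_avg_cong sum_permutes_eq)
  finally show ?thesis using assms by (simp add: field_simps)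
qed

text \<open>With \<open>i\<close> fixed, a transposition that avoids \<open>i\<close> shows that
  every partner \<open>j\<close> gives the same value. The sum over all partners involves only
  \<open>a (\<pi> i)\<close> and the total, which reduces the claim to one position.\<close>

lemma perm_avg_pair:
  fixes a :: "nat \<Rightarrow> real"
  assumes ij: "i < N" "j < N" "i \<noteq> j"
  shows "perm_avg N (\<lambda>\<pi>. a (\<pi> i) * a (\<pi> j))
    = ((\<Sum>k<N. a k)\<^sup>2 - (\<Sum>k<N. (a k)\<^sup>2)) / (real N * (real N - 1))"
proof -
  let ?e = "\<lambda>j. perm_avg N (\<lambda>\<pi>. a (\<pi> i) * a (\<pi> j))"
  have N: "real N - 1 > 0" using ij by simp
  have eq: "?e j' = ?e j" if "j' \<in> {..<N} - {i}" for j'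
    using perm_avg_compose_right[OF permutes_swap_id[of j "{..<N}" j'], of "\<lambda>\<pi>. a (\<pi> i) * a (\<pi> j)"]
      that ij by (simp add: transpose_apply_other)
  have "(\<Sum>j'\<in>{..<N} - {i}. ?e j') = (\<Sum>j'\<in>{..<N} - {i}. ?e j)"
    by (rule sum.cong[OF refl eq])
  then have "(real N - 1) * ?e j = (\<Sum>j'\<in>{..<N} - {i}. ?e j')"
    using ij by (simp add: of_nat_diff)
  also have "\<dots> = perm_avg N (\<lambda>\<pi>. a (\<pi> i) * (\<Sum>j'\<in>{..<N} - {i}. a (\<pi> j')))"
    by (simp only: perm_avg_sum[symmetric] sum_distrib_left)
  also have "\<dots> = perm_avg N (\<lambda>\<pi>. (\<Sum>k<N. a k) * a (\<pi> i) - (a (\<pi> i))\<^sup>2)"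
  proof (rule perm_avg_cong)
    fix \<pi> assume "\<pi> permutes {..<N}"
    then have "(\<Sum>j'\<in>{..<N} - {i}. a (\<pi> j')) = (\<Sum>k<N. a k) - a (\<pi> i)"
      using ij by (simp add: sum_diff1 sum_permutes_eq)
    then show "a (\<pi> i) * (\<Sum>j'\<in>{..<N} - {i}. a (\<pi> j')) = (\<Sum>k<N. a k) * a (\<pi> i) - (a (\<pi> i))\<^sup>2"
      by (simp only:) (simp add: right_diff_distrib power2_eq_square mult.commute)
  qed
  also have "\<dots> = ((\<Sum>k<N. a k)\<^sup>2 - (\<Sum>k<N. (a k)\<^sup>2)) / N"
    using perm_avg_component[OF ij(1), of a] perm_avg_component[OF ij(1), of "\<lambda>k. (a k)\<^sup>2"]
    by (simp add: perm_avg_diff perm_avg_cmult diff_divide_distrib power2_eq_square)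
  finally show ?thesis using N ij by (simp add: field_simps)
qed

text \<open>The variance of a contrast under sampling without replacement; the bound drops the
  square of the population total. It serves three times: for the stability of the linear statistic
  under changes of the data, for its second moment, and, with \<open>a = c\<close>, for the near
  orthogonality of two rearrangements of the coefficients.\<close>

lemma perm_avg_linear_square_le:
  fixes a c :: "nat \<Rightarrow> real"
  assumes N: "2 \<le> N" and c0: "(\<Sum>i<N. c i) = 0"
  shows "perm_avg N (\<lambda>\<pi>. (\<Sum>i<N. c i * a (\<pi> i))\<^sup>2)
    \<le> (\<Sum>i<N. (c i)\<^sup>2) * (\<Sum>i<N. (a i)\<^sup>2) / (real N - 1)"
proof -
  let ?A = "\<Sum>i<N. (a i)\<^sup>2" and ?C = "\<Sum>i<N. (c i)\<^sup>2" and ?s = "\<Sum>i<N. a i"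
  let ?d = "?A / N" and ?o = "(?s\<^sup>2 - ?A) / (real N * (real N - 1))"
  have N1: "real N - 1 > 0" using N by simp
  have e: "perm_avg N (\<lambda>\<pi>. a (\<pi> i) * a (\<pi> j)) = (if i = j then ?d else ?o)"
    if "i < N" "j < N" for i j
    using that perm_avg_pair[of i N j a] perm_avg_component[of i N "\<lambda>k. (a k)\<^sup>2"]
    by (auto simp: power2_eq_square)
  have "perm_avg N (\<lambda>\<pi>. (\<Sum>i<N. c i * a (\<pi> i))\<^sup>2)
     = perm_avg N (\<lambda>\<pi>. \<Sum>i<N. \<Sum>j<N. (c i * c j) * (a (\<pi> i) * a (\<pi> j)))"
    by (simp add: power2_eq_square sum_product mult_ac)
  also have "\<dots> = (\<Sum>i<N. \<Sum>j<N. (c i * c j) * (if i = j then ?d else ?o))"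
    by (simp add: perm_avg_sum perm_avg_cmult e)
  \<comment> \<open>The moment matrix is \<open>?o\<close> times the all-ones matrix plus a multiple
    of the identity, and the all-ones part is annihilated by coefficients with sum 0.\<close>
  also have "\<dots> = (\<Sum>i<N. \<Sum>j<N. (c i * c j) * ?o + (if i = j then (c i)\<^sup>2 * (?d - ?o) else 0))"
    by (intro sum.cong refl) (auto simp: algebra_simps power2_eq_square)
  also have "\<dots> = (\<Sum>i<N. \<Sum>j<N. c i * c j) * ?o + (\<Sum>i<N. (c i)\<^sup>2 * (?d - ?o))"
    by (simp only: sum.distrib sum_distrib_right) (simp add: sum.delta)
  also have "(\<Sum>i<N. \<Sum>j<N. c i * c j) = 0"
    using c0 by (simp flip: sum_product)
  also have "(\<Sum>i<N. (c i)\<^sup>2 * (?d - ?o)) = ?C * (?d - ?o)"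
    by (rule sum_distrib_right[symmetric])
  finally have eq: "perm_avg N (\<lambda>\<pi>. (\<Sum>i<N. c i * a (\<pi> i))\<^sup>2) = ?C * (?d - ?o)"
    by simp
  have "?d - ?o = (?A * (real N - 1) - ?s\<^sup>2 + ?A) / (real N * (real N - 1))"
    using N N1 by (simp add: field_simps)
  also have "\<dots> \<le> ?A * real N / (real N * (real N - 1))"
    using N1 N by (intro divide_right_mono) (auto simp: algebra_simps)
  also have "\<dots> = ?A / (real N - 1)" using N by simp
  finally have "?C * (?d - ?o) \<le> ?C * (?A / (real N - 1))"
    by (intro mult_left_mono sum_nonneg) auto
  then show ?thesis
    by (simp add: eq)
qed

text \<open>Transitivity of the symmetric group on subsets of a given size, by gluing a bijection of
  the sets to one of their complements.\<close>

lemma permutes_image_eq_exists: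
  assumes "S \<subseteq> U" "S' \<subseteq> U" "card S = card S'" "finite U"
  obtains \<tau> where "\<tau> permutes U" "\<tau> ` S = S'"
proof -
  have fin: "finite S" "finite S'" using assms by (auto intro: finite_subset)
  obtain f where f: "bij_betw f S S'" using fin assms(3) finite_same_card_bij by blast
  have "card (U - S) = card (U - S')" using assms fin by (simp add: card_Diff_subset)
  then obtain g where g: "bij_betw g (U - S) (U - S')"
    using assms(4) finite_same_card_bij[of "U - S" "U - S'"] by auto
  define h where "h = (\<lambda>x. if x \<in> S then f x else g x)"
  define \<tau> where "\<tau> = (\<lambda>x. if x \<in> U then h x else x)"
  have "bij_betw h (S \<union> (U - S)) (S' \<union> (U - S'))"
    unfolding h_def by (rule bij_betw_disjoint_Un[OF f g]) auto
  moreover have "S \<union> (U - S) = U" "S' \<union> (U - S') = U" using assms by auto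
  ultimately have h: "bij_betw h U U" by simp
  have "bij_betw \<tau> U U" using h unfolding \<tau>_def by (subst bij_betw_cong[where g=h]) simp_all
  then have "\<tau> permutes U" by (rule bij_imp_permutes) (auto simp: \<tau>_def)
  moreover have "\<tau> ` S = f ` S"
    using assms(1) by (intro image_cong) (auto simp: \<tau>_def h_def)
  then have "\<tau> ` S = S'"
    using f by (simp add: bij_betw_def)
  ultimately show ?thesis by (rule that)
qed

text \<open>The set of positions that receive an entry of the first sample is a uniformly
  distributed \<open>m\<close>-subset: its distribution \<open>H\<close> is invariant under
  permutations, hence constant by transitivity, and has total mass 1.\<close>

lemma perm_avg_preimage:
  fixes g :: "nat set \<Rightarrow> real"
  assumes "m \<le> N"
  shows "perm_avg N (\<lambda>\<pi>. g {i. i < N \<and> \<pi> i < m})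
    = (\<Sum>S | S \<subseteq> {..<N} \<and> card S = m. g S) / (N choose m)"
proof -
  define \<S> where "\<S> = {S. S \<subseteq> {..<N} \<and> card S = m}"
  define H where "H S = perm_avg N (\<lambda>\<pi>. of_bool ({i. i < N \<and> \<pi> i < m} = S) :: real)" for S
  have fin: "finite \<S>" unfolding \<S>_def by (rule finite_subset[of _ "Pow {..<N}"]) auto
  have card: "card \<S> = N choose m" unfolding \<S>_def using n_subsets[of "{..<N}" m] by simp
  have mem: "{i. i < N \<and> \<pi> i < m} \<in> \<S>" if \<pi>: "\<pi> permutes {..<N}" for \<pi>
  proof -
    have "\<pi> ` {i. i < N \<and> \<pi> i < m} = {..<m}"
    proof (intro equalityI subsetI)
      fix x assume "x \<in> {..<m}"
      then have "x \<in> \<pi> ` {..<N}" using permutes_image[OF \<pi>] assms by auto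
      then show "x \<in> \<pi> ` {i. i < N \<and> \<pi> i < m}" using \<open>x \<in> {..<m}\<close> by auto
    qed auto
    then have "card {i. i < N \<and> \<pi> i < m} = m"
      using card_image[OF permutes_inj_on[OF \<pi>, of "{i. i < N \<and> \<pi> i < m}"]] by simp
    then show ?thesis by (auto simp: \<S>_def)
  qed
  have const: "H S = H S'" if SS: "S \<in> \<S>" "S' \<in> \<S>" for S S'
  proof -
    obtain \<tau> where \<tau>: "\<tau> permutes {..<N}" "\<tau> ` S = S'"
      using permutes_image_eq_exists[of S "{..<N}" S'] SS by (auto simp: \<S>_def)
    have lt: "\<tau> i < N \<longleftrightarrow> i < N" for i using permutes_in_image[OF \<tau>(1), of i] by simp
    have "({i. i < N \<and> \<pi> (\<tau> i) < m} = S) \<longleftrightarrow> ({i. i < N \<and> \<pi> i < m} = S')" for \<pi>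
    proof -
      have e: "\<tau> ` {i. i < N \<and> \<pi> (\<tau> i) < m} = {i. i < N \<and> \<pi> i < m}"
      proof (intro equalityI subsetI)
        fix x assume x: "x \<in> {i. i < N \<and> \<pi> i < m}"
        then have "x \<in> \<tau> ` {..<N}" using permutes_image[OF \<tau>(1)] by simp
        then obtain y where "y < N" "x = \<tau> y" by auto
        then show "x \<in> \<tau> ` {i. i < N \<and> \<pi> (\<tau> i) < m}" using x by blast
      next
        fix x assume "x \<in> \<tau> ` {i. i < N \<and> \<pi> (\<tau> i) < m}"
        then obtain y where "x = \<tau> y" "y < N" "\<pi> (\<tau> y) < m" by blast
        then show "x \<in> {i. i < N \<and> \<pi> i < m}" using lt[of y] by simp
      qed
      show ?thesis
        using inj_image_eq_iff[OF permutes_inj[OF \<tau>(1)], of "{i. i < N \<and> \<pi> (\<tau> i) < m}" S]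
        unfolding e \<tau>(2) by (rule sym)
    qed
    then have "(\<lambda>\<pi>. of_bool ({i. i < N \<and> (\<pi> \<circ> \<tau>) i < m} = S) :: real)
      = (\<lambda>\<pi>. of_bool ({i. i < N \<and> \<pi> i < m} = S'))"
      by (simp only: comp_def)
    then show ?thesis
      unfolding H_def
      using perm_avg_compose_right[OF \<tau>(1), of "\<lambda>\<pi>. of_bool ({i. i < N \<and> \<pi> i < m} = S) :: real"]
      by (simp only:)
  qed
  have sum1: "(\<Sum>S\<in>\<S>. H S) = 1"
  proof -
    have "(\<Sum>S\<in>\<S>. H S) = perm_avg N (\<lambda>\<pi>. \<Sum>S\<in>\<S>. of_bool ({i. i < N \<and> \<pi> i < m} = S))"
      unfolding H_def by (simp add: perm_avg_sum)
    also have "\<dots> = perm_avg N (\<lambda>\<pi>. 1)"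
    proof (rule perm_avg_cong)
      fix \<pi> assume \<pi>: "\<pi> permutes {..<N}"
      let ?A = "{i. i < N \<and> \<pi> i < m}"
      have "(\<Sum>S\<in>\<S>. of_bool (?A = S)) = (\<Sum>S\<in>\<S>. if ?A = S then 1 else (0::real))"
        by (rule sum.cong[OF refl]) simp
      also have "\<dots> = 1" by (simp only: sum.delta'[OF fin] mem[OF \<pi>] if_True)
      finally show "(\<Sum>S\<in>\<S>. of_bool (?A = S)) = (1::real)" .
    qed
    finally show ?thesis by simp
  qed
  have H: "H S = 1 / (N choose m)" if "S \<in> \<S>" for S
  proof -
    have "(\<Sum>S'\<in>\<S>. H S') = (\<Sum>S'\<in>\<S>. H S)"
      using const[OF _ that] by (intro sum.cong) auto
    then have "(\<Sum>S'\<in>\<S>. H S') = (N choose m) * H S"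
      using card by simp
    then show ?thesis using sum1 assms by (simp add: field_simps)
  qed
  have "perm_avg N (\<lambda>\<pi>. g {i. i < N \<and> \<pi> i < m})
    = perm_avg N (\<lambda>\<pi>. \<Sum>S\<in>\<S>. g S * of_bool ({i. i < N \<and> \<pi> i < m} = S))"
  proof (rule perm_avg_cong)
    fix \<pi> assume \<pi>: "\<pi> permutes {..<N}"
    let ?A = "{i. i < N \<and> \<pi> i < m}"
    have "(\<Sum>S\<in>\<S>. g S * of_bool (?A = S)) = (\<Sum>S\<in>\<S>. if ?A = S then g S else 0)"
      by (rule sum.cong[OF refl]) simp
    also have "\<dots> = g ?A" by (simp only: sum.delta'[OF fin] mem[OF \<pi>] if_True)
    finally show "g ?A = (\<Sum>S\<in>\<S>. g S * of_bool (?A = S))" ..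
  qed
  also have "\<dots> = (\<Sum>S\<in>\<S>. g S * H S)"
    by (simp only: perm_avg_sum perm_avg_cmult H_def)
  also have "\<dots> = (\<Sum>S\<in>\<S>. g S) / (N choose m)"
    unfolding sum_divide_distrib by (intro sum.cong refl) (simp only: H, simp)
  finally show ?thesis unfolding \<S>_def .
qed

section \<open>Local bounds for binomial probabilities\<close>

lemma Bernstein_second_moment:
  "(\<Sum>k\<le>n. (real k - c)\<^sup>2 * Bernstein n k x) = n * x * (1 - x) + (n * x - c)\<^sup>2"
proof -
  have "(\<Sum>k\<le>n. (real k - c)\<^sup>2 * Bernstein n k x)
    = (\<Sum>k\<le>n. real k * (real k - 1) * Bernstein n k x + (1 - 2 * c) * (real k * Bernstein n k x)
        + c\<^sup>2 * Bernstein n k x)"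
    by (intro sum.cong refl) (simp add: power2_eq_square algebra_simps)
  also have "\<dots> = real n * (real n - 1) * x\<^sup>2 + (1 - 2 * c) * (n * x) + c\<^sup>2"
    by (simp only: sum.distrib sum_distrib_left[symmetric] sum_Bernstein sum_k_Bernstein sum_kk_Bernstein
        mult_1_right)
  also have "\<dots> = n * x * (1 - x) + (n * x - c)\<^sup>2"
    by (simp add: power2_eq_square algebra_simps)
  finally show ?thesis .
qed

text \<open>Chebyshev's inequality with the variance bound p (1 - p) \<le> 1/4.\<close>

lemma Bernstein_window:
  assumes "0 < p" "p < 1"
  shows "(\<Sum>k | k \<le> n \<and> \<bar>real k - n * p\<bar> \<le> sqrt n. Bernstein n k p) \<ge> 3 / 4"
proof (cases "n = 0")
  case True then show ?thesis by (simp add: Bernstein_def)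
next
  case False
  let ?W = "{k. k \<le> n \<and> \<bar>real k - n * p\<bar> \<le> sqrt n}" and ?V = "{k. k \<le> n \<and> \<not> \<bar>real k - n * p\<bar> \<le> sqrt n}"
  have nn: "0 \<le> Bernstein n k p" for k using assms by (simp add: Bernstein_nonneg)
  have "n * (\<Sum>k\<in>?V. Bernstein n k p) = (\<Sum>k\<in>?V. n * Bernstein n k p)"
    by (rule sum_distrib_left)
  also have "\<dots> \<le> (\<Sum>k\<in>?V. (real k - n * p)\<^sup>2 * Bernstein n k p)"
  proof (intro sum_mono mult_right_mono nn)
    fix k assume "k \<in> ?V"
    then have "sqrt n < \<bar>real k - n * p\<bar>" by auto
    then have "(sqrt n)\<^sup>2 \<le> \<bar>real k - n * p\<bar>\<^sup>2" by (intro power_mono) auto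
    then show "real n \<le> (real k - n * p)\<^sup>2" by simp
  qed
  also have "\<dots> \<le> (\<Sum>k\<le>n. (real k - n * p)\<^sup>2 * Bernstein n k p)"
    by (intro sum_mono2) (auto intro!: mult_nonneg_nonneg nn)
  also have "\<dots> = n * (p * (1 - p))" by (simp add: Bernstein_second_moment)
  also have "\<dots> \<le> n * (1 / 4)"
  proof (intro mult_left_mono)
    have "0 \<le> (p - 1/2)\<^sup>2" by simp
    then show "p * (1 - p) \<le> 1 / 4" by (simp add: power2_eq_square algebra_simps)
  qed simp
  finally have V: "(\<Sum>k\<in>?V. Bernstein n k p) \<le> 1 / 4" using False by simp
  have "{..n} = ?W \<union> ?V" by auto
  then have "(\<Sum>k\<le>n. Bernstein n k p) = (\<Sum>k\<in>?W \<union> ?V. Bernstein n k p)" by (rule arg_cong)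
  also have "\<dots> = (\<Sum>k\<in>?W. Bernstein n k p) + (\<Sum>k\<in>?V. Bernstein n k p)"
    by (intro sum.union_disjoint) auto
  finally show ?thesis using V by simp
qed

text \<open>The ratio of neighbouring probabilities, cross-multiplied. They increase from
  \<open>k\<close> to \<open>Suc k\<close> exactly while k + 1 < (n + 1) p.\<close>

lemma Bernstein_Suc:
  assumes "k < n"
  shows "Bernstein n (Suc k) p * ((real k + 1) * (1 - p)) = Bernstein n k p * ((real n - real k) * p)"
proof -
  obtain d where d: "n = Suc k + d" using assms less_iff_Suc_add by auto
  have "Suc k * (n choose Suc k) = (n - k) * (n choose k)"
    using binomial_absorb_comp[of n k] binomial_absorption[of k n] d
    by (metis binomial_absorption binomial_absorb_comp)
  then have "(real k + 1) * real (n choose Suc k) = (real n - real k) * real (n choose k)"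
    using assms by (metis of_nat_mult of_nat_Suc of_nat_diff less_imp_le_nat add.commute)
  moreover have "n - k = Suc (n - Suc k)" using d by simp
  ultimately show ?thesis unfolding Bernstein_def by (simp add: mult_ac)
qed

lemma Bernstein_flip:
  assumes "k \<le> n"
  shows "Bernstein n k p = Bernstein n (n - k) (1 - p)"
  using assms by (simp add: Bernstein_def binomial_symmetric[symmetric])

text \<open>Climb from \<open>j\<close> to \<open>i\<close> one step at a time. Below the mode a
  step gains at most the factor 1 + \<theta>, the worst case being the step at \<open>j\<close>;
  there are at most \<open>s\<close> such steps. Beyond the mode the probabilities no longer
  increase.\<close>

lemma Bernstein_upper_le:
  assumes p: "0 < p" "p < 1" and ij: "j \<le> i" "i \<le> n"
    and \<theta>: "0 \<le> \<theta>" "(real n + 1) * p - (real j + 1) \<le> \<theta> * ((real j + 1) * (1 - p))"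
    and s: "(real n + 1) * p - real j \<le> real s"
  shows "Bernstein n i p \<le> (1 + \<theta>) ^ s * Bernstein n j p"
proof -
  have nn: "0 \<le> Bernstein n k p" for k using p by (simp add: Bernstein_nonneg)
  have *: "j + d \<le> n \<Longrightarrow> Bernstein n (j + d) p \<le> (1 + \<theta>) ^ (min d s) * Bernstein n j p" for d
  proof (induction d)
    case (Suc d)
    let ?l = "real (j + d)"
    have pos: "0 < (?l + 1) * (1 - p)" using p by simp
    have eq: "Bernstein n (Suc (j + d)) p * ((?l + 1) * (1 - p)) = Bernstein n (j + d) p * ((real n - ?l) * p)"
      using Suc.prems by (intro Bernstein_Suc) auto
    have IH: "Bernstein n (j + d) p \<le> (1 + \<theta>) ^ (min d s) * Bernstein n j p"
      using Suc by simp
    show ?case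
    proof (cases "?l + 1 \<le> (real n + 1) * p")
      case True
      have "\<theta> * ((real j + 1) * (1 - p)) \<le> \<theta> * ((?l + 1) * (1 - p))"
        using \<theta>(1) p by (intro mult_left_mono mult_right_mono) auto
      then have "(real n - ?l) * p \<le> (1 + \<theta>) * ((?l + 1) * (1 - p))"
        using \<theta>(2) by (simp add: algebra_simps)
      then have "Bernstein n (Suc (j + d)) p * ((?l + 1) * (1 - p))
          \<le> Bernstein n (j + d) p * ((1 + \<theta>) * ((?l + 1) * (1 - p)))"
        unfolding eq by (intro mult_left_mono nn)
      also have "\<dots> = ((1 + \<theta>) * Bernstein n (j + d) p) * ((?l + 1) * (1 - p))" by simp
      finally have "Bernstein n (Suc (j + d)) p \<le> (1 + \<theta>) * Bernstein n (j + d) p"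
        using pos by (rule mult_right_le_imp_le)
      also have "\<dots> \<le> (1 + \<theta>) * ((1 + \<theta>) ^ (min d s) * Bernstein n j p)"
        using IH \<theta>(1) by (intro mult_left_mono) auto
      also have "\<dots> = (1 + \<theta>) ^ (min (Suc d) s) * Bernstein n j p"
      proof -
        \<comment> \<open>A step below the mode is among the first \<open>s\<close>, so the exponent
          \<open>min d s\<close> really grows by one here.\<close>
        have "real (Suc d) \<le> real s" using True s by simp
        then have "min (Suc d) s = Suc (min d s)" by simp
        then show ?thesis by simp
      qed
      finally show ?thesis by simp
    next
      case False
      then have "(real n - ?l) * p \<le> (?l + 1) * (1 - p)" by (simp add: algebra_simps)
      then have "Bernstein n (Suc (j + d)) p * ((?l + 1) * (1 - p)) \<le> Bernstein n (j + d) p * ((?l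
          + 1) * (1 - p))"
        unfolding eq by (intro mult_left_mono nn)
      then have "Bernstein n (Suc (j + d)) p \<le> Bernstein n (j + d) p"
        using pos by (rule mult_right_le_imp_le)
      also note IH
      also have "(1 + \<theta>) ^ (min d s) * Bernstein n j p \<le> (1 + \<theta>) ^ (min (Suc d) s) * Bernstein n j p"
        using \<theta>(1) by (intro mult_right_mono power_increasing nn) auto
      finally show ?thesis by simp
    qed
  qed simp
  have "Bernstein n i p \<le> (1 + \<theta>) ^ (min (i - j) s) * Bernstein n j p"
    using *[of "i - j"] ij by simp
  also have "\<dots> \<le> (1 + \<theta>) ^ s * Bernstein n j p"
    using \<theta>(1) by (intro mult_right_mono power_increasing nn) auto
  finally show ?thesis .
qed

text \<open>About D sqrt n steps may lie below the mode, each with a factor 1 + O(1 / sqrt n), so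
  their product is bounded uniformly in \<open>n\<close>. The size condition on \<open>n\<close>
  keeps \<open>j\<close> above n p / 2.\<close>

lemma Bernstein_upper_window:
  assumes p: "0 < p" "p < 1" and D: "0 \<le> D" and n: "0 < n" "2 * D * sqrt n \<le> n * p"
    and j: "j \<le> n" "n * p - D * sqrt n \<le> real j" and ij: "j \<le> i" "i \<le> n"
  shows "Bernstein n i p \<le> exp (2 * (D + 1) * (D + 3) / (p * (1 - p))) * Bernstein n j p"
proof -
  \<comment> \<open>The ratio at \<open>j\<close> exceeds 1 by ((n + 1) p - (j + 1)) / ((j + 1) (1 -
    p)). Its numerator is at most (D + 1) sqrt n, and j + 1 is at least n p / 2.\<close>
  define \<theta> where "\<theta> = 2 * (D + 1) / (sqrt n * p * (1 - p))"
  \<comment> \<open>The mode is near (n + 1) p, not n p; the extra 1 absorbs the difference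
    \<open>p\<close>.\<close>
  define s where "s = nat \<lceil>D * sqrt n + 1\<rceil>"
  have sn: "1 \<le> sqrt n" "sqrt n * sqrt n = n" using n by auto
  have nn: "0 \<le> Bernstein n k p" for k using p by (simp add: Bernstein_nonneg)
  have \<theta>0: "0 \<le> \<theta>" using p D by (simp add: \<theta>_def)
  have jl: "n * p / 2 \<le> real j + 1" using j n by simp
  have "(real n + 1) * p - (real j + 1) \<le> D * sqrt n + 1"
    using j p by (simp add: algebra_simps)
  also have "\<dots> \<le> (D + 1) * sqrt n" using sn by (simp add: algebra_simps)
  also have "\<dots> = \<theta> * ((n * p / 2) * (1 - p))"
  proof -
    have "\<theta> * ((n * p / 2) * (1 - p)) = (D + 1) * (n / sqrt n) * ((p * (1 - p)) / (p * (1 - p)))"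
      by (simp add: \<theta>_def)
    also have "\<dots> = (D + 1) * sqrt n"
      using p n by (simp add: real_div_sqrt)
    finally show ?thesis ..
  qed
  also have "\<dots> \<le> \<theta> * ((real j + 1) * (1 - p))"
    using p jl \<theta>0 by (intro mult_left_mono mult_right_mono) auto
  finally have 1: "(real n + 1) * p - (real j + 1) \<le> \<theta> * ((real j + 1) * (1 - p))" .
  have "(real n + 1) * p - real j \<le> D * sqrt n + 1"
    using j p by (simp add: algebra_simps)
  also have "\<dots> \<le> real s" unfolding s_def by linarith
  finally have 2: "(real n + 1) * p - real j \<le> real s" .
  have "real s \<le> D * sqrt n + 2" using D sn unfolding s_def
    by (smt (verit) mult_nonneg_nonneg of_nat_nat of_int_ceiling_le_add_one zero_le_ceiling)
  also have "\<dots> \<le> (D + 3) * sqrt n" using sn(1) unfolding distrib_right by linarith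
  finally have s: "real s \<le> (D + 3) * sqrt n" .
  have "(1 + \<theta>) ^ s \<le> exp \<theta> ^ s" using \<theta>0 by (intro power_mono) (auto simp: exp_ge_add_one_self)
  also have "\<dots> = exp (s * \<theta>)" by (simp add: exp_of_nat_mult)
  also have "\<dots> \<le> exp (((D + 3) * sqrt n) * \<theta>)"
    using s \<theta>0 by (simp add: mult_right_mono)
  also have "((D + 3) * sqrt n) * \<theta> = 2 * (D + 1) * (D + 3) / (p * (1 - p))"
    using sn(1) by (simp add: \<theta>_def)
  finally have e: "(1 + \<theta>) ^ s \<le> exp (2 * (D + 1) * (D + 3) / (p * (1 - p)))" .
  have "Bernstein n i p \<le> (1 + \<theta>) ^ s * Bernstein n j p"
    by (rule Bernstein_upper_le[OF p ij \<theta>0 1 2])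
  also have "\<dots> \<le> exp (2 * (D + 1) * (D + 3) / (p * (1 - p))) * Bernstein n j p"
    by (intro mult_right_mono e nn)
  finally show ?thesis .
qed

text \<open>Below \<open>j\<close>, reflect \<open>k\<close> to \<open>n - k\<close> and
  \<open>p\<close> to \<open>1 - p\<close>; the window and the constant are symmetric under this.
  Hence central probabilities are comparable to the maximal one.\<close>

lemma Bernstein_window_max:
  fixes n :: nat and p D :: real
  assumes p: "0 < p" "p < 1" and D: "0 \<le> D"
    and n: "0 < n" "2 * D * sqrt n \<le> n * p" "2 * D * sqrt n \<le> n * (1 - p)"
    and j: "\<bar>real j - n * p\<bar> \<le> D * sqrt n" and i: "i \<le> n"
  shows "Bernstein n i p \<le> exp (2 * (D + 1) * (D + 3) / (p * (1 - p))) * Bernstein n j p"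
proof -
  have "0 \<le> D * sqrt n" using D by simp
  then have "real j \<le> n * p + n * (1 - p)" using n(3) j by (simp add: abs_le_iff)
  then have "real j \<le> n" by (simp add: algebra_simps)
  then have jn: "j \<le> n" by simp
  show ?thesis
  proof (cases "j \<le> i")
    case True
    then show ?thesis using Bernstein_upper_window[OF p D n(1,2) jn _ True i] j by auto
  next
    case False
    have "Bernstein n (n - i) (1 - p) \<le> exp (2 * (D + 1) * (D + 3) / ((1 - p) * (1 - (1
        - p)))) * Bernstein n (n - j) (1 - p)"
    proof (rule Bernstein_upper_window)
      show "real n * (1 - p) - D * sqrt n \<le> real (n - j)"
        using j jn by (simp add: of_nat_diff algebra_simps abs_if split: if_splits)
    qed (use p D n jn i False in auto)
    then show ?thesis using Bernstein_flip[OF jn, of p] Bernstein_flip[OF i, of p] by (simp add: mult.commute)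
  qed
qed

text \<open>Split a + b trials into two independent blocks; Vandermonde's identity. Terms with l > b
  or M - l > a vanish through their binomial coefficients, so the range of \<open>l\<close> needs no
  further restriction.\<close>

lemma Bernstein_convolution:
  "(\<Sum>l\<le>M. Bernstein b l p * Bernstein a (M - l) p) = Bernstein (a + b) M p"
proof -
  have "(\<Sum>l\<le>M. Bernstein b l p * Bernstein a (M - l) p)
    = (\<Sum>l\<le>M. real ((b choose l) * (a choose (M - l))) * (p ^ M * (1 - p) ^ (a + b - M)))"
  proof (rule sum.cong[OF refl])
    fix l assume l: "l \<in> {..M}"
    show "Bernstein b l p * Bernstein a (M - l) p
      = real ((b choose l) * (a choose (M - l))) * (p ^ M * (1 - p) ^ (a + b - M))"
    proof (cases "l \<le> b \<and> M - l \<le> a")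
      case True
      then have "p ^ M = p ^ l * p ^ (M - l)" "(1 - p) ^ (a + b - M) = (1 - p) ^ (b - l) * (1 - p) ^ (a
          - (M - l))"
        using l by (auto simp flip: power_add intro!: arg_cong2[where f=power])
      then show ?thesis by (simp add: Bernstein_def)
    qed (auto simp: Bernstein_def binomial_eq_0)
  qed
  also have "\<dots> = real (\<Sum>l\<le>M. (b choose l) * (a choose (M - l))) * (p ^ M * (1 - p) ^ (a + b - M))"
    by (simp add: sum_distrib_right)
  also have "(\<Sum>l\<le>M. (b choose l) * (a choose (M - l))) = (a + b) choose M"
    using vandermonde[of b a M] by (simp add: add.commute)
  finally show ?thesis by (simp add: Bernstein_def)
qed

text \<open>A hypergeometric probability divided by the corresponding binomial one is a ratio of two
  Bernstein polynomials of this kind, so this bounds a likelihood ratio uniformly.\<close>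

lemma Bernstein_le_convolution:
  assumes p: "0 < p" "p < 1" and \<kappa>: "0 < \<kappa>" and D: "0 \<le> D"
  obtains C n0 where "0 < C" "\<And>a b M i. n0 \<le> a + b \<Longrightarrow> \<kappa> * real (a + b) \<le> real a \<Longrightarrow>
     \<bar>real M - real (a + b) * p\<bar> \<le> D * sqrt (a + b) \<Longrightarrow> i \<le> a \<Longrightarrow>
     Bernstein a i p \<le> C * Bernstein (a + b) M p"
proof -
  \<comment> \<open>The window has to be expressed in terms of sqrt a instead of sqrt (a + b), at
    the price of 1 / sqrt \<kappa>; the added 1 is room for the deviation of the other
    \<open>b\<close> trials.\<close>
  define D' where "D' = (D + 1) / sqrt \<kappa>"
  define E where "E = exp (2 * (D' + 1) * (D' + 3) / (p * (1 - p)))"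
  have D': "0 \<le> D'" using D \<kappa> by (simp add: D'_def)
  have "eventually (\<lambda>n. 2 * D' * sqrt (real n) \<le> real n * p) sequentially"
    using p by real_asymp
  moreover have "eventually (\<lambda>n. 2 * D' * sqrt (real n) \<le> real n * (1 - p)) sequentially"
    using p by real_asymp
  moreover have "eventually (\<lambda>n::nat. 0 < n) sequentially" by (rule eventually_gt_at_top)
  ultimately have "eventually (\<lambda>n. 0 < n \<and> 2 * D' * sqrt (real n) \<le> real n * p \<and> 2 * D' * sqrt (real n)
      \<le> real n * (1 - p)) sequentially"
    by eventually_elim auto
  then obtain n1 where n1: "\<And>n. n1 \<le> n \<Longrightarrow> 0 < n \<and> 2 * D' * sqrt (real n) \<le> real n * p
      \<and> 2 * D' * sqrt (real n) \<le> real n * (1 - p)"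
    by (auto simp: eventually_sequentially)
  \<comment> \<open>From a + b \<ge> n0 one gets a \<ge> \<kappa> n0 \<ge> n1, the size that the
    window bound requires of \<open>a\<close>.\<close>
  define n0 where "n0 = nat \<lceil>n1 / \<kappa>\<rceil>"
  have "Bernstein a i p \<le> 2 * E * Bernstein (a + b) M p"
    if N: "n0 \<le> a + b" and a: "\<kappa> * real (a + b) \<le> real a"
      and M: "\<bar>real M - real (a + b) * p\<bar> \<le> D * sqrt (a + b)" and i: "i \<le> a" for a b M i
  proof -
    have nn: "0 \<le> Bernstein n k p" for n k using p by (simp add: Bernstein_nonneg)
    have "n1 / \<kappa> \<le> real (a + b)" using N unfolding n0_def by linarith
    then have "real n1 \<le> \<kappa> * real (a + b)" using \<kappa> by (simp add: field_simps)
    then have "n1 \<le> a" using a by linarith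
    then have na: "0 < a" "2 * D' * sqrt (real a) \<le> real a * p" "2 * D' * sqrt (real a) \<le> real a * (1 - p)"
      using n1 by auto
    have sq: "(D + 1) * sqrt (a + b) \<le> D' * sqrt a"
    proof -
      have "sqrt \<kappa> * sqrt (a + b) \<le> sqrt a" using a by (simp flip: real_sqrt_mult)
      then have "sqrt (a + b) \<le> sqrt a / sqrt \<kappa>" using \<kappa> by (simp add: field_simps)
      then have "(D + 1) * sqrt (a + b) \<le> (D + 1) * (sqrt a / sqrt \<kappa>)" using D by (intro mult_left_mono) auto
      then show ?thesis by (simp add: D'_def)
    qed
    let ?W = "{l. l \<le> b \<and> \<bar>real l - b * p\<bar> \<le> sqrt b}"
    have W: "l \<le> M \<and> Bernstein a i p \<le> E * Bernstein a (M - l) p" if l: "l \<in> ?W" for l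
    proof -
      have "sqrt b \<le> sqrt (a + b)" by simp
      moreover have "\<bar>(real M - real l) - a * p\<bar> \<le> \<bar>real M - real (a + b) * p\<bar> + \<bar>real l - b * p\<bar>"
        by (simp add: algebra_simps)
      moreover have "D * sqrt (a + b) + sqrt (a + b) \<le> D' * sqrt a"
        using sq by (simp add: distrib_right)
      ultimately have dev: "\<bar>(real M - real l) - a * p\<bar> \<le> D' * sqrt a"
        using l M unfolding mem_Collect_eq by linarith
      have "0 \<le> D' * sqrt a" using D' by simp
      then have "real l \<le> real M" using dev na(2) by (simp add: abs_le_iff)
      then have lM: "l \<le> M" by simp
      then show ?thesis
        using Bernstein_window_max[OF p D' na _ i, of "M - l"] dev by (simp add: of_nat_diff E_def)
    qed
    \<comment> \<open>With probability at least 3/4 the \<open>b\<close> trials deviate little. Then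
      M - l is central for the \<open>a\<close> trials and its probability is comparable to the
      largest one; summing over \<open>l\<close> gives back the probability of \<open>M\<close>. The
      final factor 2 covers 4/3.\<close>
    have "Bernstein a i p * (3 / 4) \<le> Bernstein a i p * (\<Sum>l\<in>?W. Bernstein b l p)"
      by (intro mult_left_mono Bernstein_window p nn)
    also have "\<dots> = (\<Sum>l\<in>?W. Bernstein b l p * Bernstein a i p)"
      by (simp add: sum_distrib_left mult.commute)
    also have "\<dots> \<le> (\<Sum>l\<in>?W. Bernstein b l p * (E * Bernstein a (M - l) p))"
      by (intro sum_mono mult_left_mono nn) (use W in auto)
    also have "\<dots> = E * (\<Sum>l\<in>?W. Bernstein b l p * Bernstein a (M - l) p)"
      by (simp add: sum_distrib_left mult_ac)
    also have "\<dots> \<le> E * (\<Sum>l\<le>M. Bernstein b l p * Bernstein a (M - l) p)"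
      by (intro mult_left_mono sum_mono2) (use W in \<open>auto intro!: mult_nonneg_nonneg nn simp: E_def\<close>)
    also have "\<dots> = E * Bernstein (a + b) M p" by (simp only: Bernstein_convolution)
    finally have "Bernstein a i p * (3 / 4) \<le> E * Bernstein (a + b) M p" .
    moreover have "0 \<le> E * Bernstein (a + b) M p" by (simp add: nn E_def)
    ultimately show ?thesis by (simp add: mult.assoc)
  qed
  then show ?thesis by (intro that[of "2 * E" n0]) (auto simp: E_def)
qed

section \<open>Independent samples and their mixture\<close>

text \<open>The arithmetic-geometric mean inequality with a free scale \<open>r\<close>. It replaces
  Cauchy-Schwarz throughout: first moments are bounded by second moments, and \<open>r\<close> is
  chosen small or balanced at each use.\<close>

lemma abs_le_square_plus:
  assumes "0 < (r::real)"
  shows "\<bar>x\<bar> \<le> x\<^sup>2 / (2 * r) + r / 2"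
proof -
  have "0 \<le> (\<bar>x\<bar> - r)\<^sup>2 / (2 * r)" using assms by simp
  also have "\<dots> = x\<^sup>2 / (2 * r) + r / 2 - \<bar>x\<bar>"
    using assms by (simp add: power2_diff diff_divide_distrib add_divide_distrib power2_eq_square[of r])
  finally show ?thesis by simp
qed

lemma sum_Pow_Bernstein:
  fixes g :: "nat \<Rightarrow> real"
  assumes "finite I"
  shows "(\<Sum>B\<in>Pow I. p ^ card B * (1 - p) ^ card (I - B) * g (card B))
      = (\<Sum>k\<le>card I. g k * Bernstein (card I) k p)"
proof -
  have "(\<Sum>B\<in>Pow I. p ^ card B * (1 - p) ^ card (I - B) * g (card B))
    = (\<Sum>k\<le>card I. \<Sum>B\<in>{B \<in> Pow I. card B = k}. p ^ card B * (1 - p) ^ card (I - B) * g (card B))"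
    using assms by (intro sum.group[symmetric]) (auto intro: card_mono)
  also have "\<dots> = (\<Sum>k\<le>card I. g k * Bernstein (card I) k p)"
  proof (rule sum.cong[OF refl])
    fix k
    have "(\<Sum>B\<in>{B \<in> Pow I. card B = k}. p ^ card B * (1 - p) ^ card (I - B) * g (card B))
      = (\<Sum>B\<in>{B \<in> Pow I. card B = k}. p ^ k * (1 - p) ^ (card I - k) * g k)"
      using assms by (intro sum.cong) (auto simp: card_Diff_subset finite_subset)
    also have "card {B \<in> Pow I. card B = k} = card I choose k"
      using n_subsets[OF assms, of k] by simp
    then have "(\<Sum>B\<in>{B \<in> Pow I. card B = k}. p ^ k * (1 - p) ^ (card I - k) * g k)
        = g k * Bernstein (card I) k p"
      by (simp add: Bernstein_def)
    finally show "(\<Sum>B\<in>{B \<in> Pow I. card B = k}. p ^ card B * (1 - p) ^ card (I - B) * g (card B))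
      = g k * Bernstein (card I) k p" .
  qed
  finally show ?thesis .
qed

text \<open>The expected number of labels changed in the coupling. The scale sqrt N balances the
  inequality, since variance and squared bias are both of order N.\<close>

lemma Bernstein_abs_deviation_le:
  assumes p: "0 < p" "p < 1" and m: "\<bar>real m - real N * p\<bar> \<le> D * sqrt N" and N: "0 < N"
  shows "(\<Sum>k\<le>N. \<bar>real k - real m\<bar> * Bernstein N k p) \<le> (1 + D\<^sup>2) * sqrt N"
proof -
  have sN: "0 < sqrt N" using N by simp
  note abs_le_square_plus[OF sN, of "real k - real m" for k]
  then have "(\<Sum>k\<le>N. \<bar>real k - real m\<bar> * Bernstein N k p)
      \<le> (\<Sum>k\<le>N. ((real k - real m)\<^sup>2 / (2 * sqrt N) + sqrt N / 2) * Bernstein N k p)"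
    using p by (intro sum_mono mult_right_mono Bernstein_nonneg) auto
  also have "\<dots> = (\<Sum>k\<le>N. (real k - real m)\<^sup>2 * Bernstein N k p) / (2 * sqrt N)
      + sqrt N / 2 * (\<Sum>k\<le>N. Bernstein N k p)"
    by (simp only: distrib_right sum.distrib sum_distrib_left sum_divide_distrib times_divide_eq_left)
  also have "\<dots> = (N * p * (1 - p) + (N * p - m)\<^sup>2) / (2 * sqrt N) + sqrt N / 2"
    by (simp add: Bernstein_second_moment)
  also have "\<dots> \<le> ((1 + D\<^sup>2) * N) / (2 * sqrt N) + sqrt N / 2"
  proof (intro add_right_mono divide_right_mono)
    have "(real N * p - real m)\<^sup>2 \<le> (D * sqrt N)\<^sup>2"
      using m by (intro abs_le_square_iff[THEN iffD1]) (auto simp: abs_minus_commute)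
    moreover have "real N * (p * (1 - p)) \<le> real N * (1 * 1)"
      using p by (intro mult_left_mono mult_mono) auto
    ultimately show "N * p * (1 - p) + (N * p - m)\<^sup>2 \<le> (1 + D\<^sup>2) * N"
      by (simp add: power_mult_distrib algebra_simps)
  qed simp
  also have "((1 + D\<^sup>2) * N) / (2 * sqrt N) = (1 + D\<^sup>2) / 2 * (N / sqrt N)" by simp
  also have "N / sqrt N = sqrt N" by (simp add: real_div_sqrt)
  also have "(1 + D\<^sup>2) / 2 * sqrt N + sqrt N / 2 \<le> (1 + D\<^sup>2) * sqrt N"
  proof -
    have "0 \<le> D\<^sup>2 * sqrt N" by simp
    moreover have "(1 + D\<^sup>2) / 2 * sqrt N + sqrt N / 2 = sqrt N + D\<^sup>2 * sqrt N / 2"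
      "(1 + D\<^sup>2) * sqrt N = sqrt N + D\<^sup>2 * sqrt N"
      by (simp_all add: algebra_simps add_divide_distrib)
    ultimately show ?thesis by linarith
  qed
  finally show ?thesis .
qed

text \<open>For r given positions, \<open>b\<close> of them labelled \<open>P\<close>, the left side
  is the probability of this pattern under a uniform \<open>m\<close>-subset of labels and the right
  side its probability under independent labels, times \<open>C\<close>. Their ratio is exactly
  \<open>Bernstein (N - r) (m - b) p / Bernstein N m p\<close>.\<close>

lemma hypergeometric_over_binomial_le:
  assumes p: "0 < p" "p < 1" and mN: "m \<le> N" and rN: "r \<le> N" and b: "b \<le> r" "b \<le> m"
    and C: "0 \<le> C" "\<And>i. i \<le> N - r \<Longrightarrow> Bernstein (N - r) i p \<le> C * Bernstein N m p"
  shows "real ((N - r) choose (m - b)) / real (N choose m) \<le> C * (p ^ b * (1 - p) ^ (r - b))"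
proof (cases "m - b \<le> N - r")
  case True
  have c: "0 < real (N choose m)" using mN by simp
  have pw: "p ^ m = p ^ b * p ^ (m - b)" "(1 - p) ^ (N - m) = (1 - p) ^ (r - b) * (1 - p) ^ (N - r - (m - b))"
    using True b mN rN by (auto simp flip: power_add intro!: arg_cong2[where f=power])
  have "real ((N - r) choose (m - b)) * (p ^ (m - b) * (1 - p) ^ (N - r - (m - b)))
    \<le> C * (real (N choose m) * (p ^ m * (1 - p) ^ (N - m)))"
    using C(2)[OF True] by (simp add: Bernstein_def mult_ac)
  also have "\<dots> = (C * real (N choose m) * (p ^ b * (1 - p) ^ (r - b))) * (p ^ (m - b) * (1 - p) ^ (N - r
      - (m - b)))"
    unfolding pw by simp
  finally have "real ((N - r) choose (m - b)) \<le> C * real (N choose m) * (p ^ b * (1 - p) ^ (r - b))"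
    using p by (subst (asm) mult_le_cancel_right) (auto simp: not_less dest: mult_pos_pos)
  then show ?thesis using c by (simp add: field_simps)
qed (use p C in \<open>simp add: binomial_eq_0\<close>)

section \<open>Labelled product measures and the mixture\<close>

locale two_sample =
  fixes P Q :: "'a measure" and p :: real
  assumes P: "prob_space P" and Q: "prob_space Q" and sets_Q: "sets Q = sets P"
    and p: "0 < p" "p < 1"
begin

sublocale P: prob_space P by (rule P)
sublocale Q: prob_space Q by (rule Q)

abbreviation "Pb \<equiv> mixture p P Q"

abbreviation PiP :: "'i set \<Rightarrow> ('i \<Rightarrow> 'a) measure" where
  "PiP I \<equiv> PiM I (\<lambda>_. P)"

abbreviation PiPb :: "'i set \<Rightarrow> ('i \<Rightarrow> 'a) measure" where
  "PiPb I \<equiv> PiM I (\<lambda>_. Pb)"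

sublocale Pb: prob_space Pb
  using p by (intro prob_space_mixture P Q sets_Q) auto

lemma space_Q: "space Q = space P" by (rule sets_eq_imp_space_eq[OF sets_Q])

text \<open>\<open>B\<close> is the set of coordinates labelled \<open>P\<close>. Arbitrary label
  sets are allowed, because permuting the coordinates and labelling at random both leave the initial
  segments.\<close>

definition prodPQ :: "'i set \<Rightarrow> 'i set \<Rightarrow> ('i \<Rightarrow> 'a) measure" where
  "prodPQ I B = PiM I (\<lambda>i. if i \<in> B then P else Q)"

text \<open>The probability of the label set \<open>B\<close> when labels are drawn independently,
  \<open>P\<close> with probability \<open>p\<close>.\<close>

definition wt :: "'i set \<Rightarrow> 'i set \<Rightarrow> real" where
  "wt I B = p ^ card B * (1 - p) ^ card (I - B)"

lemma wt_nonneg [simp]: "0 \<le> wt I B" using p by (simp add: wt_def)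

lemma sets_prodPQ [simp, measurable_cong]: "sets (prodPQ I B) = sets (PiP I)"
  unfolding prodPQ_def by (intro sets_PiM_cong) (auto simp: sets_Q)

lemma space_prodPQ [simp]: "space (prodPQ I B) = space (PiP I)"
  by (rule sets_eq_imp_space_eq) simp

lemma prob_space_prodPQ: "prob_space (prodPQ I B)"
  unfolding prodPQ_def by (intro prob_space_PiM) (auto intro: P Q)

lemma sets_PiM_Pb [simp, measurable_cong]: "sets (PiPb I) = sets (PiP I)"
  by (intro sets_PiM_cong) auto

lemma space_PiM_Pb [simp]: "space (PiPb I) = space (PiP I)"
  by (rule sets_eq_imp_space_eq) simp

lemma prob_space_PiM_Pb: "prob_space (PiPb I)"
  by (intro prob_space_PiM Pb.prob_space_axioms)

lemma nn_integral_mixture: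
  assumes "f \<in> borel_measurable P"
  shows "(\<integral>\<^sup>+x. f x \<partial>Pb) = ennreal p * (\<integral>\<^sup>+x. f x \<partial>P) + ennreal (1 - p) * (\<integral>\<^sup>+x. f x \<partial>Q)"
  using assms
proof (induction rule: borel_measurable_induct)
  case (cong f g)
  have "integral\<^sup>N Pb g = integral\<^sup>N Pb f" "integral\<^sup>N P g = integral\<^sup>N P f" "integral\<^sup>N Q g = integral\<^sup>N Q f"
    using cong(3) by (auto intro!: nn_integral_cong simp: space_Q)
  then show ?case using cong by simp
next
  case (set A)
  then show ?case by (simp add: emeasure_mixture sets_Q)
next
  case (mult u c)
  have [measurable]: "u \<in> borel_measurable Pb" "u \<in> borel_measurable Q"
    using mult(2) by (simp_all add: measurable_def space_Q sets_Q)
  show ?case using mult by (simp add: nn_integral_cmult ring_distribs mult_ac)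
next
  case (add u v)
  have [measurable]: "u \<in> borel_measurable Pb" "u \<in> borel_measurable Q" "v \<in> borel_measurable Pb"
      "v \<in> borel_measurable Q"
    using add by (simp_all add: measurable_def space_Q sets_Q)
  show ?case using add by (simp add: nn_integral_add ring_distribs ac_simps)
next
  case (seq U)
  have meas: "U i \<in> borel_measurable Pb" "U i \<in> borel_measurable Q" for i
    using seq by (simp_all add: measurable_def space_Q sets_Q)
  have mono: "mono (\<lambda>i. \<integral>\<^sup>+x. U i x \<partial>M)" for M
    using seq(3) by (auto simp: mono_def le_fun_def intro!: nn_integral_mono)
  have app: "(SUP i. U i) x = (SUP i. U i x)" for x
    by (simp add: image_image)
  have sup: "(\<integral>\<^sup>+x. (SUP i. U i) x \<partial>M) = (SUP i. \<integral>\<^sup>+x. U i x \<partial>M)"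
    if "\<And>i. U i \<in> borel_measurable M" for M
    using nn_integral_monotone_convergence_SUP[OF seq(3) that] unfolding app by simp
  have "(SUP i. \<integral>\<^sup>+x. U i x \<partial>Pb) = (SUP i. ennreal p * (\<integral>\<^sup>+x. U i x \<partial>P) + ennreal (1 - p) * (\<integral>\<^sup>+x. U i x \<partial>Q))"
    using seq by simp
  also have "\<dots> = ennreal p * (SUP i. \<integral>\<^sup>+x. U i x \<partial>P) + ennreal (1 - p) * (SUP i. \<integral>\<^sup>+x. U i x \<partial>Q)"
    using mono by (subst ennreal_SUP_add)
      (auto simp: SUP_mult_left_ennreal incseq_def mono_def intro!: mult_left_mono)
  finally show ?case unfolding sup[OF meas(1)] sup[OF meas(2)] sup[OF seq(1)] .
qed

text \<open>Multiplying out the product of mixtures: sampling from the mixture means drawing a label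
  set first. With nonnegative integrals, the induction over the coordinates raises no question of
  integrability.\<close>

lemma nn_integral_PiM_mixture:
  assumes "finite I" "F \<in> borel_measurable (PiP I)"
  shows "(\<integral>\<^sup>+z. F z \<partial>PiPb I) = (\<Sum>B\<in>Pow I. ennreal (wt I B) * (\<integral>\<^sup>+z. F z \<partial>prodPQ I B))"
  using assms
proof (induction I arbitrary: F rule: finite_induct)
  case empty
  then show ?case by (simp add: prodPQ_def PiM_empty wt_def)
next
  case (insert i I F)
  interpret Pb: product_sigma_finite "\<lambda>_. Pb" by standard
  have PQ: "product_sigma_finite (\<lambda>i. if i \<in> B then P else Q)" for B :: "'i set"
    by (intro product_sigma_finite.intro) (auto intro: P.sigma_finite_measure_axioms
        Q.sigma_finite_measure_axioms)
  have cong: "PiM I (\<lambda>j. if j \<in> insert i B then P else Q) = prodPQ I B" for B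
    unfolding prodPQ_def using insert(2) by (intro PiM_cong) auto
  have 1: "integral\<^sup>N (prodPQ (insert i I) (insert i B)) F = (\<integral>\<^sup>+x. (\<integral>\<^sup>+y. F (x(i := y)) \<partial>P) \<partial>prodPQ I B)" for B
  proof -
    have "integral\<^sup>N (prodPQ (insert i I) (insert i B)) F
      = (\<integral>\<^sup>+x. (\<integral>\<^sup>+y. F (x(i := y)) \<partial>(if i \<in> insert i B then P else Q)) \<partial>PiM I (\<lambda>j.
          if j \<in> insert i B then P else Q))"
      unfolding prodPQ_def[of "insert i I"] using insert
      by (intro product_sigma_finite.product_nn_integral_insert[OF PQ])
        (simp_all flip: prodPQ_def del: insert_iff)
    then show ?thesis by (simp only: cong) simp
  qed
  have 2: "integral\<^sup>N (prodPQ (insert i I) B) F = (\<integral>\<^sup>+x. (\<integral>\<^sup>+y. F (x(i := y)) \<partial>Q) \<partial>prodPQ I B)" if "i \<notin> B" for B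
    unfolding prodPQ_def using insert that
    by (subst product_sigma_finite.product_nn_integral_insert[OF PQ])
      (simp_all flip: prodPQ_def)
  note [measurable] = insert(4)
  have m: "(\<lambda>(x, y). F (x(i := y))) \<in> borel_measurable (PiP I \<Otimes>\<^sub>M P)"
    using measurable_compose[OF measurable_add_dim[of i I "\<lambda>_. P"] insert(4)] by (simp add: split_beta')
  have [measurable]: "(\<lambda>x. \<integral>\<^sup>+y. F (x(i := y)) \<partial>P) \<in> borel_measurable (PiP I)"
    using P.borel_measurable_nn_integral[OF m] by simp
  have "(\<lambda>(x, y). F (x(i := y))) \<in> borel_measurable (PiP I \<Otimes>\<^sub>M Q)"
    using m by (simp only: measurable_cong_sets[OF sets_pair_measure_cong[OF refl sets_Q] refl])
  then have [measurable]: "(\<lambda>x. \<integral>\<^sup>+y. F (x(i := y)) \<partial>Q) \<in> borel_measurable (PiP I)"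
    using Q.borel_measurable_nn_integral by simp
  have "(\<integral>\<^sup>+z. F z \<partial>PiPb (insert i I)) = (\<integral>\<^sup>+x. (\<integral>\<^sup>+y. F (x(i := y)) \<partial>Pb) \<partial>PiPb I)"
    using insert by (intro Pb.product_nn_integral_insert) auto
  also have "\<dots> = (\<integral>\<^sup>+x. ennreal p * (\<integral>\<^sup>+y. F (x(i := y)) \<partial>P) + ennreal (1
      - p) * (\<integral>\<^sup>+y. F (x(i := y)) \<partial>Q) \<partial>PiPb I)"
  proof (intro nn_integral_cong nn_integral_mixture)
    fix x assume "x \<in> space (PiPb I)"
    then show "(\<lambda>y. F (x(i := y))) \<in> borel_measurable P"
      using measurable_Pair2[OF m, of x] by simp
  qed
  also have "\<dots> = (\<Sum>B\<in>Pow I. ennreal (wt I B) * (\<integral>\<^sup>+x. ennreal p * (\<integral>\<^sup>+y. F (x(i := y)) \<partial>P) + ennreal (1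
      - p) * (\<integral>\<^sup>+y. F (x(i := y)) \<partial>Q) \<partial>prodPQ I B))"
    by (intro insert(3)) measurable
  also have "\<dots> = (\<Sum>B\<in>Pow I. ennreal (wt I B) * ennreal p * integral\<^sup>N (prodPQ (insert i I) (insert i B)) F
       + ennreal (wt I B) * ennreal (1 - p) * integral\<^sup>N (prodPQ (insert i I) B) F)"
  proof (rule sum.cong[OF refl])
    fix B assume "B \<in> Pow I"
    then have "i \<notin> B" using insert(2) by auto
    then show "ennreal (wt I B) * (\<integral>\<^sup>+x. ennreal p * (\<integral>\<^sup>+y. F (x(i := y)) \<partial>P) + ennreal (1
        - p) * (\<integral>\<^sup>+y. F (x(i := y)) \<partial>Q) \<partial>prodPQ I B)
      = ennreal (wt I B) * ennreal p * integral\<^sup>N (prodPQ (insert i I) (insert i B)) F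
       + ennreal (wt I B) * ennreal (1 - p) * integral\<^sup>N (prodPQ (insert i I) B) F"
      by (simp add: 1 2 nn_integral_add nn_integral_cmult distrib_left mult_ac)
  qed
  \<comment> \<open>The first sum collects the label sets that contain the new coordinate, the
    second those that do not; together they exhaust \<open>Pow (insert i I)\<close>.\<close>
  also have "\<dots> = (\<Sum>B\<in>Pow I. ennreal (wt (insert i I) (insert i B)) * integral\<^sup>N (prodPQ (insert i I)
      (insert i B)) F)
       + (\<Sum>B\<in>Pow I. ennreal (wt (insert i I) B) * integral\<^sup>N (prodPQ (insert i I) B) F)"
  proof -
    have "ennreal (wt I B) * ennreal p = ennreal (wt (insert i I) (insert i B))"
      "ennreal (wt I B) * ennreal (1 - p) = ennreal (wt (insert i I) B)" if "B \<in> Pow I" for B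
    proof -
      have B: "i \<notin> B" "finite B" using that insert(1,2) by (auto intro: finite_subset)
      have "insert i I - insert i B = I - B" "insert i I - B = insert i (I - B)" using B insert(2) by auto
      then have "wt (insert i I) (insert i B) = wt I B * p" "wt (insert i I) B = wt I B * (1 - p)"
        using B insert(1,2) by (auto simp: wt_def card_insert_if)
      then show "ennreal (wt I B) * ennreal p = ennreal (wt (insert i I) (insert i B))"
      "ennreal (wt I B) * ennreal (1 - p) = ennreal (wt (insert i I) B)"
        using p by (simp_all add: ennreal_mult)
    qed
    then show ?thesis by (simp add: sum.distrib)
  qed
  also have "\<dots> = (\<Sum>B\<in>Pow (insert i I). ennreal (wt (insert i I) B) * integral\<^sup>N (prodPQ (insert i I) B) F)"
  proof -
    have "inj_on (insert i) (Pow I)" using insert(2) by (auto simp: inj_on_def)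
    moreover have "Pow I \<inter> insert i ` Pow I = {}" using insert(2) by auto
    ultimately show ?thesis
      using insert(1) by (simp add: Pow_insert sum.union_disjoint sum.reindex add.commute)
  qed
  finally show ?case .
qed

lemma integral_PiM_mixture:
  assumes I: "finite I" and F: "F \<in> borel_measurable (PiP I)" "\<And>z. 0 \<le> F z" "\<And>z. F z \<le> (b::real)"
  shows "(\<integral>z. F z \<partial>PiPb I) = (\<Sum>B\<in>Pow I. wt I B * (\<integral>z. F z \<partial>prodPQ I B))"
proof -
  interpret PI: prob_space "PiPb I" by (rule prob_space_PiM_Pb)
  interpret PQ: prob_space "prodPQ I B" for B by (rule prob_space_prodPQ)
  note [measurable] = F(1)
  have i1: "integrable (PiPb I) F"
    by (rule PI.integrable_const_bound[of _ b]) (use F(2,3) in auto)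
  have i2: "integrable (prodPQ I B) F" for B
    by (rule PQ.integrable_const_bound[of _ b]) (use F(2,3) in auto)
  have "ennreal (\<integral>z. F z \<partial>PiPb I) = (\<integral>\<^sup>+z. ennreal (F z) \<partial>PiPb I)"
    using nn_integral_eq_integral[OF i1] F(2) by simp
  also have "\<dots> = (\<Sum>B\<in>Pow I. ennreal (wt I B) * (\<integral>\<^sup>+z. ennreal (F z) \<partial>prodPQ I B))"
    using I by (intro nn_integral_PiM_mixture) auto
  also have "\<dots> = (\<Sum>B\<in>Pow I. ennreal (wt I B * (\<integral>z. F z \<partial>prodPQ I B)))"
    using nn_integral_eq_integral[OF i2] F(2) by (simp add: ennreal_mult)
  also have "\<dots> = ennreal (\<Sum>B\<in>Pow I. wt I B * (\<integral>z. F z \<partial>prodPQ I B))"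
    using F(2) by (intro sum_ennreal) simp
  finally show ?thesis using F(2) by (subst (asm) ennreal_inj) (auto intro!: sum_nonneg)
qed

lemma measure_PiM_mixture:
  assumes "finite I" "A \<in> sets (PiP I)"
  shows "measure (PiPb I) A = (\<Sum>B\<in>Pow I. wt I B * measure (prodPQ I B) A)"
proof -
  have "A \<inter> space (PiP I) = A" using sets.sets_into_space[OF assms(2)] by (rule Int_absorb2)
  then show ?thesis using integral_PiM_mixture[of I "indicator A" 1] assms by simp
qed

lemma distr_prodPQ_reindex:
  assumes "inj_on g J" "g \<in> J \<rightarrow> I"
  shows "distr (prodPQ I B) (PiP J) (\<lambda>z. \<lambda>i\<in>J. z (g i)) = prodPQ J {i \<in> J. g i \<in> B}"
proof -
  have "distr (prodPQ I B) (PiP J) (\<lambda>z. \<lambda>i\<in>J. z (g i))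
    = distr (PiM I (\<lambda>i. if i \<in> B then P else Q)) (PiM J (\<lambda>i. if g i \<in> B then P else Q)) (\<lambda>z. \<lambda>i\<in>J. z (g i))"
    unfolding prodPQ_def by (intro distr_cong refl sets_PiM_cong) (auto simp: sets_Q)
  also have "\<dots> = PiM J (\<lambda>i. if g i \<in> B then P else Q)"
    using assms by (intro distr_PiM_reindex[where M="\<lambda>i. if i \<in> B then P else Q"]) (auto intro: P Q)
  also have "\<dots> = prodPQ J {i \<in> J. g i \<in> B}"
    unfolding prodPQ_def by (intro PiM_cong) auto
  finally show ?thesis .
qed

lemma measurable_reindex [measurable]:
  assumes "g \<in> J \<rightarrow> I"
  shows "(\<lambda>z. \<lambda>i\<in>J. z (g i)) \<in> PiP I \<rightarrow>\<^sub>M PiP J"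
  using assms by (intro measurable_restrict measurable_component_singleton) auto

text \<open>For a fixed permutation the selected \<open>r\<close> entries are independent with some
  label pattern. Averaging over permutations makes the pattern that of a uniform
  \<open>m\<close>-subset, whose probabilities are at most \<open>C\<close> times those of
  independent labels; averaged with the latter, the product laws give the mixture. The injection
  \<open>\<iota>\<close> selects the first or the second sample.\<close>

lemma contiguity:
  assumes mN: "m \<le> N" and rN: "r \<le> N" and \<iota>: "inj_on \<iota> {..<r}" "\<iota> ` {..<r} \<subseteq> {..<N}"
    and C: "0 \<le> C" "\<And>i. i \<le> N - r \<Longrightarrow> Bernstein (N - r) i p \<le> C * Bernstein N m p"
    and A: "A \<in> sets (PiP {..<r})"
  shows "perm_avg N (\<lambda>\<pi>. measure (prodPQ {..<N} {..<m})
      {z \<in> space (PiP {..<N}). (\<lambda>i\<in>{..<r}. z (\<pi> (\<iota> i))) \<in> A})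
    \<le> C * measure (PiPb {..<r}) A"
proof -
  define G where "G B = measure (prodPQ {..<r} B) A" for B
  define \<S> where "\<S> = {S. S \<subseteq> {..<N} \<and> card S = m}"
  have fin: "finite \<S>" unfolding \<S>_def by (rule finite_subset[of _ "Pow {..<N}"]) auto
  have law: "measure (prodPQ {..<N} {..<m}) {z \<in> space (PiP {..<N}). (\<lambda>i\<in>{..<r}. z (\<pi> (\<iota> i))) \<in> A}
      = G {i \<in> {..<r}. \<iota> i \<in> {i. i < N \<and> \<pi> i < m}}" if \<pi>: "\<pi> permutes {..<N}" for \<pi>
  proof -
    have g: "inj_on (\<lambda>i. \<pi> (\<iota> i)) {..<r}" "(\<lambda>i. \<pi> (\<iota> i)) \<in> {..<r} \<rightarrow> {..<N}"
      using \<iota> permutes_inj[OF \<pi>] permutes_in_image[OF \<pi>] by (auto simp: inj_on_def inj_def)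
    have "G {i \<in> {..<r}. \<pi> (\<iota> i) \<in> {..<m}}
       = measure (distr (prodPQ {..<N} {..<m}) (PiP {..<r}) (\<lambda>z. \<lambda>i\<in>{..<r}. z (\<pi> (\<iota> i)))) A"
      unfolding G_def by (simp add: distr_prodPQ_reindex[OF g])
    also have "\<dots> = measure (prodPQ {..<N} {..<m}) ((\<lambda>z. \<lambda>i\<in>{..<r}. z (\<pi> (\<iota> i))) -` A \<inter> space (prodPQ
        {..<N} {..<m}))"
      using measurable_reindex[OF g(2)] A by (intro measure_distr) auto
    also have "(\<lambda>z. \<lambda>i\<in>{..<r}. z (\<pi> (\<iota> i))) -` A \<inter> space (prodPQ {..<N} {..<m})
       = {z \<in> space (PiP {..<N}). (\<lambda>i\<in>{..<r}. z (\<pi> (\<iota> i))) \<in> A}" by auto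
    also have "{i \<in> {..<r}. \<pi> (\<iota> i) \<in> {..<m}} = {i \<in> {..<r}. \<iota> i \<in> {i. i < N \<and> \<pi> i < m}}"
      using \<iota> by auto
    finally show ?thesis ..
  qed
  have count: "real (card {S \<in> \<S>. {i \<in> {..<r}. \<iota> i \<in> S} = B}) / real (N choose m) \<le> C * wt {..<r} B"
    if B: "B \<in> Pow {..<r}" for B
  proof (cases "card B \<le> m")
    case True
    let ?T = "{T. T \<subseteq> {..<N} - \<iota> ` {..<r} \<and> card T = m - card B}"
    have finB: "finite B" using B finite_subset by auto
    have decomp: "S = \<iota> ` B \<union> (S - \<iota> ` {..<r})" if "{i \<in> {..<r}. \<iota> i \<in> S} = B" for S
      using that by auto
    \<comment> \<open>A label set with a prescribed trace on the selected positions is determined by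
      the rest, which has m - card B elements among the other N - r positions.\<close>
    have "card {S \<in> \<S>. {i \<in> {..<r}. \<iota> i \<in> S} = B} \<le> card ?T"
    proof (rule card_inj_on_le)
      show "inj_on (\<lambda>S. S - \<iota> ` {..<r}) {S \<in> \<S>. {i \<in> {..<r}. \<iota> i \<in> S} = B}"
        by (rule inj_onI) (metis (mono_tags, lifting) decomp mem_Collect_eq)
      show "(\<lambda>S. S - \<iota> ` {..<r}) ` {S \<in> \<S>. {i \<in> {..<r}. \<iota> i \<in> S} = B} \<subseteq> ?T"
      proof safe
        fix S assume S: "S \<in> \<S>" "B = {i \<in> {..<r}. \<iota> i \<in> S}"
        have "finite S" using S(1) by (auto simp: \<S>_def intro: finite_subset)
        then have "card S = card (\<iota> ` B) + card (S - \<iota> ` {..<r})"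
          using decomp[of S] S(2) finB by (subst decomp[of S], simp) (subst card_Un_disjoint, auto)
        moreover have "card (\<iota> ` B) = card B"
          using B by (intro card_image inj_on_subset[OF \<iota>(1)]) auto
        ultimately show "card (S - \<iota> ` {..<r}) = m - card {i \<in> {..<r}. \<iota> i \<in> S}"
          using S by (auto simp: \<S>_def)
      qed (auto simp: \<S>_def)
      show "finite ?T" by (rule finite_subset[of _ "Pow {..<N}"]) auto
    qed
    also have "card ?T = (N - r) choose (m - card B)"
      using \<iota> by (subst n_subsets) (auto simp: card_Diff_subset card_image)
    finally have "real (card {S \<in> \<S>. {i \<in> {..<r}. \<iota> i \<in> S} = B}) / real (N choose m)
        \<le> real ((N - r) choose (m - card B)) / real (N choose m)"
      by (intro divide_right_mono) auto
    also have "\<dots> \<le> C * (p ^ card B * (1 - p) ^ (r - card B))"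
      using B True card_mono[of "{..<r}" B]
      by (intro hypergeometric_over_binomial_le p mN rN C) auto
    also have "r - card B = card ({..<r} - B)" using B finB by (simp add: card_Diff_subset)
    finally show ?thesis by (simp add: wt_def)
  next
    case False
    have none: "{S \<in> \<S>. {i \<in> {..<r}. \<iota> i \<in> S} = B} = {}"
    proof safe
      fix S assume S: "S \<in> \<S>" "B = {i \<in> {..<r}. \<iota> i \<in> S}"
      have "card B = card (\<iota> ` B)" using B by (intro card_image[symmetric] inj_on_subset[OF \<iota>(1)]) auto
      also have "\<dots> \<le> card S" using S by (intro card_mono) (auto simp: \<S>_def intro: finite_subset)
      finally show "S \<in> {}" using S False by (simp add: \<S>_def)
    qed
    show ?thesis unfolding none using C(1) by simp
  qed
  have "perm_avg N (\<lambda>\<pi>. measure (prodPQ {..<N} {..<m})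
      {z \<in> space (PiP {..<N}). (\<lambda>i\<in>{..<r}. z (\<pi> (\<iota> i))) \<in> A})
    = perm_avg N (\<lambda>\<pi>. G {i \<in> {..<r}. \<iota> i \<in> {i. i < N \<and> \<pi> i < m}})"
    by (intro perm_avg_cong law)
  also have "\<dots> = (\<Sum>S\<in>\<S>. G {i \<in> {..<r}. \<iota> i \<in> S}) / (N choose m)"
    unfolding \<S>_def by (rule perm_avg_preimage[OF mN, of "\<lambda>S. G {i \<in> {..<r}. \<iota> i \<in> S}"])
  also have "(\<Sum>S\<in>\<S>. G {i \<in> {..<r}. \<iota> i \<in> S})
     = (\<Sum>B\<in>Pow {..<r}. \<Sum>S\<in>{S \<in> \<S>. {i \<in> {..<r}. \<iota> i \<in> S} = B}. G {i \<in> {..<r}. \<iota> i \<in> S})"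
    using fin by (intro sum.group[symmetric]) auto
  also have "\<dots> = (\<Sum>B\<in>Pow {..<r}. real (card {S \<in> \<S>. {i \<in> {..<r}. \<iota> i \<in> S} = B}) * G B)"
    by (intro sum.cong refl) simp
  also have "\<dots> / (N choose m) = (\<Sum>B\<in>Pow {..<r}. real (card {S \<in> \<S>. {i \<in> {..<r}. \<iota> i \<in> S}
      = B}) / (N choose m) * G B)"
    by (simp add: sum_divide_distrib)
  also have "\<dots> \<le> (\<Sum>B\<in>Pow {..<r}. (C * wt {..<r} B) * G B)"
    by (intro sum_mono mult_right_mono count) (auto simp: G_def)
  also have "\<dots> = C * measure (PiPb {..<r}) A"
    using A by (simp add: measure_PiM_mixture G_def sum_distrib_left mult.assoc)
  finally show ?thesis .
qed

end

section \<open>Coupling the pooled sample with a sample from the mixture\<close>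

context two_sample
begin

text \<open>For a symmetric function of the data only the number of labels \<open>P\<close> matters:
  a permutation that maps one label set to the other transports the product measures.\<close>

lemma integral_prodPQ_perm_invariant:
  fixes G :: "(nat \<Rightarrow> 'a) \<Rightarrow> real"
  assumes G: "G \<in> borel_measurable (PiP {..<N})"
    and inv: "\<And>\<tau> z. \<tau> permutes {..<N} \<Longrightarrow> z \<in> space (PiP {..<N}) \<Longrightarrow> G (\<lambda>i\<in>{..<N}. z (\<tau> i)) = G z"
    and B: "B \<subseteq> {..<N}" "B' \<subseteq> {..<N}" "card B = card B'"
  shows "(\<integral>z. G z \<partial>prodPQ {..<N} B) = (\<integral>z. G z \<partial>prodPQ {..<N} B')"
proof -
  obtain \<tau> where \<tau>: "\<tau> permutes {..<N}" "\<tau> ` B = B'"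
    using permutes_image_eq_exists[OF B] by auto
  have inj: "inj_on \<tau> {..<N}" "\<tau> \<in> {..<N} \<rightarrow> {..<N}"
    using permutes_inj_on[OF \<tau>(1)] permutes_in_image[OF \<tau>(1)] by auto
  have "{i \<in> {..<N}. \<tau> i \<in> B'} = B"
    using \<tau>(2) B(1) inj_image_mem_iff[OF permutes_inj[OF \<tau>(1)], of _ B] by auto
  then have "prodPQ {..<N} B = distr (prodPQ {..<N} B') (PiP {..<N}) (\<lambda>z. \<lambda>i\<in>{..<N}. z (\<tau> i))"
    using distr_prodPQ_reindex[OF inj, of B'] by simp
  then have "(\<integral>z. G z \<partial>prodPQ {..<N} B) = (\<integral>z. G z \<partial>distr (prodPQ {..<N} B') (PiP {..<N}) (\<lambda>z. \<lambda>i\<in>{..<N}.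
      z (\<tau> i)))"
    by simp
  also have "\<dots> = (\<integral>z. G (\<lambda>i\<in>{..<N}. z (\<tau> i)) \<partial>prodPQ {..<N} B')"
    using measurable_reindex[OF inj(2)] G by (intro integral_distr) auto
  also have "\<dots> = (\<integral>z. G z \<partial>prodPQ {..<N} B')"
    by (intro Bochner_Integration.integral_cong refl inv \<tau>) simp
  finally show ?thesis .
qed

text \<open>Labels are either only removed or only added, so no change is wasted.\<close>

lemma card_sym_diff_exists:
  fixes B :: "nat set"
  assumes "B \<subseteq> {..<N}" "m \<le> N"
  obtains B' where "B' \<subseteq> {..<N}" "card B' = m" "real (card ((B - B') \<union> (B' - B))) = \<bar>real (card B) - real m\<bar>"
proof (cases "m \<le> card B")
  case True
  then obtain B' where B': "B' \<subseteq> B" "card B' = m" by (metis obtain_subset_with_card_n)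
  have "finite B" using assms finite_subset by auto
  then have "card (B - B') = card B - m" using B' by (simp add: card_Diff_subset finite_subset)
  moreover have "(B - B') \<union> (B' - B) = B - B'" using B' by auto
  ultimately show ?thesis using True B' assms by (intro that[of B']) auto
next
  case False
  have fin: "finite B" using assms finite_subset by auto
  have "m - card B \<le> card ({..<N} - B)" using assms fin by (simp add: card_Diff_subset)
  then obtain C where C: "C \<subseteq> {..<N} - B" "card C = m - card B" by (metis obtain_subset_with_card_n)
  have finC: "finite C" using C finite_subset by auto
  have "card (B \<union> C) = m" using C fin finC False by (subst card_Un_disjoint) auto
  moreover have "(B - (B \<union> C)) \<union> ((B \<union> C) - B) = C" using C by auto
  ultimately show ?thesis using False C assms by (intro that[of "B \<union> C"]) auto
qed

text \<open>Both samples are read off from one array of independent pairs, coordinate \<open>i\<close> being taken from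
  \<open>P\<close> or from \<open>Q\<close> according to the label of \<open>i\<close>. An i.i.d. sample from the mixture has a binomial number of
  labels \<open>P\<close>, so only about \<open>sqrt N\<close> labels have to be changed in order to get exactly \<open>m\<close> of them.\<close>

lemma coupling:
  fixes G :: "(nat \<Rightarrow> 'a) \<Rightarrow> real" and f :: "'a \<Rightarrow> real"
  assumes G: "G \<in> borel_measurable (PiP {..<N})" "\<And>z. 0 \<le> G z" "\<And>z. G z \<le> b"
    and inv: "\<And>\<tau> z. \<tau> permutes {..<N} \<Longrightarrow> z \<in> space (PiP {..<N}) \<Longrightarrow> G (\<lambda>i\<in>{..<N}. z (\<tau> i)) = G z"
    and lip: "\<And>z z'. G z \<le> G z' + \<eta> + \<kappa> * (\<Sum>i<N. (f (z i) - f (z' i))\<^sup>2)" and \<kappa>: "0 \<le> \<kappa>"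
    and f: "f \<in> borel_measurable P" "integrable P (\<lambda>x. (f x)\<^sup>2)" "integrable Q (\<lambda>x. (f x)\<^sup>2)"
    and mN: "m \<le> N"
  shows "(\<integral>z. G z \<partial>prodPQ {..<N} {..<m}) \<le> (\<integral>z. G z \<partial>PiPb {..<N}) + \<eta>
    + \<kappa> * (2 * (\<integral>x. (f x)\<^sup>2 \<partial>P) + 2 * (\<integral>x. (f x)\<^sup>2 \<partial>Q)) * (\<Sum>k\<le>N. \<bar>real k - real m\<bar> * Bernstein N k p)"
proof -
  \<comment> \<open>Coordinate \<open>i\<close> owns two independent observations:
    \<open>Inl i\<close> with law \<open>P\<close> and \<open>Inr i\<close> with law
    \<open>Q\<close>. A label set decides which of the two is read.\<close>
  define K where "K = {..<N} <+> {..<N}"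
  define Mf where "Mf = case_sum (\<lambda>_::nat. P) (\<lambda>_::nat. Q)"
  define W where "W = PiM K Mf"
  define lab :: "nat set \<Rightarrow> nat \<Rightarrow> nat + nat" where "lab B i = (if i \<in> B then Inl i else Inr i)" for B i
  define T where "T B \<omega> = (\<lambda>i\<in>{..<N}. \<omega> (lab B i))" for B and \<omega> :: "nat + nat \<Rightarrow> 'a"
  \<comment> \<open>A bound for the mean squared change of \<open>f\<close> when one label is
    switched, from (x - y)^2 \<le> 2 x^2 + 2 y^2; no centring of \<open>f\<close> is
    involved.\<close>
  define V where "V = 2 * (\<integral>x. (f x)\<^sup>2 \<partial>P) + 2 * (\<integral>x. (f x)\<^sup>2 \<partial>Q)"
  define h where "h i \<omega> = (f (\<omega> (Inl i)) - f (\<omega> (Inr i)))\<^sup>2" for i and \<omega> :: "nat + nat \<Rightarrow> 'a"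
  have Mf: "prob_space (Mf i)" for i by (cases i) (auto simp: Mf_def P Q)
  interpret W: prob_space W unfolding W_def by (intro prob_space_PiM Mf)
  have fQ: "f \<in> borel_measurable Q" using f(1) by (simp add: measurable_def sets_Q space_Q)
  have lab: "inj_on (lab B) {..<N}" "lab B \<in> {..<N} \<rightarrow> K" for B
    by (auto simp: lab_def inj_on_def K_def split: if_splits)
  have setsM: "sets (PiM {..<N} (\<lambda>i. Mf (lab B i))) = sets (PiP {..<N})" for B
    by (intro sets_PiM_cong) (auto simp: Mf_def lab_def sets_Q)
  have T: "T B \<in> W \<rightarrow>\<^sub>M PiP {..<N}" for B
  proof -
    have "T B \<in> W \<rightarrow>\<^sub>M PiM {..<N} (\<lambda>i. Mf (lab B i))"
      unfolding T_def W_def using lab(2)[of B]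
      by (intro measurable_restrict measurable_component_singleton) auto
    then show ?thesis by (simp only: measurable_cong_sets[OF refl setsM])
  qed
  have law: "distr W (PiP {..<N}) (T B) = prodPQ {..<N} B" for B
  proof -
    have "distr W (PiP {..<N}) (T B) = distr W (PiM {..<N} (\<lambda>i. Mf (lab B i))) (T B)"
      by (intro distr_cong refl setsM[symmetric])
    also have "\<dots> = PiM {..<N} (\<lambda>i. Mf (lab B i))"
      unfolding W_def T_def by (intro distr_PiM_reindex Mf lab)
    also have "\<dots> = prodPQ {..<N} B"
      unfolding prodPQ_def by (intro PiM_cong) (auto simp: Mf_def lab_def)
    finally show ?thesis .
  qed
  have intG: "(\<integral>z. G z \<partial>prodPQ {..<N} B) = (\<integral>\<omega>. G (T B \<omega>) \<partial>W)" for B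
    unfolding law[symmetric] by (rule integral_distr[OF T G(1)])
  have GT: "integrable W (\<lambda>\<omega>. G (T B \<omega>))" for B
    using measurable_compose[OF T G(1)] G(2,3)
    by (intro W.integrable_const_bound[of _ b]) auto
  have sq: "integrable W (\<lambda>\<omega>. (f (\<omega> j))\<^sup>2)" "(\<integral>\<omega>. (f (\<omega> j))\<^sup>2 \<partial>W) = (\<integral>x. (f x)\<^sup>2 \<partial>Mf j)"
    and mj: "(\<lambda>\<omega>. f (\<omega> j)) \<in> borel_measurable W" if j: "j \<in> K" for j
  proof -
    have d: "distr W (Mf j) (\<lambda>\<omega>. \<omega> j) = Mf j" unfolding W_def by (rule distr_PiM_component[OF Mf j])
    have c: "(\<lambda>\<omega>. \<omega> j) \<in> W \<rightarrow>\<^sub>M Mf j" unfolding W_def using j by simp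
    have fm: "f \<in> borel_measurable (Mf j)" by (cases j) (auto simp: Mf_def f(1) fQ)
    have i: "integrable (Mf j) (\<lambda>x. (f x)\<^sup>2)" by (cases j) (auto simp: Mf_def f)
    have sm: "(\<lambda>x. (f x)\<^sup>2) \<in> borel_measurable (Mf j)" using fm by measurable
    show "integrable W (\<lambda>\<omega>. (f (\<omega> j))\<^sup>2)"
      using integrable_distr_eq[OF c sm] i d by simp
    show "(\<integral>\<omega>. (f (\<omega> j))\<^sup>2 \<partial>W) = (\<integral>x. (f x)\<^sup>2 \<partial>Mf j)"
      using integral_distr[OF c sm] d by simp
    show "(\<lambda>\<omega>. f (\<omega> j)) \<in> borel_measurable W" by (rule measurable_compose[OF c fm])
  qed
  have h: "integrable W (h i)" "(\<integral>\<omega>. h i \<omega> \<partial>W) \<le> V" if i: "i < N" for i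
  proof -
    have K: "Inl i \<in> K" "Inr i \<in> K" using i by (auto simp: K_def)
    have le: "h i \<omega> \<le> 2 * (f (\<omega> (Inl i)))\<^sup>2 + 2 * (f (\<omega> (Inr i)))\<^sup>2" for \<omega>
    proof -
      have "0 \<le> (f (\<omega> (Inl i)) + f (\<omega> (Inr i)))\<^sup>2" by simp
      then show ?thesis by (simp add: h_def power2_eq_square algebra_simps)
    qed
    have I: "integrable W (\<lambda>\<omega>. 2 * (f (\<omega> (Inl i)))\<^sup>2 + 2 * (f (\<omega> (Inr i)))\<^sup>2)"
      using sq(1)[OF K(1)] sq(1)[OF K(2)] by auto
    note [measurable] = mj[OF K(1)] mj[OF K(2)]
    have "(\<lambda>\<omega>. h i \<omega>) \<in> borel_measurable W" unfolding h_def by measurable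
    then show hi: "integrable W (h i)"
      by (rule Bochner_Integration.integrable_bound[OF I])
        (use le in \<open>auto simp: h_def intro!: AE_I2\<close>)
    have "(\<integral>\<omega>. h i \<omega> \<partial>W) \<le> (\<integral>\<omega>. 2 * (f (\<omega> (Inl i)))\<^sup>2 + 2 * (f (\<omega> (Inr i)))\<^sup>2 \<partial>W)"
      by (intro integral_mono hi I le)
    also have "\<dots> = V" using sq[OF K(1)] sq[OF K(2)] by (simp add: V_def Mf_def)
    finally show "(\<integral>\<omega>. h i \<omega> \<partial>W) \<le> V" .
  qed
  have step: "(\<integral>z. G z \<partial>prodPQ {..<N} {..<m}) \<le> (\<integral>z. G z \<partial>prodPQ {..<N} B) + \<eta> + \<kappa> * V * \<bar>real (card B)
      - real m\<bar>"
    if B: "B \<subseteq> {..<N}" for B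
  proof -
    obtain B' where B': "B' \<subseteq> {..<N}" "card B' = m"
      and D: "real (card ((B - B') \<union> (B' - B))) = \<bar>real (card B) - real m\<bar>"
      by (rule card_sym_diff_exists[OF B mN])
    let ?D = "(B - B') \<union> (B' - B)"
    have DN: "?D \<subseteq> {..<N}" using B B' by auto
    have le: "G (T B' \<omega>) \<le> G (T B \<omega>) + \<eta> + \<kappa> * (\<Sum>i\<in>?D. h i \<omega>)" for \<omega>
    proof -
      \<comment> \<open>The two samples read the same observation wherever the labels agree, so only
        the symmetric difference contributes.\<close>
      have "(\<Sum>i<N. (f (T B' \<omega> i) - f (T B \<omega> i))\<^sup>2) = (\<Sum>i<N. if i \<in> ?D then h i \<omega> else 0)"
        by (intro sum.cong refl) (auto simp: T_def lab_def h_def power2_commute)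
      also have "\<dots> = (\<Sum>i\<in>?D. h i \<omega>)"
        using DN by (intro sum.mono_neutral_cong_right) auto
      finally show ?thesis using lip[of "T B' \<omega>" "T B \<omega>"] by simp
    qed
    have hI: "integrable W (\<lambda>\<omega>. \<Sum>i\<in>?D. h i \<omega>)" using h DN by (intro Bochner_Integration.integrable_sum) auto
    have "(\<integral>\<omega>. (\<Sum>i\<in>?D. h i \<omega>) \<partial>W) = (\<Sum>i\<in>?D. \<integral>\<omega>. h i \<omega> \<partial>W)"
      using h DN by (intro Bochner_Integration.integral_sum) auto
    also have "\<dots> \<le> (\<Sum>i\<in>?D. V)" using h DN by (intro sum_mono) auto
    also have "\<dots> = V * \<bar>real (card B) - real m\<bar>" using D by simp
    finally have hV: "(\<integral>\<omega>. (\<Sum>i\<in>?D. h i \<omega>) \<partial>W) \<le> V * \<bar>real (card B) - real m\<bar>" .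
    \<comment> \<open>By symmetry all label sets of size \<open>m\<close> give the same integral, so
      \<open>B'\<close> may be chosen depending on \<open>B\<close>.\<close>
    have "(\<integral>z. G z \<partial>prodPQ {..<N} {..<m}) = (\<integral>z. G z \<partial>prodPQ {..<N} B')"
      using B' mN by (intro integral_prodPQ_perm_invariant[OF G(1) inv]) auto
    also have "\<dots> = (\<integral>\<omega>. G (T B' \<omega>) \<partial>W)" by (rule intG)
    also have "\<dots> \<le> (\<integral>\<omega>. G (T B \<omega>) + \<eta> + \<kappa> * (\<Sum>i\<in>?D. h i \<omega>) \<partial>W)"
      using GT hI le by (intro integral_mono) auto
    also have "\<dots> = (\<integral>\<omega>. G (T B \<omega>) \<partial>W) + \<eta> + \<kappa> * (\<integral>\<omega>. (\<Sum>i\<in>?D. h i \<omega>) \<partial>W)"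
      using GT[of B] hI by (simp add: W.prob_space)
    also have "\<dots> \<le> (\<integral>\<omega>. G (T B \<omega>) \<partial>W) + \<eta> + \<kappa> * (V * \<bar>real (card B) - real m\<bar>)"
      using hV \<kappa> by (intro add_left_mono mult_left_mono)
    also have "(\<integral>\<omega>. G (T B \<omega>) \<partial>W) = (\<integral>z. G z \<partial>prodPQ {..<N} B)" by (rule intG[symmetric])
    finally show ?thesis by (simp add: mult.assoc)
  qed
  have w1: "(\<Sum>B\<in>Pow {..<N}. wt {..<N} B) = 1"
    using sum_Pow_Bernstein[of "{..<N}" p "\<lambda>_. 1"] by (simp add: wt_def)
  \<comment> \<open>Now average over independent labels: the integrals combine to that under the
    mixture, and the cost becomes a mean of |k - m| under the binomial law.\<close>
  have "(\<integral>z. G z \<partial>prodPQ {..<N} {..<m}) = (\<Sum>B\<in>Pow {..<N}. wt {..<N} B * (\<integral>z. G z \<partial>prodPQ {..<N} {..<m}))"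
    by (simp only: sum_distrib_right[symmetric] w1 mult_1_left)
  also have "\<dots> \<le> (\<Sum>B\<in>Pow {..<N}. wt {..<N} B * ((\<integral>z. G z \<partial>prodPQ {..<N} B) + \<eta> + \<kappa> * V * \<bar>real (card B)
      - real m\<bar>))"
    by (intro sum_mono mult_left_mono step) auto
  also have "\<dots> = (\<Sum>B\<in>Pow {..<N}. wt {..<N} B * (\<integral>z. G z \<partial>prodPQ {..<N} B)) + \<eta> * (\<Sum>B\<in>Pow {..<N}. wt {..<N} B)
     + \<kappa> * V * (\<Sum>B\<in>Pow {..<N}. wt {..<N} B * \<bar>real (card B) - real m\<bar>)"
    by (simp only: distrib_left sum.distrib sum_distrib_left mult_ac)
  also have "(\<Sum>B\<in>Pow {..<N}. wt {..<N} B * (\<integral>z. G z \<partial>prodPQ {..<N} B)) = (\<integral>z. G z \<partial>PiPb {..<N})"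
    by (rule integral_PiM_mixture[symmetric, OF _ G]) simp
  also have "(\<Sum>B\<in>Pow {..<N}. wt {..<N} B * \<bar>real (card B) - real m\<bar>)
      = (\<Sum>k\<le>N. \<bar>real k - real m\<bar> * Bernstein N k p)"
    using sum_Pow_Bernstein[of "{..<N}" p "\<lambda>k. \<bar>real k - real m\<bar>"] by (simp add: wt_def)
  finally show ?thesis by (simp add: w1 V_def)
qed

end

section \<open>Characteristic functions of permutation distributions\<close>

lemma exp_minus_le_quadratic:
  assumes "0 \<le> (x::real)"
  shows "\<bar>exp (- x) - (1 - x)\<bar> \<le> x\<^sup>2 / 2"
proof -
  have l: "1 - x \<le> exp (- x)" using exp_ge_add_one_self[of "- x"] by simp
  have q: "1 + x + x\<^sup>2 / 2 \<le> exp x" using exp_lower_Taylor_quadratic[OF assms] .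
  have p: "0 < 1 + x + x\<^sup>2 / 2" using assms by (simp add: add_pos_nonneg)
  have "exp (- x) \<le> 1 / (1 + x + x\<^sup>2 / 2)"
    unfolding exp_minus inverse_eq_divide by (rule divide_left_mono[OF q]) (use p in auto)
  also have "\<dots> \<le> 1 - x + x\<^sup>2 / 2"
  proof -
    have "(1 - x + x\<^sup>2 / 2) * (1 + x + x\<^sup>2 / 2) = 1 + (x\<^sup>2)\<^sup>2 / 4"
      by (simp add: power2_eq_square algebra_simps)
    moreover have "0 \<le> (x\<^sup>2)\<^sup>2 / 4" by simp
    ultimately have "1 \<le> (1 - x + x\<^sup>2 / 2) * (1 + x + x\<^sup>2 / 2)" by linarith
    then show ?thesis using p by (simp add: pos_divide_le_eq)
  qed
  finally show ?thesis using l by simp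
qed

lemma exp_minus_Lipschitz:
  assumes "0 \<le> (x::real)" "0 \<le> y"
  shows "\<bar>exp (- x) - exp (- y)\<bar> \<le> \<bar>x - y\<bar>"
proof -
  have *: "exp (- a) - exp (- b) \<le> b - a" if "0 \<le> a" "a \<le> b" for a b :: real
  proof -
    have "1 - exp (- (b - a)) \<le> b - a" using exp_ge_add_one_self[of "- (b - a)"] by linarith
    moreover have "0 \<le> 1 - exp (- (b - a))" using that by simp
    moreover have "exp (- a) - exp (- b) = exp (- a) * (1 - exp (- (b - a)))"
      by (simp add: algebra_simps flip: exp_add)
    moreover have "exp (- a) \<le> 1" using that by simp
    ultimately show ?thesis using mult_left_le_one_le[of "1 - exp (- (b - a))" "exp (- a)"] by simp
  qed
  show ?thesis
  proof (cases "x \<le> y")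
    case True
    then show ?thesis using *[of x y] assms by simp
  next
    case False
    then show ?thesis using *[of y x] assms by simp
  qed
qed

lemma norm_iexp_diff_le: "cmod (iexp a - iexp b) \<le> \<bar>a - b\<bar>"
proof -
  have "iexp a - iexp b = iexp b * (iexp (a - b) - 1)"
    by (simp add: algebra_simps flip: exp_add)
  then have "cmod (iexp a - iexp b) = cmod (iexp (a - b) - 1)"
    by (simp add: norm_mult)
  also have "\<dots> \<le> \<bar>a - b\<bar>" using iexp_approx1[of "a - b" 0] by simp
  finally show ?thesis .
qed

text \<open>The remainder of the second order expansion is t^2 / 6 times a truncated moment that
  tends to 0 by dominated convergence. The expansion is stated with the normal characteristic
  function instead of 1 - v t^2 / 2, because normal factors multiply exactly and stay in the unit
  disc.\<close>

lemma (in prob_space) char_near_0: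
  assumes X [measurable]: "random_variable borel X"
    and i: "integrable M X" "integrable M (\<lambda>x. (X x)\<^sup>2)" "expectation X = 0" and \<epsilon>: "0 < \<epsilon>"
  obtains \<delta> where "0 < \<delta>" "\<And>t. \<bar>t\<bar> \<le> \<delta> \<Longrightarrow>
    cmod (char (distr M borel X) t - exp (- (expectation (\<lambda>x. (X x)\<^sup>2) * t\<^sup>2 / 2))) \<le> \<epsilon> * t\<^sup>2"
proof -
  define v where "v = expectation (\<lambda>x. (X x)\<^sup>2)"
  have v0: "0 \<le> v" unfolding v_def by simp
  define u where "u t = expectation (\<lambda>x. min (6 * (X x)\<^sup>2) (t * \<bar>X x\<bar> ^ 3))" for t :: real
  have imin: "integrable M (\<lambda>x. min (6 * (X x)\<^sup>2) (t * \<bar>X x\<bar> ^ 3))" if "0 \<le> t" for t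
  proof (rule Bochner_Integration.integrable_bound[of M "\<lambda>x. 6 * (X x)\<^sup>2"])
    have *: "\<bar>min a b\<bar> \<le> \<bar>a\<bar>" if "0 \<le> a" "0 \<le> b" for a b :: real using that by (simp add: min_def)
    show "AE x in M. norm (min (6 * (X x)\<^sup>2) (t * \<bar>X x\<bar> ^ 3)) \<le> norm (6 * (X x)\<^sup>2)"
      unfolding real_norm_def using that by (intro AE_I2 *) auto
  qed (use i in auto)
  have "(\<lambda>j. u (inverse (real (Suc j)))) \<longlonglongrightarrow> expectation (\<lambda>x. 0)"
    unfolding u_def
  proof (rule integral_dominated_convergence[where w="\<lambda>x. 6 * (X x)\<^sup>2"])
    show "AE x in M. (\<lambda>j. min (6 * (X x)\<^sup>2) (inverse (real (Suc j)) * \<bar>X x\<bar> ^ 3)) \<longlonglongrightarrow> 0"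
    proof (rule AE_I2)
      fix x
      have "(\<lambda>j. inverse (real (Suc j)) * \<bar>X x\<bar> ^ 3) \<longlonglongrightarrow> 0 * \<bar>X x\<bar> ^ 3"
        by (intro tendsto_intros LIMSEQ_inverse_real_of_nat)
      then have "(\<lambda>j. min (6 * (X x)\<^sup>2) (inverse (real (Suc j)) * \<bar>X x\<bar> ^ 3))
          \<longlonglongrightarrow> min (6 * (X x)\<^sup>2) (0 * \<bar>X x\<bar> ^ 3)"
        by (rule tendsto_min[OF tendsto_const])
      moreover have "min (6 * (X x)\<^sup>2) (0 * \<bar>X x\<bar> ^ 3) = 0" by simp
      ultimately show "(\<lambda>j. min (6 * (X x)\<^sup>2) (inverse (real (Suc j)) * \<bar>X x\<bar> ^ 3)) \<longlonglongrightarrow> 0" by (simp only:)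
    qed
  qed (use i in auto)
  then have "eventually (\<lambda>j. u (inverse (real (Suc j))) < 3 * \<epsilon>) sequentially"
    using \<epsilon> by (intro order_tendstoD) auto
  then obtain j where j: "u (inverse (real (Suc j))) < 3 * \<epsilon>" by (auto simp: eventually_sequentially)
  \<comment> \<open>The first term makes the truncated moment small; the second makes the quadratic
    error (v t^2 / 2)^2 / 2 at most \<epsilon> t^2 / 2. The 1 added to v^2 covers v = 0.\<close>
  define \<delta> where "\<delta> = min (inverse (real (Suc j))) (sqrt (4 * \<epsilon> / (v\<^sup>2 + 1)))"
  have v1: "0 < v\<^sup>2 + 1" by (simp add: add_nonneg_pos)
  have \<delta>0: "0 < \<delta>" using \<epsilon> v1 by (simp add: \<delta>_def)
  have "cmod (char (distr M borel X) t - exp (- (v * t\<^sup>2 / 2))) \<le> \<epsilon> * t\<^sup>2" if t: "\<bar>t\<bar> \<le> \<delta>" for t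
  proof -
    have "u \<bar>t\<bar> \<le> u (inverse (real (Suc j)))"
      unfolding u_def using t by (intro integral_mono imin min.mono mult_right_mono) (auto simp: \<delta>_def)
    then have ut: "u \<bar>t\<bar> \<le> 3 * \<epsilon>" using j by simp
    have "cmod (char (distr M borel X) t - (1 - t\<^sup>2 * v / 2)) \<le> t\<^sup>2 / 6 * u \<bar>t\<bar>"
      unfolding u_def using i by (intro char_approx3') (auto simp: v_def)
    also have "\<dots> \<le> t\<^sup>2 / 6 * (3 * \<epsilon>)"
      using ut by (intro mult_left_mono) auto
    finally have 1: "cmod (char (distr M borel X) t - (1 - t\<^sup>2 * v / 2)) \<le> \<epsilon> * t\<^sup>2 / 2"
      by (simp add: mult.commute)
    have "t\<^sup>2 \<le> \<delta>\<^sup>2" using t by (intro abs_le_square_iff[THEN iffD1]) auto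
    also have "\<dots> \<le> (sqrt (4 * \<epsilon> / (v\<^sup>2 + 1)))\<^sup>2" using \<delta>0 by (intro power_mono) (auto simp: \<delta>_def)
    also have "\<dots> = 4 * \<epsilon> / (v\<^sup>2 + 1)" using \<epsilon> v1 by simp
    finally have "t\<^sup>2 * (v\<^sup>2 + 1) \<le> 4 * \<epsilon>" using v1 by (simp add: pos_le_divide_eq)
    moreover have "t\<^sup>2 * v\<^sup>2 \<le> t\<^sup>2 * (v\<^sup>2 + 1)" by (intro mult_left_mono) auto
    ultimately have tv: "t\<^sup>2 * v\<^sup>2 \<le> 4 * \<epsilon>" by linarith
    have "cmod ((1 - t\<^sup>2 * v / 2) - exp (- (v * t\<^sup>2 / 2))) = \<bar>exp (- (v * t\<^sup>2 / 2)) - (1 - v * t\<^sup>2 / 2)\<bar>"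
    proof -
      have "complex_of_real (1 - t\<^sup>2 * v / 2) - exp (- (v * t\<^sup>2 / 2)) = complex_of_real ((1 - v * t\<^sup>2 / 2)
          - exp (- (v * t\<^sup>2 / 2)))"
        by (simp add: mult.commute)
      then show ?thesis by (simp only: norm_of_real abs_minus_commute mult.commute)
    qed
    also have "\<dots> \<le> (v * t\<^sup>2 / 2)\<^sup>2 / 2" using v0 by (intro exp_minus_le_quadratic) simp
    also have "\<dots> = (t\<^sup>2 * v\<^sup>2) * t\<^sup>2 / 8" by (simp add: power2_eq_square)
    also have "\<dots> \<le> (4 * \<epsilon>) * t\<^sup>2 / 8" using tv by (intro divide_right_mono mult_right_mono) auto
    finally have 2: "cmod ((1 - t\<^sup>2 * v / 2) - exp (- (v * t\<^sup>2 / 2))) \<le> \<epsilon> * t\<^sup>2 / 2" by simp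
    show ?thesis
      using norm_triangle_le[of "char (distr M borel X) t - (1 - t\<^sup>2 * v / 2)" "(1 - t\<^sup>2 * v / 2)
          - exp (- (v * t\<^sup>2 / 2))" "\<epsilon> * t\<^sup>2"] 1 2
      by simp
  qed
  then show ?thesis using that \<delta>0 unfolding v_def by blast
qed

lemma (in prob_space) expectation_iexp_PiM:
  assumes [measurable]: "random_variable borel X" and "finite I"
  shows "(\<integral>z. iexp (\<Sum>j\<in>I. a j * X (z j)) \<partial>PiM I (\<lambda>_. M)) = (\<Prod>j\<in>I. char (distr M borel X) (a j))"
proof -
  interpret product_sigma_finite "\<lambda>_. M" by standard
  have "(\<integral>z. iexp (\<Sum>j\<in>I. a j * X (z j)) \<partial>PiM I (\<lambda>_. M)) = (\<integral>z. (\<Prod>j\<in>I. iexp (a j * X (z j))) \<partial>PiM I (\<lambda>_. M))"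
    using assms(2) by (simp add: sum_distrib_left exp_sum)
  also have "\<dots> = (\<Prod>j\<in>I. \<integral>x. iexp (a j * X x) \<partial>M)"
    using assms(2) by (intro product_integral_prod) (auto intro!: integrable_const_bound[where B=1])
  also have "\<dots> = (\<Prod>j\<in>I. char (distr M borel X) (a j))"
    by (simp add: char_def integral_distr)
  finally show ?thesis .
qed

text \<open>For factors in the unit disc the distance of two products is at most the sum of the
  distances of the factors.\<close>

lemma prod_char_approx:
  fixes \<phi> :: "real \<Rightarrow> complex"
  assumes "\<And>t. cmod (\<phi> t) \<le> 1" "0 \<le> v"
    and "\<And>j. j \<in> I \<Longrightarrow> cmod (\<phi> (a j) - exp (- (v * (a j)\<^sup>2 / 2))) \<le> \<epsilon> * (a j)\<^sup>2"
    and "finite I"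
  shows "cmod ((\<Prod>j\<in>I. \<phi> (a j)) - exp (- (v * (\<Sum>j\<in>I. (a j)\<^sup>2) / 2))) \<le> \<epsilon> * (\<Sum>j\<in>I. (a j)\<^sup>2)"
proof -
  have "complex_of_real (exp (- (v * (\<Sum>j\<in>I. (a j)\<^sup>2) / 2)))
      = (\<Prod>j\<in>I. complex_of_real (exp (- (v * (a j)\<^sup>2 / 2))))"
  proof -
    have "- (v * (\<Sum>j\<in>I. (a j)\<^sup>2) / 2) = (\<Sum>j\<in>I. - (v * (a j)\<^sup>2 / 2))"
      by (simp add: sum_distrib_left sum_divide_distrib sum_negf)
    then have "exp (- (v * (\<Sum>j\<in>I. (a j)\<^sup>2) / 2)) = (\<Prod>j\<in>I. exp (- (v * (a j)\<^sup>2 / 2)))"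
      using assms(4) by (simp only: exp_sum)
    then show ?thesis by (simp only: of_real_prod)
  qed
  then have "cmod ((\<Prod>j\<in>I. \<phi> (a j)) - exp (- (v * (\<Sum>j\<in>I. (a j)\<^sup>2) / 2)))
     = cmod ((\<Prod>j\<in>I. \<phi> (a j)) - (\<Prod>j\<in>I. complex_of_real (exp (- (v * (a j)\<^sup>2 / 2)))))"
    by simp
  also have "\<dots> \<le> (\<Sum>j\<in>I. cmod (\<phi> (a j) - exp (- (v * (a j)\<^sup>2 / 2))))"
    using assms by (intro norm_prod_diff) (auto simp: norm_exp_eq_Re)
  also have "\<dots> \<le> (\<Sum>j\<in>I. \<epsilon> * (a j)\<^sup>2)" by (intro sum_mono assms)
  finally show ?thesis by (simp add: sum_distrib_left)
qed

section \<open>Permutation characteristic functions of linear statistics\<close>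

definition lin_stat :: "nat \<Rightarrow> (nat \<Rightarrow> real) \<Rightarrow> ('a \<Rightarrow> real) \<Rightarrow> (nat \<Rightarrow> 'a) \<Rightarrow> (nat \<Rightarrow> nat) \<Rightarrow> real" where
  "lin_stat N c f z \<pi> = (\<Sum>i<N. c i * f (z (\<pi> i)))"

definition perm_char :: "nat \<Rightarrow> (nat \<Rightarrow> real) \<Rightarrow> ('a \<Rightarrow> real) \<Rightarrow> real \<Rightarrow> (nat \<Rightarrow> 'a) \<Rightarrow> complex" where
  "perm_char N c f s z = perm_avg N (\<lambda>\<pi>. iexp (s * lin_stat N c f z \<pi>))"

text \<open>Moving the permutation from the data to the coefficients leaves a sum over independent
  observations, whose characteristic function factors.\<close>

lemma lin_stat_inv:
  assumes "\<pi> permutes {..<N}"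
  shows "lin_stat N c f z \<pi> = (\<Sum>j<N. c (inv \<pi> j) * f (z j))"
  unfolding lin_stat_def
  using sum_permutes_eq[OF assms, of "\<lambda>j. c (inv \<pi> j) * f (z j)"] permutes_inverses[OF assms] by simp

lemma cmod_perm_char_le: "cmod (perm_char N c f s z) \<le> 1"
  using norm_perm_avg_le[of N "\<lambda>\<pi>. iexp (s * lin_stat N c f z \<pi>)"] by (simp add: perm_char_def)

lemma integrable_perm_avg:
  fixes F :: "(nat \<Rightarrow> nat) \<Rightarrow> 'z \<Rightarrow> 'b::{real_normed_field, banach, second_countable_topology}"
  assumes "\<And>\<pi>. \<pi> permutes {..<N} \<Longrightarrow> integrable M (F \<pi>)"
  shows "integrable M (\<lambda>z. perm_avg N (\<lambda>\<pi>. F \<pi> z))"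
    and "(\<integral>z. perm_avg N (\<lambda>\<pi>. F \<pi> z) \<partial>M) = perm_avg N (\<lambda>\<pi>. \<integral>z. F \<pi> z \<partial>M)"
proof -
  have i: "integrable M (\<lambda>z. \<Sum>\<pi> | \<pi> permutes {..<N}. F \<pi> z)"
    by (intro Bochner_Integration.integrable_sum) (simp add: assms)
  then show "integrable M (\<lambda>z. perm_avg N (\<lambda>\<pi>. F \<pi> z))"
    unfolding perm_avg_def by (intro integrable_divide_zero)
  show "(\<integral>z. perm_avg N (\<lambda>\<pi>. F \<pi> z) \<partial>M) = perm_avg N (\<lambda>\<pi>. \<integral>z. F \<pi> z \<partial>M)"
    unfolding perm_avg_def integral_divide_zero
    by (subst Bochner_Integration.integral_sum) (simp_all add: assms)
qed

text \<open>The mean square only involves the expectations of \<open>perm_char\<close> and of its squared modulus; the latter is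
  an average over two permutations, and as the coefficients sum to \<open>0\<close>, two random rearrangements
  of them are nearly orthogonal, which makes it asymptotically a product.\<close>

lemma (in prob_space) perm_char_mean_square:
  assumes X [measurable]: "random_variable borel X"
    and v: "expectation (\<lambda>x. (X x)\<^sup>2) = v"
    and \<delta>: "\<And>t. \<bar>t\<bar> \<le> \<delta> \<Longrightarrow> cmod (char (distr M borel X) t - exp (- (v * t\<^sup>2 / 2))) \<le> \<epsilon> * t\<^sup>2"
    and \<epsilon>: "0 \<le> \<epsilon>" and N: "2 \<le> N" and c0: "(\<Sum>i<N. c i) = 0" and c: "\<And>i. i < N \<Longrightarrow> 2 * \<bar>s\<bar> * \<bar>c i\<bar> \<le> \<delta>"
    and S: "S = (\<Sum>i<N. (c i)\<^sup>2)" and r: "0 < r"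
  shows "(\<integral>z. (cmod (perm_char N c X s z - exp (- (s\<^sup>2 / 2))))\<^sup>2 \<partial>PiM {..<N} (\<lambda>_. M))
    \<le> 6 * \<epsilon> * s\<^sup>2 * S + 2 * s\<^sup>2 * \<bar>v * S - 1\<bar> + v * s\<^sup>2 * (S\<^sup>2 / (2 * r * (real N - 1)) + r / 2)"
proof -
  let ?M = "PiM {..<N} (\<lambda>_. M)"
  let ?\<phi> = "char (distr M borel X)"
  let ?L = "lin_stat N c X" and ?C = "perm_char N c X s"
  let ?\<Pi> = "\<lambda>\<pi>. \<Prod>j<N. char (distr M borel X) (s * (c j - c (\<pi> j)))"
  let ?g = "exp (- (s\<^sup>2 / 2)) :: real"
  interpret PM: prob_space ?M by (intro prob_space_PiM prob_space_axioms)
  interpret D: real_distribution "distr M borel X" by (rule real_distribution_distr) simp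
  have \<phi>1: "cmod (?\<phi> t) \<le> 1" for t by (rule D.cmod_char_le_1)
  have v0: "0 \<le> v" unfolding v[symmetric] by simp
  have S0: "0 \<le> S" unfolding S by (intro sum_nonneg) simp
  have Lm [measurable]: "(\<lambda>z. ?L z \<pi>) \<in> borel_measurable ?M" if "\<pi> permutes {..<N}" for \<pi>
  proof -
    have [measurable]: "(\<lambda>z. z (\<pi> i)) \<in> ?M \<rightarrow>\<^sub>M M" if "i < N" for i
      using permutes_in_image[OF \<open>\<pi> permutes {..<N}\<close>, of i] that by (intro measurable_component_singleton) simp
    show ?thesis unfolding lin_stat_def by measurable
  qed
  have ii: "integrable ?M (\<lambda>z. iexp (s * ?L z \<pi>))" if "\<pi> permutes {..<N}" for \<pi>
    using Lm[OF that] by (intro PM.integrable_const_bound[where B=1]) auto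
  have ii2: "integrable ?M (\<lambda>z. iexp (s * (?L z \<pi> - ?L z \<pi>')))"
    if "\<pi> permutes {..<N}" "\<pi>' permutes {..<N}" for \<pi> \<pi>'
    using Lm[OF that(1)] Lm[OF that(2)] by (intro PM.integrable_const_bound[where B=1]) auto
  define A where "A = (\<Prod>i<N. ?\<phi> (s * c i))"
  define X' where "X' \<pi> = (\<Sum>i<N. c i * c (\<pi> i))" for \<pi>
  define B where "B = perm_avg N ?\<Pi>"
  \<comment> \<open>The product over all coefficients does not depend on their order, so every
    permutation contributes the same expectation.\<close>
  have EA: "(\<integral>z. ?C z \<partial>?M) = A"
  proof -
    have "(\<integral>z. iexp (s * ?L z \<pi>) \<partial>?M) = A" if \<pi>: "\<pi> permutes {..<N}" for \<pi>
    proof -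
      have "(\<integral>z. iexp (s * ?L z \<pi>) \<partial>?M) = (\<integral>z. iexp (\<Sum>j<N. (s * c (inv \<pi> j)) * X (z j)) \<partial>?M)"
        by (simp add: lin_stat_inv[OF \<pi>] sum_distrib_left mult.assoc)
      also have "\<dots> = (\<Prod>j<N. ?\<phi> (s * c (inv \<pi> j)))" by (rule expectation_iexp_PiM) auto
      also have "\<dots> = A"
        using prod.permute[OF permutes_inv[OF \<pi>], of "\<lambda>j. ?\<phi> (s * c j)"] by (simp add: A_def comp_def)
      finally show ?thesis .
    qed
    then show ?thesis
      unfolding perm_char_def using integrable_perm_avg(2)[of N ?M "\<lambda>\<pi> z. iexp (s * ?L z \<pi>)"] ii
      by (simp cong: perm_avg_cong)
  qed
  have sq: "complex_of_real ((cmod (?C z))\<^sup>2) =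
      perm_avg N (\<lambda>\<pi>'. perm_avg N (\<lambda>\<pi>. iexp (s * (?L z \<pi> - ?L z \<pi>'))))" for z
  proof -
    have "cnj (?C z) = perm_avg N (\<lambda>\<pi>. iexp (- (s * ?L z \<pi>)))"
      by (simp add: perm_char_def perm_avg_def exp_cnj)
    then have "complex_of_real ((cmod (?C z))\<^sup>2)
      = ?C z * perm_avg N (\<lambda>\<pi>'. iexp (- (s * ?L z \<pi>')))"
      by (simp only: complex_norm_square)
    also have "\<dots> = perm_avg N (\<lambda>\<pi>'. perm_avg N (\<lambda>\<pi>. iexp (- (s * ?L z \<pi>')) * iexp (s * ?L z \<pi>)))"
      unfolding perm_avg_cmult perm_char_def[symmetric]
      unfolding perm_avg_cmult[of N "?C z", symmetric] by (intro perm_avg_cong mult.commute)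
    also have "\<dots> = perm_avg N (\<lambda>\<pi>'. perm_avg N (\<lambda>\<pi>. iexp (s * (?L z \<pi> - ?L z \<pi>'))))"
      by (simp add: algebra_simps flip: exp_add)
    finally show ?thesis .
  qed
  have EB: "complex_of_real (\<integral>z. (cmod (?C z))\<^sup>2 \<partial>?M) = B"
  proof -
    \<comment> \<open>After reindexing by \<open>\<pi>\<close>, an observation carries the
      coefficients \<open>c j\<close> and \<open>c (inv \<pi>' (\<pi> j))\<close>. The expectation
      depends on the relative permutation only, and this is uniform when \<open>\<pi>\<close>
      is.\<close>
    have two: "(\<integral>z. iexp (s * (?L z \<pi> - ?L z \<pi>')) \<partial>?M) = ?\<Pi> (inv \<pi>' \<circ> \<pi>)"
      if \<pi>: "\<pi> permutes {..<N}" and \<pi>': "\<pi>' permutes {..<N}" for \<pi> \<pi>'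
    proof -
      have "(\<integral>z. iexp (s * (?L z \<pi> - ?L z \<pi>')) \<partial>?M)
        = (\<integral>z. iexp (\<Sum>j<N. (s * (c (inv \<pi> j) - c (inv \<pi>' j))) * X (z j)) \<partial>?M)"
        by (simp add: lin_stat_inv[OF \<pi>] lin_stat_inv[OF \<pi>'] sum_distrib_left sum_subtractf[symmetric]
            algebra_simps)
      also have "\<dots> = (\<Prod>j<N. ?\<phi> (s * (c (inv \<pi> j) - c (inv \<pi>' j))))" by (rule expectation_iexp_PiM) auto
      also have "\<dots> = ?\<Pi> (inv \<pi>' \<circ> \<pi>)"
        using prod.permute[OF \<pi>, of "\<lambda>j. ?\<phi> (s * (c (inv \<pi> j) - c (inv \<pi>' j)))"] permutes_inverses[OF \<pi>]
        by (simp add: comp_def)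
      finally show ?thesis .
    qed
    have "complex_of_real (\<integral>z. (cmod (?C z))\<^sup>2 \<partial>?M)
      = (\<integral>z. perm_avg N (\<lambda>\<pi>'. perm_avg N (\<lambda>\<pi>. iexp (s * (?L z \<pi> - ?L z \<pi>')))) \<partial>?M)"
      unfolding sq[symmetric] by (rule integral_complex_of_real[symmetric])
    also have "\<dots> = perm_avg N (\<lambda>\<pi>'. perm_avg N (\<lambda>\<pi>. \<integral>z. iexp (s * (?L z \<pi> - ?L z \<pi>')) \<partial>?M))"
      by (subst integrable_perm_avg(2), (intro integrable_perm_avg(1) ii2; assumption))
        (intro perm_avg_cong integrable_perm_avg(2) ii2; assumption)
    also have "\<dots> = perm_avg N (\<lambda>\<pi>'. perm_avg N (\<lambda>\<pi>. ?\<Pi> (inv \<pi>' \<circ> \<pi>)))"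
      by (intro perm_avg_cong two)
    also have "\<dots> = perm_avg N (\<lambda>\<pi>'. B)"
      unfolding B_def
      by (intro perm_avg_cong perm_avg_compose_left[of _ _ ?\<Pi>] permutes_inv)
    finally show ?thesis by simp
  qed
  have Sg: "\<bar>exp (- (v * (s\<^sup>2 * S) / 2)) - ?g\<bar> \<le> s\<^sup>2 * \<bar>v * S - 1\<bar> / 2"
  proof -
    have "\<bar>exp (- (v * (s\<^sup>2 * S) / 2)) - ?g\<bar> \<le> \<bar>v * (s\<^sup>2 * S) / 2 - s\<^sup>2 / 2\<bar>"
      using v0 S0 by (intro exp_minus_Lipschitz) auto
    also have "v * (s\<^sup>2 * S) / 2 - s\<^sup>2 / 2 = s\<^sup>2 * (v * S - 1) / 2"
      by (simp add: algebra_simps diff_divide_distrib)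
    finally show ?thesis by (simp add: abs_mult)
  qed
  have A: "cmod (A - ?g) \<le> \<epsilon> * s\<^sup>2 * S + s\<^sup>2 * \<bar>v * S - 1\<bar> / 2"
  proof -
    have sumA: "(\<Sum>i<N. (s * c i)\<^sup>2) = s\<^sup>2 * S" by (simp add: S power_mult_distrib sum_distrib_left)
    have "cmod (A - exp (- (v * (\<Sum>i<N. (s * c i)\<^sup>2) / 2))) \<le> \<epsilon> * (\<Sum>i<N. (s * c i)\<^sup>2)"
      unfolding A_def
    proof (rule prod_char_approx[OF \<phi>1 v0 \<delta>])
      fix j assume "j \<in> {..<N}"
      then have "2 * (\<bar>s\<bar> * \<bar>c j\<bar>) \<le> \<delta>" using c[of j] by simp
      moreover have "0 \<le> \<bar>s\<bar> * \<bar>c j\<bar>" by simp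
      ultimately show "\<bar>s * c j\<bar> \<le> \<delta>" unfolding abs_mult by linarith
    qed simp
    then have "cmod (A - exp (- (v * (s\<^sup>2 * S) / 2))) \<le> \<epsilon> * s\<^sup>2 * S" unfolding sumA by simp
    moreover have "cmod (complex_of_real (exp (- (v * (s\<^sup>2 * S) / 2))) - ?g) \<le> s\<^sup>2 * \<bar>v * S - 1\<bar> / 2"
      using Sg by (simp only: of_real_diff[symmetric] norm_of_real)
    ultimately show ?thesis
      using norm_triangle_le[of "A - exp (- (v * (s\<^sup>2 * S) / 2))"
          "complex_of_real (exp (- (v * (s\<^sup>2 * S) / 2))) - ?g"] by simp
  qed
  have B: "cmod (B - ?g\<^sup>2) \<le> 4 * \<epsilon> * s\<^sup>2 * S + s\<^sup>2 * \<bar>v * S - 1\<bar> + v * s\<^sup>2 * (S\<^sup>2 / (2 * r * (real N - 1))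
      + r / 2)"
  proof -
    have X'S: "\<bar>X' \<pi>\<bar> \<le> S" if \<pi>: "\<pi> permutes {..<N}" for \<pi>
    proof -
      have "\<bar>X' \<pi>\<bar> \<le> (\<Sum>i<N. \<bar>c i * c (\<pi> i)\<bar>)" unfolding X'_def by (rule sum_abs)
      also have "\<dots> \<le> (\<Sum>i<N. ((c i)\<^sup>2 + (c (\<pi> i))\<^sup>2) / 2)"
      proof (rule sum_mono)
        fix i
        have "0 \<le> (\<bar>c i\<bar> - \<bar>c (\<pi> i)\<bar>)\<^sup>2" by simp
        then show "\<bar>c i * c (\<pi> i)\<bar> \<le> ((c i)\<^sup>2 + (c (\<pi> i))\<^sup>2) / 2"
          by (simp add: power2_diff abs_mult)
      qed
      also have "\<dots> = S"
        using sum_permutes_eq[OF \<pi>, of "\<lambda>i. (c i)\<^sup>2"] by (simp add: S sum.distrib flip: sum_divide_distrib)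
      finally show ?thesis .
    qed
    have pt: "cmod (?\<Pi> \<pi> - ?g\<^sup>2) \<le> 4 * \<epsilon> * s\<^sup>2 * S + s\<^sup>2 * \<bar>v * S - 1\<bar> + v * s\<^sup>2 * \<bar>X' \<pi>\<bar>"
      if \<pi>: "\<pi> permutes {..<N}" for \<pi>
    proof -
      \<comment> \<open>When \<open>X' \<pi>\<close> is negligible, the sum of squares is twice that
        for a single permutation. This is where the square \<open>?g\<^sup>2\<close> comes
        from.\<close>
      have sumB: "(\<Sum>j<N. (s * (c j - c (\<pi> j)))\<^sup>2) = s\<^sup>2 * (2 * S - 2 * X' \<pi>)"
      proof -
        have "(\<Sum>j<N. (s * (c j - c (\<pi> j)))\<^sup>2) = (\<Sum>j<N. s\<^sup>2 * (c j)\<^sup>2 + s\<^sup>2 * (c (\<pi> j))\<^sup>2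
            - 2 * s\<^sup>2 * (c j * c (\<pi> j)))"
          by (intro sum.cong refl) (simp add: power2_eq_square algebra_simps)
        also have "\<dots> = s\<^sup>2 * S + s\<^sup>2 * S - 2 * s\<^sup>2 * X' \<pi>"
          using sum_permutes_eq[OF \<pi>, of "\<lambda>i. (c i)\<^sup>2"]
          by (simp add: S X'_def sum.distrib sum_subtractf flip: sum_distrib_left)
        finally show ?thesis by (simp add: algebra_simps)
      qed
      have "cmod (?\<Pi> \<pi> - exp (- (v * (\<Sum>j<N. (s * (c j - c (\<pi> j)))\<^sup>2) / 2)))
          \<le> \<epsilon> * (\<Sum>j<N. (s * (c j - c (\<pi> j)))\<^sup>2)"
      proof (rule prod_char_approx[OF \<phi>1 v0 \<delta>])
        fix j assume j: "j \<in> {..<N}"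
        have "2 * (\<bar>s\<bar> * \<bar>c j - c (\<pi> j)\<bar>) \<le> 2 * (\<bar>s\<bar> * (\<bar>c j\<bar> + \<bar>c (\<pi> j)\<bar>))"
          by (intro mult_left_mono abs_triangle_ineq4) auto
        also have "\<dots> \<le> 2 * \<delta>" using c[of j] c[of "\<pi> j"] j permutes_in_image[OF \<pi>, of j]
            by (simp add: algebra_simps)
        finally show "\<bar>s * (c j - c (\<pi> j))\<bar> \<le> \<delta>" by (simp add: abs_mult)
      qed simp
      moreover have "v * (s\<^sup>2 * (2 * S - 2 * X' \<pi>)) / 2 = v * (s\<^sup>2 * (S - X' \<pi>))"
        by (simp add: field_simps)
      ultimately have "cmod (?\<Pi> \<pi> - exp (- (v * (s\<^sup>2 * (S - X' \<pi>))))) \<le> \<epsilon> * (s\<^sup>2 * (2 * S - 2 * X' \<pi>))"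
        unfolding sumB by (simp only:)
      also have "\<dots> \<le> \<epsilon> * (s\<^sup>2 * (4 * S))"
        using X'S[OF \<pi>] \<epsilon> by (intro mult_left_mono) auto
      finally have 1: "cmod (?\<Pi> \<pi> - exp (- (v * (s\<^sup>2 * (S - X' \<pi>))))) \<le> 4 * \<epsilon> * s\<^sup>2 * S"
        by simp
      have "\<bar>exp (- (v * (s\<^sup>2 * (S - X' \<pi>)))) - exp (- (s\<^sup>2))\<bar> \<le> \<bar>v * (s\<^sup>2 * (S - X' \<pi>)) - s\<^sup>2\<bar>"
        using v0 X'S[OF \<pi>] by (intro exp_minus_Lipschitz) auto
      also have "v * (s\<^sup>2 * (S - X' \<pi>)) - s\<^sup>2 = s\<^sup>2 * (v * S - 1) - v * s\<^sup>2 * X' \<pi>" by (simp add: algebra_simps)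
      also have "\<bar>s\<^sup>2 * (v * S - 1) - v * s\<^sup>2 * X' \<pi>\<bar> \<le> s\<^sup>2 * \<bar>v * S - 1\<bar> + v * s\<^sup>2 * \<bar>X' \<pi>\<bar>"
        using v0 by (intro order_trans[OF abs_triangle_ineq4]) (simp add: abs_mult)
      also have "exp (- (s\<^sup>2)) = ?g\<^sup>2" by (simp flip: exp_double)
      finally have 2: "cmod (complex_of_real (exp (- (v * (s\<^sup>2 * (S - X' \<pi>))))) - ?g\<^sup>2)
          \<le> s\<^sup>2 * \<bar>v * S - 1\<bar> + v * s\<^sup>2 * \<bar>X' \<pi>\<bar>"
        by (simp only: of_real_diff[symmetric] of_real_power[symmetric] norm_of_real)
      show ?thesis
        using norm_triangle_le[OF add_mono[OF 1 2]] by simp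
    qed
    have "B - ?g\<^sup>2 = perm_avg N (\<lambda>\<pi>. ?\<Pi> \<pi> - ?g\<^sup>2)"
      unfolding B_def by (simp add: perm_avg_diff)
    then have "cmod (B - ?g\<^sup>2) \<le> perm_avg N (\<lambda>\<pi>. cmod (?\<Pi> \<pi> - ?g\<^sup>2))"
      by (simp only: norm_perm_avg_le)
    also have "\<dots> \<le> perm_avg N (\<lambda>\<pi>. 4 * \<epsilon> * s\<^sup>2 * S + s\<^sup>2 * \<bar>v * S - 1\<bar> + v * s\<^sup>2 * ((X' \<pi>)\<^sup>2 / (2 * r)
        + r / 2))"
      using v0 by (intro perm_avg_mono order_trans[OF pt] add_left_mono mult_left_mono abs_le_square_plus
          r) auto
    also have "\<dots> = 4 * \<epsilon> * s\<^sup>2 * S + s\<^sup>2 * \<bar>v * S - 1\<bar> + v * s\<^sup>2 * (perm_avg N (\<lambda>\<pi>. (X' \<pi>)\<^sup>2) / (2 * r)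
        + r / 2)"
      using perm_avg_cmult[of N "1 / (2 * r)" "\<lambda>\<pi>. (X' \<pi>)\<^sup>2"] by (simp add: perm_avg_add perm_avg_cmult)
    \<comment> \<open>The contrast bound applied to the coefficients themselves: the mean of
      \<open>(X' \<pi>)\<^sup>2\<close> is at most S^2 / (N - 1), which is small when S is
      bounded.\<close>
    also have "\<dots> \<le> 4 * \<epsilon> * s\<^sup>2 * S + s\<^sup>2 * \<bar>v * S - 1\<bar> + v * s\<^sup>2 * ((S * S / (real N - 1)) / (2 * r) + r / 2)"
      using perm_avg_linear_square_le[OF N c0, of c] v0 r
      by (intro add_left_mono mult_left_mono add_right_mono divide_right_mono) (auto simp: X'_def S)
    finally show ?thesis by (simp add: power2_eq_square mult_ac)
  qed
  \<comment> \<open>Since the target is a real constant, the mean square is made of the expectations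
    \<open>B\<close> and \<open>A\<close> only: it equals Re (B - g^2) - 2 g Re (A - g).\<close>
  have expand: "(cmod (w - complex_of_real g))\<^sup>2 = (cmod w)\<^sup>2 - 2 * g * Re w + g\<^sup>2" for w g
    unfolding cmod_power2 by (simp add: power2_diff)
  have pm: "(?C) \<in> borel_measurable ?M"
    unfolding perm_char_def using ii by (intro borel_measurable_integrable integrable_perm_avg(1))
  have ip: "integrable ?M (?C)" "integrable ?M (\<lambda>z. (cmod (?C z))\<^sup>2)"
    using pm by (auto intro!: PM.integrable_const_bound[where B=1] AE_I2 simp: power_le_one cmod_perm_char_le)
  have "(\<integral>z. (cmod (?C z - ?g))\<^sup>2 \<partial>?M)
     = (\<integral>z. (cmod (?C z))\<^sup>2 - 2 * ?g * Re (?C z) + ?g\<^sup>2 \<partial>?M)"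
    by (simp only: expand)
  also have "\<dots> = (\<integral>z. (cmod (?C z))\<^sup>2 \<partial>?M) - 2 * ?g * (\<integral>z. Re (?C z) \<partial>?M) + ?g\<^sup>2"
    using ip integrable_Re[OF ip(1)] by (simp add: PM.prob_space)
  also have "\<dots> = Re B - 2 * ?g * Re A + ?g\<^sup>2"
    using integral_Re[OF ip(1)] by (simp add: EA flip: EB)
  also have "\<dots> = Re (B - ?g\<^sup>2) - 2 * ?g * Re (A - ?g)"
    by (simp add: algebra_simps power2_eq_square)
  also have "\<dots> \<le> cmod (B - ?g\<^sup>2) + 2 * cmod (A - ?g)"
  proof -
    have "\<bar>?g * Re (A - ?g)\<bar> \<le> 1 * cmod (A - ?g)"
      unfolding abs_mult by (intro mult_mono abs_Re_le_cmod) auto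
    then show ?thesis using complex_Re_le_cmod[of "B - ?g\<^sup>2"] by linarith
  qed
  also have "\<dots> \<le> (4 * \<epsilon> * s\<^sup>2 * S + s\<^sup>2 * \<bar>v * S - 1\<bar> + v * s\<^sup>2 * (S\<^sup>2 / (2 * r * (real N - 1)) + r / 2))
      + 2 * (\<epsilon> * s\<^sup>2 * S + s\<^sup>2 * \<bar>v * S - 1\<bar> / 2)"
    by (intro add_mono B mult_left_mono A) auto
  finally show ?thesis by (simp add: algebra_simps)
qed

section \<open>A quantitative continuity theorem\<close>

abbreviation "\<Phi> \<equiv> cdf std_normal_distribution"

text \<open>The normal density is at most 1 / sqrt (2 pi) \<le> 1.\<close>

lemma std_normal_interval_le:
  assumes "x \<le> y"
  shows "\<Phi> y - \<Phi> x \<le> y - x"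
proof (cases "x = y")
  case False
  then have xy: "x < y" using assms by simp
  interpret real_distribution std_normal_distribution by (rule real_dist_normal_dist)
  have d: "std_normal_density t \<le> 1" for t
  proof -
    have "1 \<le> sqrt (2 * pi)" using pi_ge_two by (intro real_le_rsqrt) simp
    then have "1 / sqrt (2 * pi) \<le> 1" by simp
    then have "1 / sqrt (2 * pi) * exp (- t\<^sup>2 / 2) \<le> 1 * 1" by (intro mult_mono) auto
    then show ?thesis by (simp add: std_normal_density_def)
  qed
  have "emeasure std_normal_distribution {x<..y}
      = (\<integral>\<^sup>+t. ennreal (std_normal_density t) * indicator {x<..y} t \<partial>lborel)"
    by (subst emeasure_density) auto
  also have "\<dots> \<le> (\<integral>\<^sup>+t. indicator {x<..y} t \<partial>lborel)"
    using d by (intro nn_integral_mono) (auto split: split_indicator)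
  also have "\<dots> = ennreal (y - x)" using xy by simp
  finally have "measure std_normal_distribution {x<..y} \<le> y - x"
    using xy by (simp add: emeasure_eq_measure ennreal_le_iff)
  then show ?thesis using cdf_diff_eq[OF xy] by simp
qed simp

lemma isCont_cdf_std_normal: "isCont (\<Phi>) x"
proof -
  interpret real_distribution std_normal_distribution by (rule real_dist_normal_dist)
  have L: "\<bar>\<Phi> y - \<Phi> x\<bar> \<le> \<bar>y - x\<bar>" for y
    using std_normal_interval_le[of x y] std_normal_interval_le[of y x]
      cdf_nondecreasing[of x y] cdf_nondecreasing[of y x] by (cases "x \<le> y") auto
  show ?thesis
    unfolding isCont_def
  proof (rule LIM_I)
    fix r :: real assume "0 < r"
    then show "\<exists>s>0. \<forall>y. y \<noteq> x \<and> norm (y - x) < s \<longrightarrow> norm (\<Phi> y - \<Phi> x) < r"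
      using L by (intro exI[of _ r]) (auto intro: le_less_trans)
  qed
qed

text \<open>Polya's argument: between neighbouring grid points both functions are monotone and
  \<open>\<Phi>\<close> varies little, and outside the grid both are near 0 or 1. The grid depends
  on \<open>\<Phi>\<close> and \<open>\<epsilon>\<close> alone, so it serves random functions
  \<open>F\<close> as well.\<close>

lemma cdf_close_uniformly:
  fixes \<Phi> :: "real \<Rightarrow> real"
  assumes mono: "mono \<Phi>" and lip: "\<And>x y. x \<le> y \<Longrightarrow> \<Phi> y - \<Phi> x \<le> y - x"
    and lim: "(\<Phi> \<longlongrightarrow> 0) at_bot" "(\<Phi> \<longlongrightarrow> 1) at_top" and \<epsilon>: "0 < \<epsilon>"
  obtains T where "finite T"
    "\<And>F t. mono F \<Longrightarrow> (\<And>x. 0 \<le> F x) \<Longrightarrow> (\<And>x. F x \<le> 1) \<Longrightarrow> (\<And>x. x \<in> T \<Longrightarrow> \<bar>F x - \<Phi> x\<bar> \<le> \<epsilon> / 4) \<Longrightarrow> \<bar>F t - \<Phi> t\<bar> \<le> \<epsilon>"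
proof -
  have e4: "0 < \<epsilon> / 4" using \<epsilon> by simp
  have "eventually (\<lambda>x. \<Phi> x < \<epsilon> / 4) at_bot" "eventually (\<lambda>x. 1 - \<epsilon> / 4 < \<Phi> x) at_top"
    using order_tendstoD(2)[OF lim(1) e4] order_tendstoD(1)[OF lim(2), of "1 - \<epsilon> / 4"] e4 by simp_all
  then obtain a b where a: "\<Phi> a < \<epsilon> / 4" and b: "1 - \<epsilon> / 4 < \<Phi> b"
    by (auto simp: eventually_at_bot_linorder eventually_at_top_linorder)
  define x where "x i = a + real i * (\<epsilon> / 4)" for i
  obtain n where n: "b - a < real n * (\<epsilon> / 4)" using reals_Archimedean3[OF e4] by blast
  have x0: "x 0 = a" by (simp add: x_def)
  have xn: "b \<le> x n" using n by (simp add: x_def)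
  have bnd: "0 \<le> \<Phi> t" "\<Phi> t \<le> 1" for t
  proof -
    show "0 \<le> \<Phi> t" by (rule tendsto_upperbound[OF lim(1)])
      (auto simp: eventually_at_bot_linorder intro!: exI[of _ t] monoD[OF mono])
    show "\<Phi> t \<le> 1" by (rule tendsto_lowerbound[OF lim(2)])
      (auto simp: eventually_at_top_linorder intro!: exI[of _ t] monoD[OF mono])
  qed
  show ?thesis
  proof (rule that[of "x ` {..n}"])
    fix F t assume F: "mono F" "\<And>x. 0 \<le> F x" "\<And>x. F x \<le> (1::real)"
      and close: "\<And>y. y \<in> x ` {..n} \<Longrightarrow> \<bar>F y - \<Phi> y\<bar> \<le> \<epsilon> / 4"
    have cl: "\<bar>F (x i) - \<Phi> (x i)\<bar> \<le> \<epsilon> / 4" if "i \<le> n" for i using that close by auto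
    consider "t < a" | "x n \<le> t" | "a \<le> t" "t < x n" by linarith
    then show "\<bar>F t - \<Phi> t\<bar> \<le> \<epsilon>"
    proof cases
      case 1
      then have "F t \<le> F a" "\<Phi> t \<le> \<Phi> a" using F(1) mono by (auto simp: mono_def)
      moreover have "\<bar>F a - \<Phi> a\<bar> \<le> \<epsilon> / 4" using cl[of 0] x0 by simp
      ultimately show ?thesis using a F(2)[of t] bnd(1)[of t] \<epsilon> by linarith
    next
      case 2
      then have "F (x n) \<le> F t" "\<Phi> (x n) \<le> \<Phi> t" "\<Phi> b \<le> \<Phi> (x n)" using F(1) mono xn by (auto simp: mono_def)
      moreover have "\<bar>F (x n) - \<Phi> (x n)\<bar> \<le> \<epsilon> / 4" using cl[of n] by simp
      ultimately show ?thesis using b F(3)[of t] bnd(2)[of t] \<epsilon> by linarith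
    next
      case 3
      define i where "i = nat \<lfloor>(t - a) / (\<epsilon> / 4)\<rfloor>"
      have q: "0 \<le> (t - a) / (\<epsilon> / 4)" using 3 \<epsilon> by simp
      have "real i \<le> (t - a) / (\<epsilon> / 4)" "(t - a) / (\<epsilon> / 4) < real i + 1"
        using q unfolding i_def by linarith+
      then have "real i * (\<epsilon> / 4) \<le> t - a" "t - a < (real i + 1) * (\<epsilon> / 4)"
        using \<epsilon> by (simp_all add: pos_le_divide_eq pos_divide_less_eq)
      moreover have "(real i + 1) * (\<epsilon> / 4) = real i * (\<epsilon> / 4) + \<epsilon> / 4" by (simp add: distrib_right)
      moreover have "x (Suc i) = x i + \<epsilon> / 4" by (simp add: x_def distrib_right add_divide_distrib)
      ultimately have xi: "x i \<le> t" "t < x (Suc i)" "x (Suc i) - x i = \<epsilon> / 4"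
        unfolding x_def by linarith+
      have "x i < x n" using xi(1) 3 by simp
      then have "i < n" using \<epsilon> by (simp add: x_def)
      then have "\<bar>F (x i) - \<Phi> (x i)\<bar> \<le> \<epsilon> / 4" "\<bar>F (x (Suc i)) - \<Phi> (x (Suc i))\<bar> \<le> \<epsilon> / 4" using cl by auto
      moreover have "F (x i) \<le> F t" "F t \<le> F (x (Suc i))" "\<Phi> (x i) \<le> \<Phi> t" "\<Phi> t \<le> \<Phi> (x (Suc i))"
        using F(1) mono xi by (auto simp: mono_def)
      moreover have "\<Phi> (x (Suc i)) - \<Phi> (x i) \<le> \<epsilon> / 4" using lip[of "x i" "x (Suc i)"] xi by simp
      ultimately show ?thesis using \<epsilon> by linarith
    qed
  qed simp
qed

text \<open>A second moment bound gives a common Lipschitz constant, so closeness on a fine grid of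
  frequencies controls the frequencies in between.\<close>

lemma (in real_distribution) char_Lipschitz:
  assumes "integrable M (\<lambda>x. x\<^sup>2)" "(\<integral>x. x\<^sup>2 \<partial>M) \<le> K"
  shows "cmod (char M t - char M s) \<le> \<bar>t - s\<bar> * (1 + K)"
proof -
  have le: "\<bar>x\<bar> \<le> 1 + x\<^sup>2" for x :: real
    using abs_le_square_plus[of 1 x] by simp
  have i1: "integrable M (\<lambda>x. 1 + x\<^sup>2)" using assms by simp
  have ii: "integrable M (\<lambda>x. iexp (t * x))" for t
    by (intro integrable_const_bound[where B=1]) auto
  have "cmod (char M t - char M s) = cmod (\<integral>x. iexp (t * x) - iexp (s * x) \<partial>M)"
    unfolding char_def using ii by simp
  also have "\<dots> \<le> (\<integral>x. cmod (iexp (t * x) - iexp (s * x)) \<partial>M)"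
    by (rule integral_norm_bound)
  also have "\<dots> \<le> (\<integral>x. \<bar>t - s\<bar> * (1 + x\<^sup>2) \<partial>M)"
  proof (rule integral_mono)
    fix x
    have "cmod (iexp (t * x) - iexp (s * x)) \<le> \<bar>t * x - s * x\<bar>" by (rule norm_iexp_diff_le)
    also have "\<dots> = \<bar>t - s\<bar> * \<bar>x\<bar>" by (simp add: abs_mult flip: left_diff_distrib)
    also have "\<dots> \<le> \<bar>t - s\<bar> * (1 + x\<^sup>2)" by (intro mult_left_mono le) simp
    finally show "cmod (iexp (t * x) - iexp (s * x)) \<le> \<bar>t - s\<bar> * (1 + x\<^sup>2)" .
  qed (use ii i1 in auto)
  also have "\<dots> = \<bar>t - s\<bar> * (1 + (\<integral>x. x\<^sup>2 \<partial>M))" using assms prob_space by simp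
  also have "\<dots> \<le> \<bar>t - s\<bar> * (1 + K)" using assms by (intro mult_left_mono) auto
  finally show ?thesis .
qed

text \<open>A compactness argument in place of an inversion formula. If the claim failed, each grid
  would admit a counterexample; by the common Lipschitz constant, closeness on ever finer grids
  becomes convergence at every frequency, and Levy's continuity theorem contradicts the distance of
  the distribution functions at \<open>t\<close>.\<close>

lemma levy_pointwise:
  assumes \<epsilon>: "0 < \<epsilon>"
  shows "\<exists>S \<delta>. finite S \<and> 0 < \<delta> \<and> (\<forall>\<mu>. real_distribution \<mu> \<longrightarrow> integrable \<mu> (\<lambda>x. x\<^sup>2) \<longrightarrow> (\<integral>x. x\<^sup>2 \<partial>\<mu>) \<le> K \<longrightarrow>
      (\<forall>s\<in>S. cmod (char \<mu> s - exp (- (s\<^sup>2 / 2))) \<le> \<delta>) \<longrightarrow>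
      \<bar>cdf \<mu> t - \<Phi> t\<bar> \<le> \<epsilon>)"
    (is "\<exists>S \<delta>. ?P S \<delta>")
proof (rule ccontr)
  assume neg: "\<not> ?thesis"
  \<comment> \<open>Mesh 1 / (j + 1) on the interval from -(j + 1) to j + 1: both the fineness and
    the range grow, yet each grid is finite.\<close>
  define S where "S j = (\<lambda>i::int. real_of_int i / real (Suc j)) ` {- int ((Suc j)\<^sup>2) .. int ((Suc j)\<^sup>2)}" for j
  have "\<exists>\<mu>. real_distribution \<mu> \<and> integrable \<mu> (\<lambda>x. x\<^sup>2) \<and> (\<integral>x. x\<^sup>2 \<partial>\<mu>) \<le> K \<and>
      (\<forall>s\<in>S j. cmod (char \<mu> s - exp (- (s\<^sup>2 / 2))) \<le> 1 / real (Suc j)) \<and>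
      \<not> \<bar>cdf \<mu> t - \<Phi> t\<bar> \<le> \<epsilon>" for j
  proof -
    have "\<not> ?P (S j) (1 / real (Suc j))" using neg by blast
    then show ?thesis by (simp add: S_def)
  qed
  then obtain \<mu> where \<mu>: "\<And>j. real_distribution (\<mu> j)" "\<And>j. integrable (\<mu> j) (\<lambda>x. x\<^sup>2)" "\<And>j. (\<integral>x. x\<^sup>2 \<partial>\<mu> j) \<le> K"
    "\<And>j s. s \<in> S j \<Longrightarrow> cmod (char (\<mu> j) s - exp (- (s\<^sup>2 / 2))) \<le> 1 / real (Suc j)"
    and far: "\<And>j. \<not> \<bar>cdf (\<mu> j) t - \<Phi> t\<bar> \<le> \<epsilon>" by metis
  have "weak_conv_m \<mu> std_normal_distribution"
  proof (rule levy_continuity[OF \<mu>(1) real_dist_normal_dist])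
    fix u :: real
    define s where "s j = real_of_int \<lfloor>u * real (Suc j)\<rfloor> / real (Suc j)" for j
    have us: "\<bar>u - s j\<bar> \<le> 1 / real (Suc j)" for j
    proof -
      have "\<bar>u * real (Suc j) - real_of_int \<lfloor>u * real (Suc j)\<rfloor>\<bar> \<le> 1" by linarith
      then have "\<bar>u * real (Suc j) - real_of_int \<lfloor>u * real (Suc j)\<rfloor>\<bar> / real (Suc j) \<le> 1 / real (Suc j)"
        by (rule divide_right_mono) simp
      moreover have "u - s j = (u * real (Suc j) - real_of_int \<lfloor>u * real (Suc j)\<rfloor>) / real (Suc j)"
        by (simp add: s_def diff_divide_distrib)
      ultimately show ?thesis by (simp only: abs_divide)
    qed
    have inv0: "(\<lambda>j. 1 / real (Suc j)) \<longlonglongrightarrow> 0" by real_asymp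
    have su: "s \<longlonglongrightarrow> u"
      by (rule LIM_zero_cancel, rule tendsto_rabs_zero_cancel, rule tendsto_sandwich[OF _ _ tendsto_const inv0])
        (use us in \<open>auto simp: abs_minus_commute\<close>)
    have sS: "eventually (\<lambda>j. s j \<in> S j) sequentially"
    proof -
      have "eventually (\<lambda>j. \<bar>u\<bar> \<le> real j) sequentially" by real_asymp
      then show ?thesis
      proof eventually_elim
        case (elim j)
        have "\<bar>u * real (Suc j)\<bar> \<le> real j * real (Suc j)" using elim by (simp add: abs_mult mult_right_mono)
        moreover have "real j * real (Suc j) + 1 \<le> real ((Suc j)\<^sup>2)"
            by (simp add: power2_eq_square algebra_simps)
        ultimately have "\<lfloor>u * real (Suc j)\<rfloor> \<in> {- int ((Suc j)\<^sup>2) .. int ((Suc j)\<^sup>2)}"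
          unfolding atLeastAtMost_iff by linarith
        then show ?case unfolding S_def s_def by (rule imageI)
      qed
    qed
    have K0: "0 \<le> K" by (rule order_trans[OF integral_nonneg_AE \<mu>(3)[of 0]]) simp
    have "(\<lambda>j. char (\<mu> j) u - exp (- ((s j)\<^sup>2 / 2))) \<longlonglongrightarrow> 0"
    proof (rule Lim_null_comparison)
      show "eventually (\<lambda>j. norm (char (\<mu> j) u - exp (- ((s j)\<^sup>2 / 2)))
          \<le> 1 / real (Suc j) * (1 + K) + 1 / real (Suc j)) sequentially"
        using sS
      proof eventually_elim
        case (elim j)
        have "cmod (char (\<mu> j) u - char (\<mu> j) (s j)) \<le> \<bar>u - s j\<bar> * (1 + K)"
          by (rule real_distribution.char_Lipschitz[OF \<mu>(1-3)])
        also have "\<dots> \<le> 1 / real (Suc j) * (1 + K)" using us K0 by (intro mult_right_mono) auto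
        finally show ?case
          using norm_triangle_le[OF add_mono[OF _ \<mu>(4)[OF elim]], of "char (\<mu> j) u - char (\<mu> j) (s j)"] by simp
      qed
      show "(\<lambda>j. 1 / real (Suc j) * (1 + K) + 1 / real (Suc j)) \<longlonglongrightarrow> 0"
        using tendsto_add[OF tendsto_mult_right[OF inv0, of "1 + K"] inv0] by simp
    qed
    moreover have "(\<lambda>j. complex_of_real (exp (- ((s j)\<^sup>2 / 2)))) \<longlonglongrightarrow> exp (- (u\<^sup>2 / 2))"
      by (intro tendsto_intros su) simp
    ultimately have "(\<lambda>j. (char (\<mu> j) u - exp (- ((s j)\<^sup>2 / 2)))
        + complex_of_real (exp (- ((s j)\<^sup>2 / 2)))) \<longlonglongrightarrow> 0 + complex_of_real (exp (- (u\<^sup>2 / 2)))"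
      by (rule tendsto_add)
    then show "(\<lambda>j. char (\<mu> j) u) \<longlonglongrightarrow> char std_normal_distribution u"
      by (simp add: char_std_normal_distribution)
  qed
  then have "(\<lambda>j. cdf (\<mu> j) t) \<longlonglongrightarrow> \<Phi> t"
    using isCont_cdf_std_normal by (simp add: weak_conv_m_def weak_conv_def)
  then have "eventually (\<lambda>j. dist (cdf (\<mu> j) t) (\<Phi> t) < \<epsilon>) sequentially"
    using \<epsilon> by (rule tendstoD)
  then obtain j where "dist (cdf (\<mu> j) t) (\<Phi> t) < \<epsilon>"
    by (auto simp: eventually_sequentially)
  then show False using far[of j] by (simp add: dist_real_def)
qed

text \<open>Only finitely many frequencies enter here, so the estimate applies to random measures whose
  characteristic functions converge in probability pointwise.\<close>

lemma levy_uniform: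
  assumes \<epsilon>: "0 < \<epsilon>"
  obtains S \<delta> where "finite S" "0 < \<delta>"
    "\<And>\<mu> t. real_distribution \<mu> \<Longrightarrow> integrable \<mu> (\<lambda>x. x\<^sup>2) \<Longrightarrow> (\<integral>x. x\<^sup>2 \<partial>\<mu>) \<le> K \<Longrightarrow>
      (\<And>s. s \<in> S \<Longrightarrow> cmod (char \<mu> s - exp (- (s\<^sup>2 / 2))) \<le> \<delta>) \<Longrightarrow>
      \<bar>cdf \<mu> t - \<Phi> t\<bar> \<le> \<epsilon>"
proof -
  interpret N: real_distribution std_normal_distribution by (rule real_dist_normal_dist)
  obtain T where T: "finite T"
    "\<And>F t. mono F \<Longrightarrow> (\<And>x. 0 \<le> F x) \<Longrightarrow> (\<And>x. F x \<le> 1) \<Longrightarrow>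
      (\<And>x. x \<in> T \<Longrightarrow> \<bar>F x - \<Phi> x\<bar> \<le> \<epsilon> / 4) \<Longrightarrow> \<bar>F t - \<Phi> t\<bar> \<le> \<epsilon>"
    using cdf_close_uniformly[OF _ std_normal_interval_le N.cdf_lim_at_bot N.cdf_lim_at_top_prob \<epsilon>]
    by (metis N.cdf_nondecreasing monoI)
  have e4: "0 < \<epsilon> / 4" using \<epsilon> by simp
  from levy_pointwise[OF e4, of K] obtain S \<delta> where S: "\<And>t. finite (S t)" "\<And>t. 0 < (\<delta> t :: real)"
    "\<And>t \<mu>. real_distribution \<mu> \<Longrightarrow> integrable \<mu> (\<lambda>x. x\<^sup>2) \<Longrightarrow> (\<integral>x. x\<^sup>2 \<partial>\<mu>) \<le> K \<Longrightarrow>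
      (\<forall>s\<in>S t. cmod (char \<mu> s - exp (- (s\<^sup>2 / 2))) \<le> \<delta> t) \<Longrightarrow>
      \<bar>cdf \<mu> t - \<Phi> t\<bar> \<le> \<epsilon> / 4" by metis
  \<comment> \<open>Inserting 1 keeps the minimum meaningful and positive if \<open>T\<close> is
    empty.\<close>
  define d where "d = Min (insert 1 (\<delta> ` T))"
  have d: "0 < d" "\<And>t. t \<in> T \<Longrightarrow> d \<le> \<delta> t"
    using T(1) S(2) by (auto simp: d_def)
  show ?thesis
  proof (rule that[of "\<Union>t\<in>T. S t" d])
    fix \<mu> t assume \<mu>: "real_distribution \<mu>" "integrable \<mu> (\<lambda>x. x\<^sup>2)" "(\<integral>x. x\<^sup>2 \<partial>\<mu>) \<le> K"
      and c: "\<And>s. s \<in> (\<Union>t\<in>T. S t) \<Longrightarrow> cmod (char \<mu> s - exp (- (s\<^sup>2 / 2))) \<le> d"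
    interpret real_distribution \<mu> by fact
    show "\<bar>cdf \<mu> t - \<Phi> t\<bar> \<le> \<epsilon>"
    proof (rule T(2))
      fix x assume x: "x \<in> T"
      show "\<bar>cdf \<mu> x - \<Phi> x\<bar> \<le> \<epsilon> / 4"
        using c x d(2)[OF x] by (intro S(3)[OF \<mu>]) (blast intro: order_trans)
    qed (auto simp: cdf_nondecreasing cdf_nonneg cdf_bounded_prob intro!: monoI)
  qed (use T S d in auto)
qed

section \<open>The linear part of the statistic\<close>

text \<open>For fixed data this is the permutation distribution as a genuine measure, so that
  distribution and characteristic functions of measures apply to it.\<close>

definition perm_law :: "nat \<Rightarrow> ((nat \<Rightarrow> nat) \<Rightarrow> real) \<Rightarrow> real measure" where
  "perm_law N L = distr (measure_pmf (pmf_of_set {\<pi>. \<pi> permutes {..<N}})) borel L"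

lemma perms_nonempty: "{\<pi>. \<pi> permutes {..<N::nat}} \<noteq> {}"
  using permutes_id by blast

lemma real_distribution_perm_law: "real_distribution (perm_law N L)"
  unfolding perm_law_def by (intro prob_space.real_distribution_distr) (auto intro:
      measure_pmf.prob_space_axioms)

lemma integrable_perm_law:
  fixes g :: "real \<Rightarrow> real"
  assumes "g \<in> borel_measurable borel"
  shows "integrable (perm_law N L) g"
  unfolding perm_law_def using assms perms_nonempty
  by (subst integrable_distr_eq) (auto intro!: integrable_measure_pmf_finite)

lemma integral_perm_law:
  fixes g :: "real \<Rightarrow> 'b::{real_normed_field, banach, second_countable_topology}"
  assumes "g \<in> borel_measurable borel"
  shows "(\<integral>x. g x \<partial>perm_law N L) = perm_avg N (\<lambda>\<pi>. g (L \<pi>))"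
proof -
  have "(\<integral>x. g x \<partial>perm_law N L) = (\<Sum>\<pi> | \<pi> permutes {..<N}. pmf (pmf_of_set {\<pi>. \<pi> permutes {..<N}}) \<pi> *\<^sub>R g
      (L \<pi>))"
    unfolding perm_law_def
    by (subst integral_distr, simp, rule assms, rule integral_measure_pmf) (use perms_nonempty in auto)
  also have "\<dots> = perm_avg N (\<lambda>\<pi>. g (L \<pi>))"
    using perms_nonempty
    by (simp add: perm_avg_def sum_divide_distrib card_perms scaleR_conv_of_real divide_inverse
        sum_distrib_left mult.commute)
  finally show ?thesis .
qed

lemma char_perm_law: "char (perm_law N (lin_stat N c f z)) s = perm_char N c f s z"
  unfolding char_def perm_char_def by (rule integral_perm_law) simp

lemma cdf_perm_law: "cdf (perm_law N L) t = perm_avg N (\<lambda>\<pi>. of_bool (L \<pi> \<le> t))"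
proof -
  interpret real_distribution "perm_law N L" by (rule real_distribution_perm_law)
  have "cdf (perm_law N L) t = (\<integral>x. indicator {..t} x \<partial>perm_law N L)" by (simp add: cdf_def)
  also have "\<dots> = perm_avg N (\<lambda>\<pi>. indicator {..t} (L \<pi>))" by (rule integral_perm_law) simp
  finally show ?thesis by (simp add: indicator_def of_bool_def)
qed

text \<open>The difference of the two sample means, scaled by sqrt N and divided by the limit
  \<open>\<tau>\<close> of the studentizing denominator, written as a contrast of the pooled
  sample.\<close>

definition coef :: "nat \<Rightarrow> nat \<Rightarrow> real \<Rightarrow> nat \<Rightarrow> real" where
  "coef m n \<tau> i = (if i < m then sqrt (m + n) / (m * \<tau>) else - (sqrt (m + n) / (n * \<tau>)))"

lemma sum_split_samples:
  fixes g :: "nat \<Rightarrow> 'b::comm_monoid_add"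
  shows "(\<Sum>i<m + n. g i) = (\<Sum>i<m. g i) + (\<Sum>j<n. g (m + j))"
proof -
  have "(\<Sum>i<m + n. g i) = (\<Sum>i<m. g i) + (\<Sum>i\<in>{m..<m + n}. g i)"
    by (simp add: lessThan_atLeast0 sum.atLeastLessThan_concat)
  also have "(\<Sum>i\<in>{m..<m + n}. g i) = (\<Sum>j<n. g (m + j))"
    using sum.shift_bounds_nat_ivl[of g 0 m n] by (simp add: lessThan_atLeast0 add.commute)
  finally show ?thesis .
qed

lemma sum_coef:
  assumes "0 < m" "0 < n" "0 < \<tau>"
  shows "(\<Sum>i<m + n. coef m n \<tau> i) = 0"
  using assms by (simp add: sum_split_samples coef_def)

lemma sum_coef_square:
  assumes "0 < m" "0 < n" "0 < \<tau>"
  shows "(\<Sum>i<m + n. (coef m n \<tau> i)\<^sup>2) = (real (m + n) / m + real (m + n) / n) / \<tau>\<^sup>2"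
  using assms
  by (simp add: sum_split_samples coef_def power_divide power_mult_distrib power2_eq_square field_simps)

lemma abs_coef_le:
  assumes "0 < \<tau>"
  shows "\<bar>coef m n \<tau> i\<bar> \<le> (sqrt (m + n) / m + sqrt (m + n) / n) / \<tau>"
  using assms by (simp add: coef_def add_divide_distrib)

lemma lin_stat_coef:
  "lin_stat (m + n) (coef m n \<tau>) f z \<pi>
    = sqrt (m + n) * ((\<Sum>i<m. f (z (\<pi> i))) / m - (\<Sum>j<n. f (z (\<pi> (m + j)))) / n) / \<tau>"
proof -
  have "(\<Sum>i<m. coef m n \<tau> i * f (z (\<pi> i))) = sqrt (m + n) / (m * \<tau>) * (\<Sum>i<m. f (z (\<pi> i)))"
    by (simp add: coef_def sum_distrib_left)
  moreover have "(\<Sum>j<n. coef m n \<tau> (m + j) * f (z (\<pi> (m + j))))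
      = - (sqrt (m + n) / (n * \<tau>)) * (\<Sum>j<n. f (z (\<pi> (m + j))))"
    by (simp add: coef_def sum_distrib_left sum_negf)
  ultimately show ?thesis
    unfolding lin_stat_def sum_split_samples by (simp add: right_diff_distrib diff_divide_distrib mult_ac)
qed

lemma lin_stat_diff: "lin_stat N c f z \<pi> - lin_stat N c f z' \<pi> = (\<Sum>i<N. c i * (f (z (\<pi> i)) - f (z' (\<pi> i))))"
  by (simp add: lin_stat_def right_diff_distrib sum_subtractf)

lemma lin_stat_permute:
  assumes "\<pi> permutes {..<N}" "\<tau> permutes {..<N}"
  shows "lin_stat N c f (\<lambda>i\<in>{..<N}. z (\<tau> i)) \<pi> = lin_stat N c f z (\<tau> \<circ> \<pi>)"
  using permutes_in_image[OF assms(1)] by (simp add: lin_stat_def)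

lemma perm_char_permute:
  assumes "\<tau> permutes {..<N}"
  shows "perm_char N c f s (\<lambda>i\<in>{..<N}. z (\<tau> i)) = perm_char N c f s z"
proof -
  have "perm_char N c f s (\<lambda>i\<in>{..<N}. z (\<tau> i)) = perm_avg N (\<lambda>\<pi>. iexp (s * lin_stat N c f z (\<tau> \<circ> \<pi>)))"
    unfolding perm_char_def by (intro perm_avg_cong) (simp add: lin_stat_permute assms)
  also have "\<dots> = perm_char N c f s z"
    unfolding perm_char_def using perm_avg_compose_left[OF assms, of "\<lambda>\<pi>. iexp (s * lin_stat N c f z \<pi>)"] .
  finally show ?thesis .
qed

text \<open>The form required by \<open>coupling\<close>: a small constant plus a multiple of the
  squared distance. The bound for contrasts controls squares, so the scale \<open>r\<close> mediates
  between the modulus and its square.\<close>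

lemma perm_char_Lipschitz:
  assumes N: "2 \<le> N" and c: "(\<Sum>i<N. c i) = 0" and r: "0 < r"
  shows "cmod (perm_char N c f s z - perm_char N c f s z')
    \<le> \<bar>s\<bar> * r / 2 + \<bar>s\<bar> * (\<Sum>i<N. (c i)\<^sup>2) / (2 * r * (real N - 1)) * (\<Sum>i<N. (f (z i) - f (z' i))\<^sup>2)"
proof -
  let ?d = "\<lambda>\<pi>. lin_stat N c f z \<pi> - lin_stat N c f z' \<pi>"
  have "cmod (perm_char N c f s z - perm_char N c f s z')
      \<le> perm_avg N (\<lambda>\<pi>. cmod (iexp (s * lin_stat N c f z \<pi>) - iexp (s * lin_stat N c f z' \<pi>)))"
    unfolding perm_char_def perm_avg_diff[symmetric] by (rule norm_perm_avg_le)
  also have "\<dots> \<le> perm_avg N (\<lambda>\<pi>. \<bar>s\<bar> * (r / 2 + 1 / (2 * r) * (?d \<pi>)\<^sup>2))"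
  proof (rule perm_avg_mono)
    fix \<pi>
    have "cmod (iexp (s * lin_stat N c f z \<pi>) - iexp (s * lin_stat N c f z' \<pi>)) \<le> \<bar>s\<bar> * \<bar>?d \<pi>\<bar>"
      using norm_iexp_diff_le[of "s * lin_stat N c f z \<pi>" "s * lin_stat N c f z' \<pi>"]
      by (simp only: abs_mult right_diff_distrib[symmetric])
    also have "\<dots> \<le> \<bar>s\<bar> * (r / 2 + 1 / (2 * r) * (?d \<pi>)\<^sup>2)"
      using abs_le_square_plus[OF r, of "?d \<pi>"] by (intro mult_left_mono) auto
    finally show "cmod (iexp (s * lin_stat N c f z \<pi>) - iexp (s * lin_stat N c f z' \<pi>))
        \<le> \<bar>s\<bar> * (r / 2 + 1 / (2 * r) * (?d \<pi>)\<^sup>2)" .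
  qed
  also have "\<dots> = \<bar>s\<bar> * (r / 2 + 1 / (2 * r) * perm_avg N (\<lambda>\<pi>. (?d \<pi>)\<^sup>2))"
    by (simp only: perm_avg_cmult perm_avg_add perm_avg_const)
  also have "\<dots> \<le> \<bar>s\<bar> * (r / 2 + 1 / (2 * r) * ((\<Sum>i<N. (c i)\<^sup>2) * (\<Sum>i<N. (f (z i) - f (z' i))\<^sup>2) / (real N
      - 1)))"
    unfolding lin_stat_diff using r
    by (intro mult_left_mono add_left_mono perm_avg_linear_square_le[OF N c, of "\<lambda>i. f (z i) - f (z' i)"]) auto
  finally show ?thesis by (simp add: distrib_left mult_ac)
qed

lemma cmod_perm_char_diff_le: "cmod (perm_char N c f s z - exp (- (s\<^sup>2 / 2))) \<le> 2"
proof -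
  have "cmod (perm_char N c f s z - exp (- (s\<^sup>2 / 2))) \<le> cmod (perm_char N c f s z) + cmod (exp (- (s\<^sup>2 / 2)))"
    by (rule norm_triangle_ineq4)
  also have "\<dots> \<le> 1 + 1" by (intro add_mono cmod_perm_char_le) (simp add: norm_exp_eq_Re)
  finally show ?thesis by simp
qed

lemma (in two_sample) measurable_lin_stat:
  assumes [measurable]: "f \<in> borel_measurable P" and \<pi>: "\<pi> permutes {..<N}"
  shows "(\<lambda>z. lin_stat N c f z \<pi>) \<in> borel_measurable (PiP {..<N})"
proof -
  have [measurable]: "(\<lambda>z. z (\<pi> i)) \<in> PiP {..<N} \<rightarrow>\<^sub>M P" if "i < N" for i
    using permutes_in_image[OF \<pi>, of i] that by (intro measurable_component_singleton) simp
  show ?thesis unfolding lin_stat_def by measurable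
qed

lemma borel_measurable_perm_avg:
  fixes F :: "(nat \<Rightarrow> nat) \<Rightarrow> 'z \<Rightarrow> 'b::{real_normed_field, second_countable_topology}"
  assumes "\<And>\<pi>. \<pi> permutes {..<N} \<Longrightarrow> F \<pi> \<in> borel_measurable M"
  shows "(\<lambda>z. perm_avg N (\<lambda>\<pi>. F \<pi> z)) \<in> borel_measurable M"
  unfolding perm_avg_def using assms by (intro borel_measurable_divide borel_measurable_sum) auto

lemma (in two_sample) measurable_perm_char:
  assumes "f \<in> borel_measurable P"
  shows "(\<lambda>z. perm_char N c f s z) \<in> borel_measurable (PiP {..<N})"
proof -
  have "(\<lambda>z. iexp (s * lin_stat N c f z \<pi>)) \<in> borel_measurable (PiP {..<N})" if "\<pi> permutes {..<N}" for \<pi>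
    using measurable_lin_stat[OF assms that] by measurable
  then show ?thesis unfolding perm_char_def by (rule borel_measurable_perm_avg)
qed

text \<open>Both components have positive weight in the mixture, so each inherits the finite second
  moment.\<close>

lemma (in two_sample) square_integrable_components:
  fixes f :: "'a \<Rightarrow> real"
  assumes "integrable Pb (\<lambda>x. (f x)\<^sup>2)" "f \<in> borel_measurable P"
  shows "integrable P (\<lambda>x. (f x)\<^sup>2)" "integrable Q (\<lambda>x. (f x)\<^sup>2)"
proof -
  have m: "(\<lambda>x. (f x)\<^sup>2) \<in> borel_measurable P" using assms(2) by measurable
  then have mQ: "(\<lambda>x. (f x)\<^sup>2) \<in> borel_measurable Q" by (simp add: measurable_def sets_Q space_Q)
  have "(\<integral>\<^sup>+x. ennreal ((f x)\<^sup>2) \<partial>Pb) < \<infinity>"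
    using assms(1) by (simp add: integrable_iff_bounded)
  then have "ennreal p * (\<integral>\<^sup>+x. ennreal ((f x)\<^sup>2) \<partial>P) + ennreal (1 - p) * (\<integral>\<^sup>+x. ennreal ((f x)\<^sup>2) \<partial>Q) < \<infinity>"
    using m by (subst (asm) nn_integral_mixture) auto
  then have "(\<integral>\<^sup>+x. ennreal ((f x)\<^sup>2) \<partial>P) < \<infinity>" "(\<integral>\<^sup>+x. ennreal ((f x)\<^sup>2) \<partial>Q) < \<infinity>"
    using p by (auto simp: ennreal_mult_less_top)
  then show "integrable P (\<lambda>x. (f x)\<^sup>2)" "integrable Q (\<lambda>x. (f x)\<^sup>2)"
    using m mQ by (simp_all add: integrable_iff_bounded)
qed

text \<open>Holds for every label set, although \<open>f\<close> need not be centred under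
  \<open>P\<close> or \<open>Q\<close>, because the coefficients sum to 0. The factor 2 bounds N /
  (N - 1).\<close>

lemma (in two_sample) mean_perm_avg_lin_stat_square:
  assumes f: "f \<in> borel_measurable P" "integrable P (\<lambda>x. (f x)\<^sup>2)" "integrable Q (\<lambda>x. (f x)\<^sup>2)"
    and N: "2 \<le> N" and c: "(\<Sum>i<N. c i) = 0"
  shows "integrable (prodPQ {..<N} B) (\<lambda>z. perm_avg N (\<lambda>\<pi>. (lin_stat N c f z \<pi>)\<^sup>2))"
    and "(\<integral>z. perm_avg N (\<lambda>\<pi>. (lin_stat N c f z \<pi>)\<^sup>2) \<partial>prodPQ {..<N} B)
      \<le> 2 * (\<Sum>i<N. (c i)\<^sup>2) * ((\<integral>x. (f x)\<^sup>2 \<partial>P) + (\<integral>x. (f x)\<^sup>2 \<partial>Q))"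
proof -
  interpret PQ: prob_space "prodPQ {..<N} B" by (rule prob_space_prodPQ)
  let ?V = "(\<integral>x. (f x)\<^sup>2 \<partial>P) + (\<integral>x. (f x)\<^sup>2 \<partial>Q)"
  let ?C = "\<Sum>i<N. (c i)\<^sup>2"
  have fQ: "f \<in> borel_measurable Q" using f(1) by (simp add: measurable_def sets_Q space_Q)
  have i: "integrable (prodPQ {..<N} B) (\<lambda>z. (f (z i))\<^sup>2)"
    and le: "(\<integral>z. (f (z i))\<^sup>2 \<partial>prodPQ {..<N} B) \<le> ?V" if "i < N" for i
  proof -
    let ?R = "if i \<in> B then P else Q"
    have d: "distr (prodPQ {..<N} B) ?R (\<lambda>z. z i) = ?R"
      unfolding prodPQ_def using that by (intro distr_PiM_component[where M="\<lambda>i. if i \<in> B then P else Q"])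
          (auto intro: P Q)
    have m: "(\<lambda>z. z i) \<in> prodPQ {..<N} B \<rightarrow>\<^sub>M ?R"
      unfolding prodPQ_def using that by (intro measurable_component_singleton) auto
    have fm: "(\<lambda>x. (f x)\<^sup>2) \<in> borel_measurable ?R" using f(1) fQ by auto
    have "integrable ?R (\<lambda>x. (f x)\<^sup>2)" using f by simp
    then show "integrable (prodPQ {..<N} B) (\<lambda>z. (f (z i))\<^sup>2)"
      using integrable_distr_eq[OF m fm] d by simp
    have "(\<integral>z. (f (z i))\<^sup>2 \<partial>prodPQ {..<N} B) = (\<integral>x. (f x)\<^sup>2 \<partial>?R)"
      using integral_distr[OF m fm] d by simp
    also have "\<dots> \<le> ?V" by simp
    finally show "(\<integral>z. (f (z i))\<^sup>2 \<partial>prodPQ {..<N} B) \<le> ?V" .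
  qed
  have bd: "perm_avg N (\<lambda>\<pi>. (lin_stat N c f z \<pi>)\<^sup>2) \<le> ?C / (real N - 1) * (\<Sum>i<N. (f (z i))\<^sup>2)" for z
    using perm_avg_linear_square_le[OF N c, of "\<lambda>i. f (z i)"] by (simp add: lin_stat_def)
  have I: "integrable (prodPQ {..<N} B) (\<lambda>z. ?C / (real N - 1) * (\<Sum>i<N. (f (z i))\<^sup>2))"
    using i by (intro integrable_mult_right Bochner_Integration.integrable_sum) auto
  have "(\<lambda>z. perm_avg N (\<lambda>\<pi>. (lin_stat N c f z \<pi>)\<^sup>2)) \<in> borel_measurable (PiP {..<N})"
    using measurable_lin_stat[OF f(1)] by (intro borel_measurable_perm_avg borel_measurable_power) auto
  then have "(\<lambda>z. perm_avg N (\<lambda>\<pi>. (lin_stat N c f z \<pi>)\<^sup>2)) \<in> borel_measurable (prodPQ {..<N} B)" by measurable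
  then show int: "integrable (prodPQ {..<N} B) (\<lambda>z. perm_avg N (\<lambda>\<pi>. (lin_stat N c f z \<pi>)\<^sup>2))"
  proof (rule Bochner_Integration.integrable_bound[OF I])
    show "AE z in prodPQ {..<N} B. norm (perm_avg N (\<lambda>\<pi>. (lin_stat N c f z \<pi>)\<^sup>2))
        \<le> norm (?C / (real N - 1) * (\<Sum>i<N. (f (z i))\<^sup>2))"
    proof (rule AE_I2)
      fix z
      have "0 \<le> perm_avg N (\<lambda>\<pi>. (lin_stat N c f z \<pi>)\<^sup>2)" by (intro perm_avg_nonneg) simp
      then show "norm (perm_avg N (\<lambda>\<pi>. (lin_stat N c f z \<pi>)\<^sup>2))
          \<le> norm (?C / (real N - 1) * (\<Sum>i<N. (f (z i))\<^sup>2))"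
        using bd[of z] unfolding real_norm_def by linarith
    qed
  qed
  have "(\<integral>z. perm_avg N (\<lambda>\<pi>. (lin_stat N c f z \<pi>)\<^sup>2) \<partial>prodPQ {..<N} B)
     \<le> (\<integral>z. ?C / (real N - 1) * (\<Sum>i<N. (f (z i))\<^sup>2) \<partial>prodPQ {..<N} B)"
    by (intro integral_mono int I bd)
  also have "\<dots> = ?C / (real N - 1) * (\<Sum>i<N. \<integral>z. (f (z i))\<^sup>2 \<partial>prodPQ {..<N} B)"
    unfolding integral_mult_right_zero by (subst Bochner_Integration.integral_sum) (use i in auto)
  also have "\<dots> \<le> ?C / (real N - 1) * (\<Sum>i<N. ?V)"
    using N le by (intro mult_left_mono sum_mono divide_nonneg_nonneg sum_nonneg) auto
  also have "\<dots> = ?C * ?V * (N / (real N - 1))" by simp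
  also have "\<dots> \<le> ?C * ?V * 2"
    using N by (intro mult_left_mono) (auto simp: divide_le_eq intro!: mult_nonneg_nonneg sum_nonneg)
  finally show "(\<integral>z. perm_avg N (\<lambda>\<pi>. (lin_stat N c f z \<pi>)\<^sup>2) \<partial>prodPQ {..<N} B) \<le> 2 * ?C * ?V" by simp
qed

section \<open>Asymptotics of the linear statistic\<close>

locale two_sample_limit = two_sample P Q p
  for P Q :: "'a measure" and p :: real +
  fixes f :: "'a \<Rightarrow> real" and m n :: "nat \<Rightarrow> nat" and D :: real
  assumes f: "integrable Pb f" "(\<integral>x. f x \<partial>Pb) = 0" "integrable Pb (\<lambda>x. (f x)\<^sup>2)" "0 < (\<integral>x. (f x)\<^sup>2 \<partial>Pb)"
    and m: "filterlim m at_top sequentially" and n: "filterlim n at_top sequentially"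
    and pm: "(\<lambda>k. real (m k) / real (m k + n k)) \<longlonglongrightarrow> p"
    and D: "0 \<le> D" "eventually (\<lambda>k. \<bar>real (m k) - real (m k + n k) * p\<bar> \<le> D * sqrt (m k + n k)) sequentially"
begin

definition "v = (\<integral>x. (f x)\<^sup>2 \<partial>Pb)"
text \<open>The limit of the denominator: N / m and N / n tend to 1 / p and 1 / (1 - p), whose sum
  is 1 / (p (1 - p)).\<close>

definition "\<tau> = sqrt (v / (p * (1 - p)))"

abbreviation "N k \<equiv> m k + n k"
abbreviation "c k \<equiv> coef (m k) (n k) \<tau>"

abbreviation "Lin k \<equiv> lin_stat (N k) (c k) f"
abbreviation "PC k \<equiv> perm_char (N k) (c k) f"
abbreviation "Law k \<equiv> prodPQ {..<N k} {..<m k}"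

text \<open>The sum of the squared coefficients once both sample sizes are positive. Its limit 1 / v
  is what makes the limiting variance 1.\<close>

definition "Cs k = (real (N k) / m k + real (N k) / n k) / \<tau>\<^sup>2"

lemma v: "0 < v" using f by (simp add: v_def)

lemma \<tau>: "0 < \<tau>" "\<tau>\<^sup>2 = v / (p * (1 - p))" using v p by (auto simp: \<tau>_def)

lemma fP: "f \<in> borel_measurable P"
  using borel_measurable_integrable[OF f(1)] by (simp add: measurable_def)

lemma fsq: "integrable P (\<lambda>x. (f x)\<^sup>2)" "integrable Q (\<lambda>x. (f x)\<^sup>2)"
  using square_integrable_components[OF f(3) fP] by auto

lemma ev_mn: "eventually (\<lambda>k. 0 < m k \<and> 0 < n k) sequentially"
  using filterlim_at_top[THEN iffD1, OF m, rule_format, of 1] filterlim_at_top[THEN iffD1, OF n,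
      rule_format, of 1]
  by eventually_elim auto

lemma N_top: "filterlim (\<lambda>k. real (N k)) at_top sequentially"
proof -
  have "filterlim (\<lambda>k. N k) at_top sequentially"
    by (rule filterlim_at_top_mono[OF m]) auto
  then show ?thesis by (rule filterlim_compose[OF filterlim_real_sequentially])
qed

lemma Nm: "(\<lambda>k. real (N k) / m k) \<longlonglongrightarrow> 1 / p"
proof -
  have "(\<lambda>k. 1 / (real (m k) / real (N k))) \<longlonglongrightarrow> 1 / p"
    using p by (intro tendsto_intros pm) auto
  then show ?thesis by simp
qed

lemma pn: "(\<lambda>k. real (n k) / real (N k)) \<longlonglongrightarrow> 1 - p"
proof (rule Lim_transform_eventually)
  show "(\<lambda>k. 1 - real (m k) / real (N k)) \<longlonglongrightarrow> 1 - p" by (intro tendsto_intros pm)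
  show "eventually (\<lambda>k. 1 - real (m k) / real (N k) = real (n k) / real (N k)) sequentially"
    using ev_mn by eventually_elim (simp add: field_simps)
qed

lemma Nn: "(\<lambda>k. real (N k) / n k) \<longlonglongrightarrow> 1 / (1 - p)"
proof -
  have "(\<lambda>k. 1 / (real (n k) / real (N k))) \<longlonglongrightarrow> 1 / (1 - p)"
    using p by (intro tendsto_intros pn) auto
  then show ?thesis by simp
qed

lemma Cs_lim: "Cs \<longlonglongrightarrow> 1 / v"
proof -
  have "(\<lambda>k. (real (N k) / m k + real (N k) / n k) / \<tau>\<^sup>2) \<longlonglongrightarrow> (1 / p + 1 / (1 - p)) / \<tau>\<^sup>2"
    using \<tau> by (intro tendsto_intros Nm Nn) auto
  moreover have "(1 / p + 1 / (1 - p)) / \<tau>\<^sup>2 = 1 / v"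
    using p v unfolding \<tau>(2) by (simp add: field_simps)
  ultimately show ?thesis unfolding Cs_def[abs_def] by simp
qed

text \<open>Uniform negligibility of the coefficients: it confines the arguments of the
  characteristic function of \<open>f\<close> to the neighbourhood of 0 where
  \<open>char_near_0\<close> applies.\<close>

lemma coef_small: "(\<lambda>k. (sqrt (N k) / m k + sqrt (N k) / n k) / \<tau>) \<longlonglongrightarrow> 0"
proof (rule Lim_transform_eventually)
  have "(\<lambda>k. (real (N k) / m k + real (N k) / n k) / \<tau> * inverse (sqrt (N k))) \<longlonglongrightarrow> (1 / p + 1 / (1 - p)) / \<tau> * 0"
    using \<tau> by (intro tendsto_intros Nm Nn tendsto_inverse_0_at_top filterlim_compose[OF sqrt_at_top
        N_top]) auto
  then show "(\<lambda>k. (real (N k) / m k + real (N k) / n k) / \<tau> * inverse (sqrt (N k))) \<longlonglongrightarrow> 0" by simp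
  show "eventually (\<lambda>k. (real (N k) / m k + real (N k) / n k) / \<tau> * inverse (sqrt (N k))
      = (sqrt (N k) / m k + sqrt (N k) / n k) / \<tau>) sequentially"
    using ev_mn
  proof eventually_elim
    case (elim k)
    then have q: "real (N k) = sqrt (N k) * sqrt (N k)" "sqrt (N k) \<noteq> 0" by auto
    have "(s * s / a + s * s / b) / \<tau> * inverse s = (s / a + s / b) / \<tau>" if "s \<noteq> 0" for s a b :: real
      using that \<tau>(1) by (simp add: field_simps)
    from this[OF q(2), of "m k" "n k"] show ?case unfolding q(1)[symmetric] .
  qed
qed

lemma N_minus_1_lim: "(\<lambda>k. 1 / (real (N k) - 1)) \<longlonglongrightarrow> 0" "(\<lambda>k. sqrt (N k) / (real (N k) - 1)) \<longlonglongrightarrow> 0"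
proof -
  have "((\<lambda>x::real. 1 / (x - 1)) \<longlongrightarrow> 0) at_top" "((\<lambda>x::real. sqrt x / (x - 1)) \<longlongrightarrow> 0) at_top" by real_asymp+
  from this[THEN filterlim_compose, OF N_top]
  show "(\<lambda>k. 1 / (real (N k) - 1)) \<longlonglongrightarrow> 0" "(\<lambda>k. sqrt (N k) / (real (N k) - 1)) \<longlonglongrightarrow> 0" by simp_all
qed

lemma ev_N2: "eventually (\<lambda>k. 2 \<le> N k) sequentially"
  using ev_mn by eventually_elim auto

lemma ev_c: "eventually (\<lambda>k. (\<Sum>i<N k. c k i) = 0 \<and> (\<Sum>i<N k. (c k i)\<^sup>2) = Cs k) sequentially"
  using ev_mn by eventually_elim (auto simp: sum_coef sum_coef_square Cs_def \<tau>)

text \<open>Under the mixture the mean square bound applies; \<open>coupling\<close> carries the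
  result to the pooled sample, since the integrand is symmetric in the data and stable under
  changing O(sqrt N) observations.\<close>

lemma perm_char_mean_abs_tendsto:
  "(\<lambda>k. \<integral>z. cmod (PC k s z - exp (- (s\<^sup>2 / 2))) \<partial>Law k) \<longlonglongrightarrow> 0"
proof (rule tendstoI)
  fix e :: real assume e: "0 < e"
  let ?g = "exp (- (s\<^sup>2 / 2)) :: real"
  \<comment> \<open>The three constants make the terms with \<open>\<epsilon>\<close>,
    \<open>r\<close> and \<open>r3\<close> contribute at most e / 8 each in the limit; with the e /
    4 in \<open>bd\<close> the total stays below e. The added 1 in the denominators covers s =
    0.\<close>
  define \<epsilon> where "\<epsilon> = e\<^sup>2 * v / (48 * (s\<^sup>2 + 1))"
  define r where "r = e\<^sup>2 / (4 * (v * s\<^sup>2 + 1))"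
  define r3 where "r3 = e / (4 * (\<bar>s\<bar> + 1))"
  define V where "V = 2 * (\<integral>x. (f x)\<^sup>2 \<partial>P) + 2 * (\<integral>x. (f x)\<^sup>2 \<partial>Q)"
  have s1: "0 < s\<^sup>2 + 1" "0 < v * s\<^sup>2 + 1" using v by (auto intro: add_nonneg_pos)
  have pos: "0 < \<epsilon>" "0 < r" "0 < r3" using e v s1 by (auto simp: \<epsilon>_def r_def r3_def)
  obtain \<delta> where \<delta>: "0 < \<delta>" "\<And>t. \<bar>t\<bar> \<le> \<delta> \<Longrightarrow>
    cmod (char (distr Pb borel f) t - exp (- (v * t\<^sup>2 / 2))) \<le> \<epsilon> * t\<^sup>2"
    using Pb.char_near_0[OF borel_measurable_integrable[OF f(1)] f(1,3,2) pos(1)]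
        unfolding v_def[symmetric] by blast
  define A where "A k = 6 * \<epsilon> * s\<^sup>2 * Cs k + 2 * s\<^sup>2 * \<bar>v * Cs k - 1\<bar>
      + v * s\<^sup>2 * ((Cs k)\<^sup>2 / (2 * r) * (1 / (real (N k) - 1)) + r / 2)" for k
  \<comment> \<open>The last summand is the cost of the coupling: O(sqrt N) changed labels times a
    factor of order 1 / N.\<close>
  define bd where "bd k = A k / e + e / 4 + (\<bar>s\<bar> * r3 / 2 + \<bar>s\<bar> * Cs k / (2 * r3) * V * (1
      + D\<^sup>2) * (sqrt (N k) / (real (N k) - 1)))" for k
  have "A \<longlonglongrightarrow> 6 * \<epsilon> * s\<^sup>2 * (1 / v) + 2 * s\<^sup>2 * \<bar>v * (1 / v) - 1\<bar> + v * s\<^sup>2 * ((1 / v)\<^sup>2 / (2 * r) * 0 + r / 2)"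
    unfolding A_def[abs_def] using pos by (intro tendsto_intros Cs_lim N_minus_1_lim) auto
  then have Al: "A \<longlonglongrightarrow> 6 * \<epsilon> * s\<^sup>2 / v + v * s\<^sup>2 * r / 2" using v by simp
  have "bd \<longlonglongrightarrow> (6 * \<epsilon> * s\<^sup>2 / v + v * s\<^sup>2 * r / 2) / e + e / 4 + (\<bar>s\<bar> * r3 / 2
      + \<bar>s\<bar> * (1 / v) / (2 * r3) * V * (1 + D\<^sup>2) * 0)"
    unfolding bd_def[abs_def] using pos e by (intro tendsto_intros Al Cs_lim N_minus_1_lim) auto
  moreover have "(6 * \<epsilon> * s\<^sup>2 / v + v * s\<^sup>2 * r / 2) / e + e / 4 + (\<bar>s\<bar> * r3 / 2
      + \<bar>s\<bar> * (1 / v) / (2 * r3) * V * (1 + D\<^sup>2) * 0) < e"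
  proof -
    have "6 * (e\<^sup>2 * v / (48 * x)) * y / v / e = e / 8 * (y / x)" if "0 < x" for x y
      using that e v by (simp add: field_simps power2_eq_square)
    from this[OF s1(1)] have "6 * \<epsilon> * s\<^sup>2 / v / e = e / 8 * (s\<^sup>2 / (s\<^sup>2 + 1))" unfolding \<epsilon>_def .
    also have "\<dots> \<le> e / 8 * 1" using e s1 by (intro mult_left_mono) (auto simp: divide_le_eq)
    finally have 1: "6 * \<epsilon> * s\<^sup>2 / v / e \<le> e / 8" by simp
    have "v * s\<^sup>2 * r / 2 / e = e / 8 * (v * s\<^sup>2 / (v * s\<^sup>2 + 1))" using e by (simp add: r_def power2_eq_square)
    also have "\<dots> \<le> e / 8 * 1" using e s1 by (intro mult_left_mono) (auto simp: divide_le_eq)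
    finally have 2: "v * s\<^sup>2 * r / 2 / e \<le> e / 8" by simp
    have "\<bar>s\<bar> * r3 / 2 = e / 8 * (\<bar>s\<bar> / (\<bar>s\<bar> + 1))" by (simp add: r3_def)
    also have "\<dots> \<le> e / 8 * 1" using e by (intro mult_left_mono) (auto simp: divide_le_eq)
    finally have 3: "\<bar>s\<bar> * r3 / 2 \<le> e / 8" by simp
    show ?thesis unfolding add_divide_distrib mult_zero_right using 1 2 3 e by linarith
  qed
  ultimately have ev: "eventually (\<lambda>k. bd k < e) sequentially" by (rule order_tendstoD)
  have ev2: "eventually (\<lambda>k. (sqrt (N k) / m k + sqrt (N k) / n k) / \<tau> < \<delta> / (2 * (\<bar>s\<bar> + 1))) sequentially"
    using coef_small by (rule order_tendstoD) (use \<delta>(1) in \<open>simp add: divide_pos_pos\<close>)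
  show "eventually (\<lambda>k. dist (\<integral>z. cmod (PC k s z - exp (- (s\<^sup>2 / 2))) \<partial>Law k) 0 < e) sequentially"
    using ev ev2 ev_c ev_N2 D(2)
  proof eventually_elim
    case (elim k)
    then have N: "2 \<le> N k" and c0: "(\<Sum>i<N k. c k i) = 0" and Cs: "(\<Sum>i<N k. (c k i)\<^sup>2) = Cs k" by auto
    define G where "G z = cmod (PC k s z - exp (- (s\<^sup>2 / 2)))" for z
    define \<kappa> where "\<kappa> = \<bar>s\<bar> * Cs k / (2 * r3 * (real (N k) - 1))"
    interpret PM: prob_space "PiPb {..<N k}" by (rule prob_space_PiM_Pb)
    have Cs0: "0 \<le> Cs k" unfolding Cs[symmetric] by (intro sum_nonneg) simp
    have \<kappa>0: "0 \<le> \<kappa>" unfolding \<kappa>_def using Cs0 pos N by simp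
    have G2: "G z \<le> 2" for z unfolding G_def by (rule cmod_perm_char_diff_le)
    have Gm: "G \<in> borel_measurable (PiP {..<N k})"
      unfolding G_def[abs_def] using measurable_perm_char[OF fP] by measurable
    have lip: "G z \<le> G z' + \<bar>s\<bar> * r3 / 2 + \<kappa> * (\<Sum>i<N k. (f (z i) - f (z' i))\<^sup>2)" for z z'
    proof -
      have "G z - G z' \<le> cmod (PC k s z - PC k s z')"
        unfolding G_def using norm_triangle_ineq2[of "PC k s z - exp (- (s\<^sup>2 / 2))" "PC k s z'
            - exp (- (s\<^sup>2 / 2))"] by simp
      also have "\<dots> \<le> \<bar>s\<bar> * r3 / 2 + \<kappa> * (\<Sum>i<N k. (f (z i) - f (z' i))\<^sup>2)"
        using perm_char_Lipschitz[OF N c0 pos(3), of f s z z'] unfolding \<kappa>_def Cs .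
      finally show ?thesis by simp
    qed
    have "(\<integral>z. G z \<partial>Law k) \<le> (\<integral>z. G z \<partial>PiPb {..<N k}) + \<bar>s\<bar> * r3 / 2
        + \<kappa> * V * (\<Sum>j\<le>N k. \<bar>real j - real (m k)\<bar> * Bernstein (N k) j p)"
      unfolding V_def
    proof (rule coupling[OF Gm _ G2 _ lip \<kappa>0 fP fsq])
      show "G (\<lambda>i\<in>{..<N k}. z (\<tau>' i)) = G z" if "\<tau>' permutes {..<N k}" for \<tau>' z
        unfolding G_def perm_char_permute[OF that] ..
    qed (auto simp: G_def)
    also have "\<dots> \<le> (\<integral>z. G z \<partial>PiPb {..<N k}) + \<bar>s\<bar> * r3 / 2 + \<kappa> * V * ((1 + D\<^sup>2) * sqrt (N k))"
      using elim N \<kappa>0 p by (intro add_left_mono mult_left_mono Bernstein_abs_deviation_le) (auto simp: V_def)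
    also have "(\<integral>z. G z \<partial>PiPb {..<N k}) \<le> A k / e + e / 4"
    proof -
      have Gi: "integrable (PiPb {..<N k}) (\<lambda>z. (G z)\<^sup>2)" "integrable (PiPb {..<N k}) G"
      proof -
        have G0: "0 \<le> G z" for z by (simp add: G_def)
        have "(G z)\<^sup>2 \<le> 2\<^sup>2" for z by (rule power_mono[OF G2 G0])
        note G4 = this
        note [measurable] = Gm
        show "integrable (PiPb {..<N k}) (\<lambda>z. (G z)\<^sup>2)"
          by (rule PM.integrable_const_bound[where B="2\<^sup>2"]) (intro AE_I2, simp only: G4 real_norm_def
              abs_power2, measurable)
        show "integrable (PiPb {..<N k}) G"
          by (rule PM.integrable_const_bound[where B=2]) (intro AE_I2, simp only: G0 G2 real_norm_def
              abs_of_nonneg, measurable)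
      qed
      \<comment> \<open>The passage from mean square to mean, with the scale e / 2.\<close>
      have "(\<integral>z. G z \<partial>PiPb {..<N k}) \<le> (\<integral>z. (G z)\<^sup>2 / e + e / 4 \<partial>PiPb {..<N k})"
      proof (rule integral_mono)
        show "G z \<le> (G z)\<^sup>2 / e + e / 4" for z
          using abs_le_square_plus[of "e / 2" "G z"] e by simp
      qed (use Gi in auto)
      also have "\<dots> = (\<integral>z. (G z)\<^sup>2 \<partial>PiPb {..<N k}) / e + e / 4"
        using Gi by (simp add: PM.prob_space del: space_PiM_Pb)
      also have "(\<integral>z. (G z)\<^sup>2 \<partial>PiPb {..<N k}) \<le> A k"
      proof -
        have "2 * \<bar>s\<bar> * \<bar>c k i\<bar> \<le> \<delta>" for i
        proof -
          have "\<bar>c k i\<bar> \<le> \<delta> / (2 * (\<bar>s\<bar> + 1))" using abs_coef_le[OF \<tau>(1), of "m k" "n k" i] elim(2) by simp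
          then have "\<bar>c k i\<bar> * (2 * (\<bar>s\<bar> + 1)) \<le> \<delta>" by (simp add: pos_le_divide_eq)
          then show ?thesis by (simp add: algebra_simps)
        qed
        then have "(\<integral>z. (G z)\<^sup>2 \<partial>PiPb {..<N k}) \<le> 6 * \<epsilon> * s\<^sup>2 * Cs k + 2 * s\<^sup>2 * \<bar>v * Cs k - 1\<bar>
            + v * s\<^sup>2 * ((Cs k)\<^sup>2 / (2 * r * (real (N k) - 1)) + r / 2)"
          unfolding G_def using pos N c0 Cs
          by (intro Pb.perm_char_mean_square[OF borel_measurable_integrable[OF f(1)] v_def[symmetric]
              \<delta>(2)]) auto
        then show ?thesis by (simp add: A_def)
      qed
      finally show ?thesis using e by (simp add: divide_right_mono)
    qed
    finally have "(\<integral>z. G z \<partial>Law k) \<le> bd k"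
      by (simp add: bd_def \<kappa>_def mult_ac)
    moreover have "0 \<le> (\<integral>z. G z \<partial>Law k)" by (intro integral_nonneg_AE) (simp add: G_def)
    ultimately show ?case using elim(1) unfolding G_def by simp
  qed
qed

end

section \<open>The studentized statistic\<close>

text \<open>Slutsky's argument for distribution functions: compare at t - \<eta> and t + \<eta>. The
  shift costs at most \<eta> because the normal distribution function is 1-Lipschitz, and the rest
  is the proportion of permutations on which the statistics differ by more.\<close>

lemma perm_avg_cdf_perturb:
  assumes L: "\<And>t. \<bar>perm_avg N (\<lambda>\<pi>. of_bool (L \<pi> \<le> t)) - \<Phi> t\<bar> \<le> \<epsilon>" and \<eta>: "0 \<le> \<eta>"
  shows "\<bar>perm_avg N (\<lambda>\<pi>. of_bool (S \<pi> \<le> t)) - \<Phi> t\<bar>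
    \<le> \<epsilon> + \<eta> + perm_avg N (\<lambda>\<pi>. of_bool (\<eta> < \<bar>S \<pi> - L \<pi>\<bar>))"
proof -
  let ?F = "\<lambda>X t. perm_avg N (\<lambda>\<pi>. of_bool (X \<pi> \<le> t)) :: real"
  let ?d = "perm_avg N (\<lambda>\<pi>. of_bool (\<eta> < \<bar>S \<pi> - L \<pi>\<bar>)) :: real"
  have "?F S t \<le> perm_avg N (\<lambda>\<pi>. of_bool (L \<pi> \<le> t + \<eta>) + of_bool (\<eta> < \<bar>S \<pi> - L \<pi>\<bar>))"
    by (intro perm_avg_mono) (auto simp: of_bool_def)
  then have up: "?F S t \<le> ?F L (t + \<eta>) + ?d" by (simp add: perm_avg_add)
  have "?F L (t - \<eta>) \<le> perm_avg N (\<lambda>\<pi>. of_bool (S \<pi> \<le> t) + of_bool (\<eta> < \<bar>S \<pi> - L \<pi>\<bar>))"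
    by (intro perm_avg_mono) (auto simp: of_bool_def)
  then have lo: "?F L (t - \<eta>) \<le> ?F S t + ?d" by (simp add: perm_avg_add)
  show ?thesis
    using up lo L[of "t + \<eta>"] L[of "t - \<eta>"] std_normal_interval_le[of t "t + \<eta>"] std_normal_interval_le[of
        "t - \<eta>" t] \<eta>
    by linarith
qed

text \<open>A deterministic Slutsky lemma, where \<open>a\<close> and \<open>b\<close> stand for N /
  m and N / n, and \<open>s1\<close>, \<open>s2\<close> for the two scale estimates. One
  \<open>\<delta>\<close> serves all values, so it can be applied to each data set and each
  permutation separately.\<close>

lemma studentized_close:
  fixes \<tau> \<sigma> g K \<eta> :: real
  assumes \<tau>: "0 < \<tau>" "\<tau>\<^sup>2 = \<sigma>\<^sup>2 * g" and \<sigma>: "0 < \<sigma>" and g: "0 < g" and \<eta>: "0 < \<eta>" and K: "0 \<le> K"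
  shows "\<exists>\<delta>>0. \<forall>a b s1 s2 T L. 0 \<le> a \<longrightarrow> 0 \<le> b \<longrightarrow> a + b \<le> 2 * g \<longrightarrow> \<bar>a + b - g\<bar> \<le> \<delta> \<longrightarrow>
    \<bar>s1 - \<sigma>\<bar> \<le> \<delta> \<longrightarrow> \<bar>s2 - \<sigma>\<bar> \<le> \<delta> \<longrightarrow> \<bar>T - L * \<tau>\<bar> \<le> (2 * g + 2) * \<delta> \<longrightarrow> \<bar>L\<bar> \<le> K \<longrightarrow>
    \<bar>T / sqrt (a * s1\<^sup>2 + b * s2\<^sup>2) - L\<bar> \<le> \<eta>"
proof -
  \<comment> \<open>\<open>\<delta> * c1\<close> bounds the error of the squared denominator, and
    \<open>\<delta> * c2\<close> then bounds \<open>T - L * V\<close>.\<close>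
  define c1 where "c1 = 2 * g * (2 * \<sigma> + 1) + \<sigma>\<^sup>2"
  define c2 where "c2 = 2 * g + 2 + K * (c1 / \<tau>)"
  \<comment> \<open>The second term forces V \<ge> \<tau> / 2, and then the third makes
    \<open>\<delta> * c2\<close> at most \<open>\<eta> * V\<close>.\<close>
  define \<delta> where "\<delta> = min 1 (min (\<tau>\<^sup>2 / (2 * c1)) (\<eta> * \<tau> / (2 * c2)))"
  have c1: "0 < c1" using g \<sigma> by (simp add: c1_def add_pos_pos)
  have c2: "0 < c2" using g K c1 \<tau> by (simp add: c2_def add_pos_nonneg)
  have \<delta>0: "0 < \<delta>" using c1 c2 \<tau>(1) \<eta> by (simp add: \<delta>_def)
  have \<delta>1: "\<delta> \<le> 1" and \<delta>2: "\<delta> * c1 \<le> \<tau>\<^sup>2 / 2" and \<delta>3: "\<delta> * c2 \<le> \<eta> * \<tau> / 2"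
  proof -
    show "\<delta> \<le> 1" by (simp add: \<delta>_def)
    have "\<delta> \<le> \<tau>\<^sup>2 / (2 * c1)" "\<delta> \<le> \<eta> * \<tau> / (2 * c2)" by (simp_all add: \<delta>_def)
    then show "\<delta> * c1 \<le> \<tau>\<^sup>2 / 2" "\<delta> * c2 \<le> \<eta> * \<tau> / 2" using c1 c2 by (simp_all add: field_simps)
  qed
  show ?thesis
  proof (intro exI[of _ \<delta>] conjI[OF \<delta>0] allI impI)
    fix a b s1 s2 T L :: real
    assume ab: "0 \<le> a" "0 \<le> b" "a + b \<le> 2 * g" "\<bar>a + b - g\<bar> \<le> \<delta>"
      and s: "\<bar>s1 - \<sigma>\<bar> \<le> \<delta>" "\<bar>s2 - \<sigma>\<bar> \<le> \<delta>" and T: "\<bar>T - L * \<tau>\<bar> \<le> (2 * g + 2) * \<delta>" and L: "\<bar>L\<bar> \<le> K"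
    define W where "W = a * s1\<^sup>2 + b * s2\<^sup>2"
    define V where "V = sqrt W"
    have sq: "\<bar>x\<^sup>2 - \<sigma>\<^sup>2\<bar> \<le> \<delta> * (2 * \<sigma> + 1)" if "\<bar>x - \<sigma>\<bar> \<le> \<delta>" for x
    proof -
      have "x\<^sup>2 - \<sigma>\<^sup>2 = (x - \<sigma>) * (x + \<sigma>)" by (simp add: power2_eq_square algebra_simps)
      then have "\<bar>x\<^sup>2 - \<sigma>\<^sup>2\<bar> = \<bar>x - \<sigma>\<bar> * \<bar>x + \<sigma>\<bar>" by (simp add: abs_mult)
      also have "\<dots> \<le> \<delta> * (2 * \<sigma> + 1)" using that \<delta>1 \<delta>0 \<sigma> by (intro mult_mono) auto
      finally show ?thesis .
    qed
    have W0: "0 \<le> W" using ab by (simp add: W_def)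
    have "W - \<tau>\<^sup>2 = a * (s1\<^sup>2 - \<sigma>\<^sup>2) + b * (s2\<^sup>2 - \<sigma>\<^sup>2) + \<sigma>\<^sup>2 * (a + b - g)"
      unfolding W_def \<tau>(2) by (simp add: algebra_simps)
    then have "\<bar>W - \<tau>\<^sup>2\<bar> \<le> a * \<bar>s1\<^sup>2 - \<sigma>\<^sup>2\<bar> + b * \<bar>s2\<^sup>2 - \<sigma>\<^sup>2\<bar> + \<sigma>\<^sup>2 * \<bar>a + b - g\<bar>"
      using ab abs_triangle_ineq[of "a * (s1\<^sup>2 - \<sigma>\<^sup>2) + b * (s2\<^sup>2 - \<sigma>\<^sup>2)" "\<sigma>\<^sup>2 * (a + b - g)"]
        abs_triangle_ineq[of "a * (s1\<^sup>2 - \<sigma>\<^sup>2)" "b * (s2\<^sup>2 - \<sigma>\<^sup>2)"] by (simp add: abs_mult)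
    also have "\<dots> \<le> a * (\<delta> * (2 * \<sigma> + 1)) + b * (\<delta> * (2 * \<sigma> + 1)) + \<sigma>\<^sup>2 * \<delta>"
      using ab s by (intro add_mono mult_left_mono sq) auto
    also have "\<dots> = (a + b) * (\<delta> * (2 * \<sigma> + 1)) + \<sigma>\<^sup>2 * \<delta>" by (simp add: distrib_right)
    also have "\<dots> \<le> (2 * g) * (\<delta> * (2 * \<sigma> + 1)) + \<sigma>\<^sup>2 * \<delta>"
      using ab \<delta>0 \<sigma> by (intro add_right_mono mult_right_mono) auto
    also have "\<dots> = \<delta> * c1" by (simp add: c1_def algebra_simps)
    finally have Wt: "\<bar>W - \<tau>\<^sup>2\<bar> \<le> \<delta> * c1" .
    have V2: "V\<^sup>2 = W" "0 \<le> V" using W0 by (auto simp: V_def)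
    \<comment> \<open>Since V + \<tau> \<ge> \<tau>, the error of the square controls that of the
      root. The denominator thereby stays away from 0, where division by convention would give
      0.\<close>
    have "\<bar>V - \<tau>\<bar> * \<tau> \<le> \<bar>V - \<tau>\<bar> * (V + \<tau>)" using V2 by (intro mult_left_mono) auto
    also have "\<dots> = \<bar>(V - \<tau>) * (V + \<tau>)\<bar>" using V2 \<tau> by (simp add: abs_mult)
    also have "(V - \<tau>) * (V + \<tau>) = W - \<tau>\<^sup>2" unfolding V2(1)[symmetric]
        by (simp add: power2_eq_square algebra_simps)
    finally have Vt: "\<bar>V - \<tau>\<bar> * \<tau> \<le> \<delta> * c1" using Wt by simp
    then have "\<bar>V - \<tau>\<bar> * \<tau> \<le> (\<tau> / 2) * \<tau>" using \<delta>2 by (simp add: power2_eq_square)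
    then have "\<bar>V - \<tau>\<bar> \<le> \<tau> / 2" using \<tau>(1) by (rule mult_right_le_imp_le)
    then have Vl: "\<tau> / 2 \<le> V" by linarith
    have Vt': "\<bar>V - \<tau>\<bar> \<le> \<delta> * (c1 / \<tau>)" using Vt \<tau>(1) by (simp add: field_simps)
    have V0: "0 < V" using Vl \<tau> by simp
    have "\<bar>T - L * V\<bar> = \<bar>(T - L * \<tau>) + L * (\<tau> - V)\<bar>" by (simp add: algebra_simps)
    also have "\<dots> \<le> \<bar>T - L * \<tau>\<bar> + \<bar>L * (\<tau> - V)\<bar>" by (rule abs_triangle_ineq)
    also have "\<dots> = \<bar>T - L * \<tau>\<bar> + \<bar>L\<bar> * \<bar>V - \<tau>\<bar>" by (simp add: abs_mult abs_minus_commute)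
    also have "\<dots> \<le> (2 * g + 2) * \<delta> + K * (\<delta> * (c1 / \<tau>))"
      using T L Vt' K by (intro add_mono mult_mono) auto
    also have "\<dots> = \<delta> * c2" by (simp add: c2_def algebra_simps)
    also have "\<dots> \<le> \<eta> * (\<tau> / 2)" using \<delta>3 by simp
    also have "\<dots> \<le> \<eta> * V" using Vl \<eta> by (intro mult_left_mono) auto
    finally have "\<bar>T - L * V\<bar> / V \<le> \<eta>" using V0 by (simp add: pos_divide_le_eq)
    moreover have "T / V - L = (T - L * V) / V" using V0 by (simp add: field_simps)
    ultimately show "\<bar>T / sqrt (a * s1\<^sup>2 + b * s2\<^sup>2) - L\<bar> \<le> \<eta>"
      using V0 by (simp add: V_def[symmetric] W_def[symmetric] abs_divide)
  qed
qed

text \<open>By right continuity every value is a limit of values at rational points to the right.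
  The supremum becomes countable, which makes it measurable as a function of the data.\<close>

lemma cdf_diff_SUP_Rats:
  assumes "real_distribution \<mu>" "real_distribution \<nu>"
  shows "(SUP t. \<bar>cdf \<mu> t - cdf \<nu> t\<bar>) = (SUP t\<in>\<rat>. \<bar>cdf \<mu> t - cdf \<nu> t\<bar>)"
    and "bdd_above (range (\<lambda>t. \<bar>cdf \<mu> t - cdf \<nu> t\<bar>))"
proof -
  interpret \<mu>: real_distribution \<mu> by fact
  interpret \<nu>: real_distribution \<nu> by fact
  let ?g = "\<lambda>t. \<bar>cdf \<mu> t - cdf \<nu> t\<bar>"
  have "?g t \<le> 1" for t
    using \<mu>.cdf_nonneg[of t] \<mu>.cdf_bounded_prob[of t] \<nu>.cdf_nonneg[of t] \<nu>.cdf_bounded_prob[of t] by linarith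
  then show bdd: "bdd_above (range ?g)" by (auto simp: bdd_above_def)
  then have bddQ: "bdd_above (?g ` \<rat>)" by (rule bdd_above_mono) auto
  show "(SUP t. ?g t) = (SUP t\<in>\<rat>. ?g t)"
  proof (rule antisym)
    show "(SUP t. ?g t) \<le> (SUP t\<in>\<rat>. ?g t)"
    proof (rule cSUP_least)
      fix t
      have lim: "(?g \<longlongrightarrow> ?g t) (at_right t)"
        using \<mu>.cdf_is_right_cont[of t] \<nu>.cdf_is_right_cont[of t] unfolding continuous_within
            by (intro tendsto_intros)
      show "?g t \<le> (SUP t\<in>\<rat>. ?g t)"
      proof (rule ccontr)
        assume "\<not> ?thesis"
        then have "eventually (\<lambda>y. (SUP t\<in>\<rat>. ?g t) < ?g y) (at_right t)"
          using order_tendstoD(1)[OF lim] by simp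
        then obtain b where b: "t < b" "\<And>y. t < y \<Longrightarrow> y < b \<Longrightarrow> (SUP t\<in>\<rat>. ?g t) < ?g y"
          by (auto simp: eventually_at_right_field)
        obtain y where y: "y \<in> \<rat>" "t < y" "y < b" using Rats_dense_in_real[OF b(1)] by auto
        have "?g y \<le> (SUP t\<in>\<rat>. ?g t)" by (rule cSUP_upper[OF y(1) bddQ])
        then show False using b(2)[OF y(2,3)] by simp
      qed
    qed simp
    show "(SUP t\<in>\<rat>. ?g t) \<le> (SUP t. ?g t)"
      by (rule cSUP_subset_mono) (use bdd in auto)
  qed
qed

lemma perm_cdf_eq_perm_avg: "perm_cdf N S z t = perm_avg N (\<lambda>\<pi>. of_bool (S (\<lambda>i. z (\<pi> i)) \<le> t))"
  by (simp add: perm_cdf_def perm_avg_def)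

lemma perm_cdf_eq_cdf: "perm_cdf N S z = cdf (perm_law N (\<lambda>\<pi>. S (\<lambda>i. z (\<pi> i))))"
  by (rule ext) (simp add: perm_cdf_eq_perm_avg cdf_perm_law)

definition perm_cdf_dist :: "nat \<Rightarrow> ((nat \<Rightarrow> 'a) \<Rightarrow> real) \<Rightarrow> (nat \<Rightarrow> 'a) \<Rightarrow> real" where
  "perm_cdf_dist N S z = (SUP t. \<bar>perm_cdf N S z t - \<Phi> t\<bar>)"

lemma perm_cdf_dist_le:
  assumes "\<And>t. \<bar>perm_cdf N S z t - \<Phi> t\<bar> \<le> b"
  shows "perm_cdf_dist N S z \<le> b"
  unfolding perm_cdf_dist_def using assms by (intro cSUP_least) auto

lemma measurable_perm_cdf_dist:
  assumes "\<And>\<pi>. \<pi> permutes {..<N} \<Longrightarrow> (\<lambda>z. S (\<lambda>i. z (\<pi> i))) \<in> borel_measurable M"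
  shows "perm_cdf_dist N S \<in> borel_measurable M"
proof -
  have eq: "perm_cdf_dist N S = (\<lambda>z. SUP t\<in>\<rat>. \<bar>perm_cdf N S z t - \<Phi> t\<bar>)"
    unfolding perm_cdf_dist_def[abs_def] perm_cdf_eq_cdf
    by (subst cdf_diff_SUP_Rats(1)) (auto simp: real_distribution_perm_law real_dist_normal_dist)
  have [measurable]: "(\<lambda>z. perm_cdf N S z t) \<in> borel_measurable M" for t
    unfolding perm_cdf_eq_perm_avg
  proof (rule borel_measurable_perm_avg)
    fix \<pi> assume "\<pi> permutes {..<N}"
    note [measurable] = assms[OF this]
    show "(\<lambda>z. of_bool (S (\<lambda>i. z (\<pi> i)) \<le> t) :: real) \<in> borel_measurable M" by measurable
  qed
  show ?thesis
    unfolding eq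
  proof (rule borel_measurable_cSUP)
    show "bdd_above ((\<lambda>t. \<bar>perm_cdf N S z t - \<Phi> t\<bar>) ` \<rat>)" for z
      unfolding perm_cdf_eq_cdf
      by (rule bdd_above_mono[OF cdf_diff_SUP_Rats(2)[OF real_distribution_perm_law
          real_dist_normal_dist]]) auto
  qed (auto simp: countable_rat)
qed

section \<open>Uniform approximation of the linear permutation distribution\<close>

context two_sample_limit
begin

text \<open>A bound for the expected second moment of the linear permutation distribution: the 4
  combines the factor 2 of \<open>mean_perm_avg_lin_stat_square\<close> with
  \<open>Cs k < 2 / v\<close>, valid eventually.\<close>

definition "L2 = 4 / v * ((\<integral>x. (f x)\<^sup>2 \<partial>P) + (\<integral>x. (f x)\<^sup>2 \<partial>Q))"

lemma L2_nonneg: "0 \<le> L2" using v by (simp add: L2_def)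

lemma ev_second_moment:
  "eventually (\<lambda>k. integrable (Law k) (\<lambda>z. perm_avg (N k) (\<lambda>\<pi>. (Lin k z \<pi>)\<^sup>2)) \<and>
     (\<integral>z. perm_avg (N k) (\<lambda>\<pi>. (Lin k z \<pi>)\<^sup>2) \<partial>Law k) \<le> L2) sequentially"
proof -
  have "eventually (\<lambda>k. Cs k < 2 / v) sequentially"
    using Cs_lim by (rule order_tendstoD) (use v in \<open>simp add: divide_strict_right_mono\<close>)
  then show ?thesis
    using ev_c ev_N2
  proof eventually_elim
    case (elim k)
    then have c0: "(\<Sum>i<N k. c k i) = 0" by simp
    note X = mean_perm_avg_lin_stat_square[OF fP fsq elim(3) c0, of "{..<m k}"]
    have "2 * (\<Sum>i<N k. (c k i)\<^sup>2) * ((\<integral>x. (f x)\<^sup>2 \<partial>P) + (\<integral>x. (f x)\<^sup>2 \<partial>Q)) \<le> L2"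
      unfolding L2_def using elim by (intro mult_right_mono) auto
    then show ?case using X by auto
  qed
qed

text \<open>The exceptional set \<open>A\<close> collects the data for which the second moment
  reaches \<open>K\<close> or one of finitely many characteristic function values is off by at least
  \<open>\<delta>\<close>; Markov's inequality bounds each part. Off \<open>A\<close> the
  deterministic \<open>levy_uniform\<close> applies.\<close>

lemma linear_part_close:
  assumes \<epsilon>: "0 < \<epsilon>" and e: "0 < e"
  shows "eventually (\<lambda>k. \<exists>A\<in>sets (PiP {..<N k}). measure (Law k) A \<le> e \<and>
    (\<forall>z\<in>space (PiP {..<N k}) - A. \<forall>t.
      \<bar>perm_avg (N k) (\<lambda>\<pi>. of_bool (Lin k z \<pi> \<le> t)) - \<Phi> t\<bar> \<le> \<epsilon>)) sequentially"
proof -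
  define K where "K = 2 * (L2 + 1) / e"
  have K: "0 < K" using e L2_nonneg by (simp add: K_def)
  obtain S \<delta> where S: "finite S" "0 < \<delta>"
    and lev: "\<And>\<mu> t. real_distribution \<mu> \<Longrightarrow> integrable \<mu> (\<lambda>x. x\<^sup>2) \<Longrightarrow> (\<integral>x. x\<^sup>2 \<partial>\<mu>) \<le> K \<Longrightarrow>
      (\<And>s. s \<in> S \<Longrightarrow> cmod (char \<mu> s - exp (- (s\<^sup>2 / 2))) \<le> \<delta>) \<Longrightarrow>
      \<bar>cdf \<mu> t - \<Phi> t\<bar> \<le> \<epsilon>"
    using levy_uniform[OF \<epsilon>, of K] by blast
  \<comment> \<open>The second half of \<open>e\<close> is shared among the frequencies in
    \<open>S\<close>; the added 1 covers an empty \<open>S\<close>.\<close>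
  define e' where "e' = e / (2 * (real (card S) + 1))"
  have e': "0 < e'" using e by (simp add: e'_def add_nonneg_pos)
  define G where "G k s z = cmod (PC k s z - exp (- (s\<^sup>2 / 2)))" for k s z
  have "eventually (\<lambda>k. \<forall>s\<in>S. (\<integral>z. G k s z \<partial>Law k) < \<delta> * e') sequentially"
    unfolding G_def
    by (intro eventually_ball_finite S ballI order_tendstoD[OF perm_char_mean_abs_tendsto]) (use S e' in auto)
  then show ?thesis
    using ev_second_moment
  proof eventually_elim
    case (elim k)
    let ?M = "Law k"
    interpret PQ: prob_space ?M by (rule prob_space_prodPQ)
    define L where "L z = perm_avg (N k) (\<lambda>\<pi>. (Lin k z \<pi>)\<^sup>2)" for z
    have Li: "integrable ?M L" "(\<integral>z. L z \<partial>?M) \<le> L2" using elim(2) by (auto simp: L_def[abs_def])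
    have L0: "0 \<le> L z" for z unfolding L_def by (intro perm_avg_nonneg) simp
    have Gm: "G k s \<in> borel_measurable ?M" for s
      unfolding G_def[abs_def] using measurable_perm_char[OF fP, of "N k" "c k" s] by measurable
    have G2: "G k s z \<le> 2" for s z unfolding G_def by (rule cmod_perm_char_diff_le)
    have G0: "0 \<le> G k s z" for s z by (simp add: G_def)
    have Gi: "integrable ?M (G k s)" for s
      by (rule PQ.integrable_const_bound[where B=2]) (intro AE_I2, simp only: G0 G2 real_norm_def
          abs_of_nonneg, rule Gm)
    define A1 where "A1 = {z \<in> space ?M. K \<le> L z}"
    define A2 where "A2 s = {z \<in> space ?M. \<delta> \<le> G k s z}" for s
    define A where "A = A1 \<union> (\<Union>s\<in>S. A2 s)"
    have A1: "A1 \<in> sets ?M" using borel_measurable_integrable[OF Li(1)] unfolding A1_def by measurable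
    have A2: "A2 s \<in> sets ?M" for s unfolding A2_def using Gm[of s] by measurable
    have "measure ?M A1 \<le> (\<integral>z. L z \<partial>?M) / K"
      unfolding A1_def by (rule integral_Markov_inequality_measure[OF Li(1), of "{}"]) (use L0 K in auto)
    also have "\<dots> \<le> (L2 + 1) / K" using Li(2) K by (intro divide_right_mono) auto
    also have "\<dots> = e / 2"
    proof -
      have "x / (2 * x / e) = e / 2" if "0 < x" for x using that e by simp
      from this[of "L2 + 1"] show ?thesis using L2_nonneg by (simp only: K_def)
    qed
    finally have m1: "measure ?M A1 \<le> e / 2" .
    have m2: "measure ?M (A2 s) \<le> e'" if "s \<in> S" for s
    proof -
      have "measure ?M (A2 s) \<le> (\<integral>z. G k s z \<partial>?M) / \<delta>"
        unfolding A2_def by (rule integral_Markov_inequality_measure[OF Gi, of "{}"]) (use G0 S in auto)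
      also have "\<dots> \<le> e'" using elim that S(2) by (auto simp: pos_divide_le_eq mult.commute less_imp_le)
      finally show ?thesis .
    qed
    have "measure ?M A \<le> measure ?M A1 + measure ?M (\<Union>s\<in>S. A2 s)"
      unfolding A_def using A1 A2 S by (intro measure_Un_le) auto
    also have "\<dots> \<le> e / 2 + (\<Sum>s\<in>S. measure ?M (A2 s))"
      using m1 A2 S by (intro add_mono measure_UNION_le) auto
    also have "\<dots> \<le> e / 2 + (\<Sum>s\<in>S. e')" by (intro add_left_mono sum_mono m2)
    also have "\<dots> \<le> e"
    proof -
      have "real (card S) * e' \<le> (real (card S) + 1) * e'" using e' by (intro mult_right_mono) auto
      also have "\<dots> = e / 2"
      proof -
        have "x * (e / (2 * x)) = e / 2" if "0 < x" for x using that by simp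
        from this[of "real (card S) + 1"] show ?thesis by (simp only: e'_def)
      qed
      finally show ?thesis by simp
    qed
    finally have mA: "measure ?M A \<le> e" .
    have AM: "A \<in> sets (PiP {..<N k})" using A1 A2 S unfolding A_def by auto
    have "\<bar>perm_avg (N k) (\<lambda>\<pi>. of_bool (Lin k z \<pi> \<le> t)) - \<Phi> t\<bar> \<le> \<epsilon>"
      if z: "z \<in> space (PiP {..<N k}) - A" for z t
      unfolding cdf_perm_law[symmetric]
    proof (rule lev[OF real_distribution_perm_law integrable_perm_law])
      show "(\<integral>x. x\<^sup>2 \<partial>perm_law (N k) (Lin k z)) \<le> K"
        using z by (subst integral_perm_law) (auto simp: A_def A1_def L_def)
      fix s assume "s \<in> S"
      then show "cmod (char (perm_law (N k) (Lin k z)) s - exp (- (s\<^sup>2 / 2))) \<le> \<delta>"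
        unfolding char_perm_law using z by (auto simp: A_def A2_def G_def)
    qed simp
    then show ?case using AM mA by auto
  qed
qed

end

section \<open>Replacing the studentized statistic by the linear one\<close>

definition lin_error :: "'a estimator \<Rightarrow> real \<Rightarrow> ('a \<Rightarrow> real) \<Rightarrow> nat \<Rightarrow> (nat \<Rightarrow> 'a) \<Rightarrow> real" where
  "lin_error \<theta>h \<theta>0 f r x = sqrt (real r) * (\<theta>h r x - \<theta>0) - (\<Sum>i<r. f (x i)) / sqrt (real r)"

locale two_sample_estimators = two_sample_limit P Q p f m n D
  for P Q :: "'a measure" and p f m n D +
  fixes \<theta>h \<sigma>h :: "'a estimator" and \<theta>0 :: real
  assumes \<theta>h: "\<And>r. \<theta>h r \<in> borel_measurable (PiP {..<r})"
    and \<sigma>h: "\<And>r. \<sigma>h r \<in> borel_measurable (PiP {..<r})"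
    and lin: "\<And>\<delta>. 0 < \<delta> \<Longrightarrow> (\<lambda>r. measure (PiPb {..<r}) {x \<in> space (PiP {..<r}).
        \<delta> < \<bar>lin_error \<theta>h \<theta>0 f r x\<bar>}) \<longlonglongrightarrow> 0"
    and cons: "\<And>\<delta>. 0 < \<delta> \<Longrightarrow> (\<lambda>r. measure (PiPb {..<r}) {x \<in> space (PiP {..<r}).
        \<delta> < \<bar>\<sigma>h r x - sqrt v\<bar>}) \<longlonglongrightarrow> 0"
begin

definition Bad :: "real \<Rightarrow> nat \<Rightarrow> (nat \<Rightarrow> 'a) set" where
  "Bad \<delta> r = {x \<in> space (PiP {..<r}).
      \<delta> < \<bar>lin_error \<theta>h \<theta>0 f r x\<bar>} \<union>
    {x \<in> space (PiP {..<r}). \<delta> < \<bar>\<sigma>h r x - sqrt v\<bar>}"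

lemma Bad_components:
  "{x \<in> space (PiP {..<r}). \<delta> < \<bar>lin_error \<theta>h \<theta>0 f r x\<bar>} \<in> sets (PiP {..<r})"
  "{x \<in> space (PiP {..<r}). \<delta> < \<bar>\<sigma>h r x - sqrt v\<bar>} \<in> sets (PiP {..<r})"
proof -
  note [measurable] = \<theta>h[of r] \<sigma>h[of r] fP
  have [measurable]: "lin_error \<theta>h \<theta>0 f r \<in> borel_measurable (PiP {..<r})"
    unfolding lin_error_def by measurable
  show "{x \<in> space (PiP {..<r}). \<delta> < \<bar>lin_error \<theta>h \<theta>0 f r x\<bar>} \<in> sets (PiP {..<r})"
    by measurable
  show "{x \<in> space (PiP {..<r}). \<delta> < \<bar>\<sigma>h r x - sqrt v\<bar>} \<in> sets (PiP {..<r})" by measurable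
qed

lemma Bad_sets: "Bad \<delta> r \<in> sets (PiP {..<r})"
  unfolding Bad_def using Bad_components by auto

lemma Bad_tendsto:
  assumes "0 < \<delta>"
  shows "(\<lambda>r. measure (PiPb {..<r}) (Bad \<delta> r)) \<longlonglongrightarrow> 0"
proof (rule tendsto_sandwich[OF always_eventually always_eventually tendsto_const tendsto_add_zero[OF
    lin[OF assms] cons[OF assms]]])
  show "\<forall>r. measure (PiPb {..<r}) (Bad \<delta> r) \<le>
    measure (PiPb {..<r}) {x \<in> space (PiP {..<r}).
        \<delta> < \<bar>lin_error \<theta>h \<theta>0 f r x\<bar>} +
    measure (PiPb {..<r}) {x \<in> space (PiP {..<r}). \<delta> < \<bar>\<sigma>h r x - sqrt v\<bar>}"
    unfolding Bad_def using Bad_components by (intro allI measure_Un_le) auto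
qed simp

abbreviation "S k \<equiv> S_stat \<theta>h \<sigma>h (m k) (n k)"

lemma measurable_S_stat:
  assumes \<pi>: "\<pi> permutes {..<a + b}"
  shows "(\<lambda>z. S_stat \<theta>h \<sigma>h a b (\<lambda>i. z (\<pi> i))) \<in> borel_measurable (PiP {..<a + b})"
proof -
  have lt: "\<pi> i < a + b \<longleftrightarrow> i < a + b" for i using permutes_in_image[OF \<pi>, of i] by simp
  have 1: "(\<lambda>z. first_sample a (\<lambda>i. z (\<pi> i))) \<in> PiP {..<a + b} \<rightarrow>\<^sub>M PiP {..<a}"
    unfolding first_sample_def by (intro measurable_reindex) (auto simp: lt)
  have 2: "(\<lambda>z. second_sample a b (\<lambda>i. z (\<pi> i))) \<in> PiP {..<a + b} \<rightarrow>\<^sub>M PiP {..<b}"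
    unfolding second_sample_def by (intro measurable_reindex[where g="\<lambda>j. \<pi> (a + j)"]) (auto simp: lt)
  note [measurable] = measurable_compose[OF 1 \<theta>h] measurable_compose[OF 1 \<sigma>h] measurable_compose[OF 2 \<theta>h]
      measurable_compose[OF 2 \<sigma>h]
  show ?thesis unfolding S_stat_def T_stat_def V_stat_def by measurable
qed

text \<open>Both permuted samples are expanded around the same centre \<open>\<theta>0\<close>,
  which cancels in the difference. The two errors are rescaled by sqrt (N / m) and sqrt (N / n), and
  sqrt x \<le> x + 1.\<close>

lemma T_stat_minus_lin_stat:
  assumes mn: "0 < a" "0 < b" and \<delta>: "0 \<le> \<delta>"
    and 1: "first_sample a z \<notin> Bad \<delta> a" "first_sample a z \<in> space (PiP {..<a})"
    and 2: "second_sample a b z \<notin> Bad \<delta> b" "second_sample a b z \<in> space (PiP {..<b})"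
  shows "\<bar>T_stat \<theta>h a b z - lin_stat (a + b) (coef a b \<tau>) f z id * \<tau>\<bar> \<le> (real (a + b) / a + real (a
      + b) / b + 2) * \<delta>"
proof -
  define A where "A = lin_error \<theta>h \<theta>0 f a (first_sample a z)"
  define B where "B = lin_error \<theta>h \<theta>0 f b (second_sample a b z)"
  have A: "\<bar>A\<bar> \<le> \<delta>" using 1 by (auto simp: A_def Bad_def)
  have B: "\<bar>B\<bar> \<le> \<delta>" using 2 by (auto simp: B_def Bad_def)
  have eq: "sqrt (real (a + b)) / sqrt r * (sqrt r * x - y / sqrt r)
      = sqrt (real (a + b)) * x - sqrt (real (a + b)) * (y / r)" if "0 < r" for r x y :: real
  proof -
    have "sqrt r * sqrt r = r" "sqrt r \<noteq> 0" using that by auto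
    then show ?thesis by (simp add: right_diff_distrib)
  qed
  have "T_stat \<theta>h a b z - lin_stat (a + b) (coef a b \<tau>) f z id * \<tau>
     = sqrt (real (a + b)) / sqrt (real a) * A - sqrt (real (a + b)) / sqrt (real b) * B"
    unfolding A_def B_def lin_error_def using mn \<tau>(1)
    by (subst (1 2) eq) (simp_all add: T_stat_def first_sample_def second_sample_def lin_stat_coef
        right_diff_distrib)
  also have "\<bar>\<dots>\<bar> \<le> sqrt (real (a + b)) / sqrt (real a) * \<bar>A\<bar> + sqrt (real (a + b)) / sqrt (real b) * \<bar>B\<bar>"
    by (rule order_trans[OF abs_triangle_ineq4]) (simp add: abs_mult)
  also have "\<dots> \<le> sqrt (real (a + b)) / sqrt (real a) * \<delta> + sqrt (real (a + b)) / sqrt (real b) * \<delta>"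
    using A B by (intro add_mono mult_left_mono) auto
  also have "\<dots> = (sqrt (real (a + b) / a) + sqrt (real (a + b) / b)) * \<delta>"
    by (simp add: real_sqrt_divide distrib_right)
  also have "\<dots> \<le> ((real (a + b) / a + 1) + (real (a + b) / b + 1)) * \<delta>"
  proof (intro mult_right_mono add_mono \<delta>)
    have *: "sqrt x \<le> x + 1" if "0 \<le> x" for x
    proof (rule real_le_lsqrt)
      show "x \<le> (x + 1)\<^sup>2" using that by (simp add: power2_eq_square algebra_simps)
    qed (use that in auto)
    show "sqrt (real (a + b) / a) \<le> real (a + b) / a + 1" "sqrt (real (a + b) / b) \<le> real (a + b) / b + 1"
      by (intro *; simp)+
  qed
  finally show ?thesis by (simp add: add_ac)
qed

text \<open>Three things can go wrong: the estimators fail on the first permuted sample, or on the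
  second, or the linear statistic is too large. The first two are transferred from the mixture by
  \<open>contiguity\<close>, the third is excluded by its second moment.\<close>

lemma S_stat_mean_close:
  fixes \<eta> e :: real
  assumes \<eta>: "0 < \<eta>" and e: "0 < e"
  shows "eventually (\<lambda>k. (\<integral>z. perm_avg (N k) (\<lambda>\<pi>. of_bool (\<eta> < \<bar>S k (\<lambda>i. z (\<pi> i)) - Lin k z \<pi>\<bar>)) \<partial>Law k)
      \<le> e) sequentially"
proof -
  \<comment> \<open>Chosen so that Chebyshev's inequality for the linear statistic yields e /
    2.\<close>
  define K where "K = sqrt (2 * (L2 + 1) / e)"
  have K: "0 < K" "K\<^sup>2 = 2 * (L2 + 1) / e" using e L2_nonneg by (auto simp: K_def)
  define g where "g = 1 / p + 1 / (1 - p)"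
  have g: "0 < g" using p by (simp add: g_def add_pos_pos)
  have \<tau>g: "\<tau>\<^sup>2 = (sqrt v)\<^sup>2 * g" unfolding \<tau>(2) using v p by (simp add: g_def field_simps)
  have sv: "0 < sqrt v" using v by simp
  obtain \<delta> where \<delta>: "0 < \<delta>" and stud: "\<forall>a b s1 s2 T L. 0 \<le> a \<longrightarrow> 0 \<le> b \<longrightarrow> a + b \<le> 2 * g \<longrightarrow> \<bar>a + b - g\<bar> \<le> \<delta> \<longrightarrow>
    \<bar>s1 - sqrt v\<bar> \<le> \<delta> \<longrightarrow> \<bar>s2 - sqrt v\<bar> \<le> \<delta> \<longrightarrow> \<bar>T - L * \<tau>\<bar> \<le> (2 * g + 2) * \<delta> \<longrightarrow> \<bar>L\<bar> \<le> K \<longrightarrow>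
    \<bar>T / sqrt (a * s1\<^sup>2 + b * s2\<^sup>2) - L\<bar> \<le> \<eta>"
    using studentized_close[OF \<tau>(1) \<tau>g sv g \<eta> less_imp_le[OF K(1)]] by (elim exE conjE)
  \<comment> \<open>Eventually both m / N and n / N exceed \<open>\<kappa>\<close>, so the positions
    outside either sample form a fixed fraction of all, as \<open>Bernstein_le_convolution\<close>
    requires.\<close>
  define \<kappa> where "\<kappa> = min p (1 - p) / 2"
  have \<kappa>: "0 < \<kappa>" "\<kappa> < p" "\<kappa> < 1 - p" using p by (auto simp: \<kappa>_def min_def)
  obtain C n0 where C: "0 < C" and Cb: "\<And>a b M i. n0 \<le> a + b \<Longrightarrow> \<kappa> * real (a + b) \<le> real a \<Longrightarrow>
     \<bar>real M - real (a + b) * p\<bar> \<le> D * sqrt (a + b) \<Longrightarrow> i \<le> a \<Longrightarrow> Bernstein a i p \<le> C * Bernstein (a + b) M p"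
    using Bernstein_le_convolution[OF p \<kappa>(1) D(1)] by blast
  have ga: "(\<lambda>k. real (N k) / m k + real (N k) / n k) \<longlonglongrightarrow> g" unfolding g_def by (intro tendsto_add Nm Nn)
  have e1: "eventually (\<lambda>k. real (N k) / m k + real (N k) / n k < 2 * g) sequentially"
    using ga by (rule order_tendstoD) (use g in simp)
  have e2: "eventually (\<lambda>k. dist (real (N k) / m k + real (N k) / n k) g < \<delta>) sequentially"
    using ga \<delta> by (rule tendstoD)
  have e3: "eventually (\<lambda>k. \<kappa> < real (m k) / real (N k)) sequentially" "eventually (\<lambda>k. \<kappa>
      < real (n k) / real (N k)) sequentially"
    using order_tendstoD(1)[OF pm \<kappa>(2)] order_tendstoD(1)[OF pn \<kappa>(3)] .
  have "filterlim N at_top sequentially" by (rule filterlim_at_top_mono[OF m]) auto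
  then have e4: "eventually (\<lambda>k. n0 \<le> N k) sequentially" by (simp add: filterlim_at_top)
  have e5: "eventually (\<lambda>k. measure (PiPb {..<m k}) (Bad \<delta> (m k)) < e / (4 * C)) sequentially"
    "eventually (\<lambda>k. measure (PiPb {..<n k}) (Bad \<delta> (n k)) < e / (4 * C)) sequentially"
    using e C by (intro order_tendstoD(2)[OF filterlim_compose[OF Bad_tendsto[OF \<delta>] m]]
        order_tendstoD(2)[OF filterlim_compose[OF Bad_tendsto[OF \<delta>] n]]; simp)+
  show ?thesis
    using e1 e2 e3 e4 e5 ev_mn ev_second_moment D(2)
  proof eventually_elim
    case (elim k)
    let ?M = "Law k"
    interpret PQ: prob_space ?M by (rule prob_space_prodPQ)
    have mn: "0 < m k" "0 < n k" using elim by auto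
    have N0: "0 < real (N k)" using mn by simp
    define F where "F \<pi> z = (of_bool (\<eta> < \<bar>S k (\<lambda>i. z (\<pi> i)) - Lin k z \<pi>\<bar>) :: real)" for \<pi> z
    define A1 where "A1 \<pi> = {z \<in> space (PiP {..<N k}). (\<lambda>i\<in>{..<m k}. z (\<pi> i)) \<in> Bad \<delta> (m k)}" for \<pi>
    define A2 where "A2 \<pi> = {z \<in> space (PiP {..<N k}). (\<lambda>j\<in>{..<n k}. z (\<pi> (m k + j))) \<in> Bad \<delta> (n k)}" for \<pi>
    define L where "L \<pi> z = (Lin k z \<pi>)\<^sup>2" for \<pi> z
    have lt: "\<pi> i < N k \<longleftrightarrow> i < N k" if "\<pi> permutes {..<N k}" for \<pi> i
      using permutes_in_image[OF that, of i] by simp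
    have r1: "(\<lambda>z. \<lambda>i\<in>{..<m k}. z (\<pi> i)) \<in> PiP {..<N k} \<rightarrow>\<^sub>M PiP {..<m k}"
      and r2: "(\<lambda>z. \<lambda>j\<in>{..<n k}. z (\<pi> (m k + j))) \<in> PiP {..<N k} \<rightarrow>\<^sub>M PiP {..<n k}"
      if \<pi>: "\<pi> permutes {..<N k}" for \<pi>
      using measurable_reindex[of \<pi> "{..<m k}" "{..<N k}"] measurable_reindex[of "\<lambda>j. \<pi> (m k
          + j)" "{..<n k}" "{..<N k}"]
      by (auto simp: lt[OF \<pi>])
    have A1m: "A1 \<pi> \<in> sets ?M" and A2m: "A2 \<pi> \<in> sets ?M" if \<pi>: "\<pi> permutes {..<N k}" for \<pi>
      using measurable_sets[OF r1[OF \<pi>] Bad_sets] measurable_sets[OF r2[OF \<pi>] Bad_sets]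
      by (auto simp: A1_def A2_def vimage_def Int_def conj_commute)
    have Fm: "F \<pi> \<in> borel_measurable ?M" if \<pi>: "\<pi> permutes {..<N k}" for \<pi>
    proof -
      note [measurable] = measurable_S_stat[OF \<pi>] measurable_lin_stat[OF fP \<pi>]
      show ?thesis unfolding F_def[abs_def] by measurable
    qed
    have Fi: "integrable ?M (F \<pi>)" if \<pi>: "\<pi> permutes {..<N k}" for \<pi>
      by (rule PQ.integrable_const_bound[where B=1]) (auto simp: F_def[abs_def] Fm[OF \<pi>, unfolded
          F_def[abs_def]])
    have Li: "integrable ?M (\<lambda>z. perm_avg (N k) (\<lambda>\<pi>. L \<pi> z))" "(\<integral>z. perm_avg (N k) (\<lambda>\<pi>. L \<pi> z) \<partial>?M) \<le> L2"
      using elim(9) by (auto simp: L_def)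
    have ind: "integrable ?M (indicator B :: _ \<Rightarrow> real)" if "B \<in> sets ?M" for B
      using that by (intro integrable_real_indicator) (auto simp: PQ.emeasure_eq_measure)
    have Ii: "integrable ?M (\<lambda>z. perm_avg (N k) (\<lambda>\<pi>. indicator (A1 \<pi>) z :: real))"
        "integrable ?M (\<lambda>z. perm_avg (N k) (\<lambda>\<pi>. indicator (A2 \<pi>) z :: real))"
      by (intro integrable_perm_avg(1) ind A1m A2m; assumption)+
    \<comment> \<open>Outside the two bad sets and for
      \<open>\<bar>Lin k z \<pi>\<bar> \<le> K\<close> the left side is 0 by
      \<open>studentized_close\<close>; otherwise one of the summands on the right already gives
      1.\<close>
    have pt: "F \<pi> z \<le> indicator (A1 \<pi>) z + indicator (A2 \<pi>) z + L \<pi> z / K\<^sup>2"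
      if \<pi>: "\<pi> permutes {..<N k}" and z: "z \<in> space ?M" for \<pi> z
    proof (cases "z \<in> A1 \<pi> \<or> z \<in> A2 \<pi> \<or> K < \<bar>Lin k z \<pi>\<bar>")
      case True
      have L0: "0 \<le> L \<pi> z / K\<^sup>2" by (simp add: L_def)
      have F1: "F \<pi> z \<le> 1" by (simp add: F_def)
      show ?thesis
      proof (cases "z \<in> A1 \<pi> \<or> z \<in> A2 \<pi>")
        case True
        then have "1 \<le> indicator (A1 \<pi>) z + (indicator (A2 \<pi>) z :: real)" by (auto split: split_indicator)
        then show ?thesis using L0 F1 by linarith
      next
        case False
        then have "K\<^sup>2 \<le> \<bar>Lin k z \<pi>\<bar>\<^sup>2" using True K by (intro power_mono) auto
        then have "1 \<le> L \<pi> z / K\<^sup>2" using K(1) by (simp add: L_def)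
        moreover have "0 \<le> indicator (A1 \<pi>) z + (indicator (A2 \<pi>) z :: real)" by simp
        ultimately show ?thesis using F1 by linarith
      qed
    next
      case False
      let ?z = "\<lambda>i. z (\<pi> i)"
      have f1: "first_sample (m k) ?z = (\<lambda>i\<in>{..<m k}. z (\<pi> i))"
          and f2: "second_sample (m k) (n k) ?z = (\<lambda>j\<in>{..<n k}. z (\<pi> (m k + j)))"
        by (simp_all add: first_sample_def second_sample_def)
      have z': "z \<in> space (PiP {..<N k})" using z by simp
      have s1: "first_sample (m k) ?z \<in> space (PiP {..<m k})" "first_sample (m k) ?z \<notin> Bad \<delta> (m k)"
        unfolding f1 using measurable_space[OF r1[OF \<pi>] z'] False z' by (auto simp: A1_def)
      have s2: "second_sample (m k) (n k) ?z \<in> space (PiP {..<n k})"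
          "second_sample (m k) (n k) ?z \<notin> Bad \<delta> (n k)"
        unfolding f2 using measurable_space[OF r2[OF \<pi>] z'] False z' by (auto simp: A2_def)
      have leq: "Lin k ?z id = Lin k z \<pi>" by (simp add: lin_stat_def)
      have "\<bar>T_stat \<theta>h (m k) (n k) ?z - Lin k z \<pi> * \<tau>\<bar> \<le> (real (N k) / m k + real (N k) / n k + 2) * \<delta>"
        unfolding leq[symmetric] using \<delta> by (intro T_stat_minus_lin_stat mn s1 s2) auto
      also have "\<dots> \<le> (2 * g + 2) * \<delta>" using elim(1) \<delta> by (intro mult_right_mono) auto
      finally have T: "\<bar>T_stat \<theta>h (m k) (n k) ?z - Lin k z \<pi> * \<tau>\<bar> \<le> (2 * g + 2) * \<delta>" .
      have "\<bar>S k ?z - Lin k z \<pi>\<bar> \<le> \<eta>"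
        unfolding S_stat_def V_stat_def
      proof (rule stud[rule_format])
        show "\<bar>\<sigma>h (m k) (first_sample (m k) ?z) - sqrt v\<bar> \<le> \<delta>" using s1 by (auto simp: Bad_def)
        show "\<bar>\<sigma>h (n k) (second_sample (m k) (n k) ?z) - sqrt v\<bar> \<le> \<delta>" using s2 by (auto simp: Bad_def)
        show "\<bar>real (N k) / real (m k) + real (N k) / real (n k) - g\<bar> \<le> \<delta>" using elim(2)
            by (simp add: dist_real_def)
        show "\<bar>Lin k z \<pi>\<bar> \<le> K" using False by simp
      qed (use T elim(1) in auto)
      then have "F \<pi> z = 0" by (simp add: F_def)
      then show ?thesis by (simp add: L_def)
    qed
    have "(\<integral>z. perm_avg (N k) (\<lambda>\<pi>. F \<pi> z) \<partial>?M)
      \<le> (\<integral>z. perm_avg (N k) (\<lambda>\<pi>. indicator (A1 \<pi>) z) + perm_avg (N k) (\<lambda>\<pi>. indicator (A2 \<pi>) z) + perm_avg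
          (N k) (\<lambda>\<pi>. L \<pi> z) / K\<^sup>2 \<partial>?M)"
    proof (rule integral_mono)
      show "integrable ?M (\<lambda>z. perm_avg (N k) (\<lambda>\<pi>. F \<pi> z))" by (rule integrable_perm_avg(1)) (rule Fi)
      fix z assume z: "z \<in> space ?M"
      have "perm_avg (N k) (\<lambda>\<pi>. F \<pi> z) \<le> perm_avg (N k) (\<lambda>\<pi>. indicator (A1 \<pi>) z + indicator (A2 \<pi>) z
          + 1 / K\<^sup>2 * L \<pi> z)"
        using pt[OF _ z] by (intro perm_avg_mono) simp
      then show "perm_avg (N k) (\<lambda>\<pi>. F \<pi> z) \<le> perm_avg (N k) (\<lambda>\<pi>. indicator (A1 \<pi>) z)
          + perm_avg (N k) (\<lambda>\<pi>. indicator (A2 \<pi>) z) + perm_avg (N k) (\<lambda>\<pi>. L \<pi> z) / K\<^sup>2"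
        by (simp only: perm_avg_add perm_avg_cmult) simp
    qed (use Li Ii in auto)
    also have "\<dots> = (\<integral>z. perm_avg (N k) (\<lambda>\<pi>. indicator (A1 \<pi>) z) \<partial>?M)
        + (\<integral>z. perm_avg (N k) (\<lambda>\<pi>. indicator (A2 \<pi>) z) \<partial>?M)
        + (\<integral>z. perm_avg (N k) (\<lambda>\<pi>. L \<pi> z) \<partial>?M) / K\<^sup>2"
      using Li Ii by simp
    also have "\<dots> \<le> e / 4 + e / 4 + e / 2"
    proof (intro add_mono)
      have i: "(\<integral>z. perm_avg (N k) (\<lambda>\<pi>. indicator (A \<pi>) z) \<partial>?M) = perm_avg (N k) (\<lambda>\<pi>. measure ?M (A \<pi>))"
        if A: "\<And>\<pi>. \<pi> permutes {..<N k} \<Longrightarrow> A \<pi> \<in> sets ?M" for A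
      proof -
        have "(\<integral>z. indicator (A \<pi>) z \<partial>?M) = measure ?M (A \<pi>)" if \<pi>: "\<pi> permutes {..<N k}" for \<pi>
          using sets.sets_into_space[OF A[OF \<pi>]] by (simp add: Int_absorb2 del: space_prodPQ)
        moreover have "(\<integral>z. perm_avg (N k) (\<lambda>\<pi>. indicator (A \<pi>) z :: real) \<partial>?M)
            = perm_avg (N k) (\<lambda>\<pi>. \<integral>z. indicator (A \<pi>) z \<partial>?M)"
          by (rule integrable_perm_avg(2)) (rule ind, rule A)
        ultimately show ?thesis by (simp cong: perm_avg_cong)
      qed
      have i1: "(\<integral>z. perm_avg (N k) (\<lambda>\<pi>. indicator (A1 \<pi>) z) \<partial>?M) = perm_avg (N k) (\<lambda>\<pi>. measure ?M (A1 \<pi>))"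
        by (rule i) (rule A1m)
      have i2: "(\<integral>z. perm_avg (N k) (\<lambda>\<pi>. indicator (A2 \<pi>) z) \<partial>?M) = perm_avg (N k) (\<lambda>\<pi>. measure ?M (A2 \<pi>))"
        by (rule i) (rule A2m)
      have "(\<integral>z. perm_avg (N k) (\<lambda>\<pi>. indicator (A1 \<pi>) z) \<partial>?M) \<le> C * measure (PiPb {..<m k}) (Bad \<delta> (m k))"
        unfolding i1 unfolding A1_def
      \<comment> \<open>The positions outside the first sample number \<open>n k\<close>; they are
        the block \<open>a\<close> of the convolution.\<close>
      proof (rule contiguity[OF _ _ _ _ _ _ Bad_sets, where \<iota>="\<lambda>i. i"])
        fix i assume "i \<le> N k - m k"
        moreover have "\<kappa> * real (N k) \<le> real (n k)" using elim(4) N0 by (simp add: pos_less_divide_eq)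
        ultimately show "Bernstein (N k - m k) i p \<le> C * Bernstein (N k) (m k) p"
          using Cb[of "n k" "m k" "m k" i] elim by (simp add: add.commute)
      qed (use C in auto)
      also have "\<dots> \<le> e / 4" using elim(6) C by (simp add: field_simps)
      finally show "(\<integral>z. perm_avg (N k) (\<lambda>\<pi>. indicator (A1 \<pi>) z) \<partial>?M) \<le> e / 4" .
      have "(\<integral>z. perm_avg (N k) (\<lambda>\<pi>. indicator (A2 \<pi>) z) \<partial>?M) \<le> C * measure (PiPb {..<n k}) (Bad \<delta> (n k))"
        unfolding i2 unfolding A2_def
      \<comment> \<open>The selected block has moved, but the number of labels \<open>P\<close> is
        still \<open>m k\<close>, so the denominator is the same central probability.\<close>
      proof (rule contiguity[OF _ _ _ _ _ _ Bad_sets, where \<iota>="\<lambda>j. m k + j"])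
        fix i assume "i \<le> N k - n k"
        moreover have "\<kappa> * real (N k) \<le> real (m k)" using elim(3) N0 by (simp add: pos_less_divide_eq)
        ultimately show "Bernstein (N k - n k) i p \<le> C * Bernstein (N k) (m k) p"
          using Cb[of "m k" "n k" "m k" i] elim by simp
      qed (use C in auto)
      also have "\<dots> \<le> e / 4" using elim(7) C by (simp add: field_simps)
      finally show "(\<integral>z. perm_avg (N k) (\<lambda>\<pi>. indicator (A2 \<pi>) z) \<partial>?M) \<le> e / 4" .
      have "(\<integral>z. perm_avg (N k) (\<lambda>\<pi>. L \<pi> z) \<partial>?M) / K\<^sup>2 \<le> (L2 + 1) / K\<^sup>2"
        using Li(2) by (intro divide_right_mono) auto
      also have "\<dots> = e / 2"
      proof -
        have "x / (2 * x / e) = e / 2" if "0 < x" for x using that e by simp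
        from this[of "L2 + 1"] show ?thesis using L2_nonneg by (simp only: K(2))
      qed
      finally show "(\<integral>z. perm_avg (N k) (\<lambda>\<pi>. L \<pi> z) \<partial>?M) / K\<^sup>2 \<le> e / 2" .
    qed
    finally show ?case by (simp add: F_def)
  qed
qed

lemma measurable_perm_cdf_dist_S: "perm_cdf_dist (N k) (S k) \<in> borel_measurable (PiP {..<N k})"
  by (rule measurable_perm_cdf_dist) (rule measurable_S_stat)

lemma perm_cdf_dist_tendsto:
  assumes \<epsilon>: "0 < \<epsilon>"
  shows "(\<lambda>k. measure (Law k) {z \<in> space (PiP {..<N k}). \<epsilon> < perm_cdf_dist (N k) (S k) z}) \<longlonglongrightarrow> 0"
proof (rule tendstoI)
  fix e :: real assume e: "0 < e"
  let ?d = "\<lambda>k z. perm_avg (N k) (\<lambda>\<pi>. of_bool (\<epsilon> / 3 < \<bar>S k (\<lambda>i. z (\<pi> i)) - Lin k z \<pi>\<bar>)) :: real"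
  \<comment> \<open>One third of \<open>\<epsilon>\<close> each goes to the linear approximation, to
    the shift and to the proportion of deviating permutations; Markov's inequality at level
    \<epsilon> / 3 turns \<epsilon> e / 12 into e / 4.\<close>
  have \<epsilon>3: "0 < \<epsilon> / 3" and e4: "0 < e / 4" and ee: "0 < \<epsilon> * e / 12" using \<epsilon> e by auto
  show "eventually (\<lambda>k. dist (measure (Law k) {z \<in> space (PiP {..<N k}). \<epsilon>
      < perm_cdf_dist (N k) (S k) z}) 0 < e) sequentially"
    using linear_part_close[OF \<epsilon>3 e4] S_stat_mean_close[OF \<epsilon>3 ee]
  proof eventually_elim
    case (elim k)
    let ?M = "Law k"
    interpret PQ: prob_space ?M by (rule prob_space_prodPQ)
    obtain A where A: "A \<in> sets (PiP {..<N k})" "measure ?M A \<le> e / 4"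
      and cl: "\<And>z t. z \<in> space (PiP {..<N k}) - A \<Longrightarrow>
        \<bar>perm_avg (N k) (\<lambda>\<pi>. of_bool (Lin k z \<pi> \<le> t)) - \<Phi> t\<bar> \<le> \<epsilon> / 3"
      using elim(1) by blast
    have di: "integrable ?M (?d k)"
    proof (rule integrable_perm_avg(1))
      fix \<pi> assume \<pi>: "\<pi> permutes {..<N k}"
      note [measurable] = measurable_S_stat[OF \<pi>] measurable_lin_stat[OF fP \<pi>]
      have "(\<lambda>z. of_bool (\<epsilon> / 3 < \<bar>S k (\<lambda>i. z (\<pi> i)) - Lin k z \<pi>\<bar>) :: real) \<in> borel_measurable ?M"
        by measurable
      then show "integrable ?M (\<lambda>z. of_bool (\<epsilon> / 3 < \<bar>S k (\<lambda>i. z (\<pi> i)) - Lin k z \<pi>\<bar>) :: real)"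
        by (rule PQ.integrable_const_bound[where B=1, rotated]) auto
    qed
    define B where "B = {z \<in> space ?M. \<epsilon> / 3 \<le> ?d k z}"
    have Bm: "B \<in> sets ?M" using borel_measurable_integrable[OF di] unfolding B_def by measurable
    have "measure ?M B \<le> (\<integral>z. ?d k z \<partial>?M) / (\<epsilon> / 3)"
      unfolding B_def by (rule integral_Markov_inequality_measure[OF di, of "{}"]) (use \<epsilon>3 in \<open>auto
          intro!: perm_avg_nonneg\<close>)
    also have "\<dots> \<le> (\<epsilon> * e / 12) / (\<epsilon> / 3)" using elim(2) \<epsilon> by (intro divide_right_mono) auto
    also have "\<dots> = e / 4" using \<epsilon> by simp
    finally have mB: "measure ?M B \<le> e / 4" .
    have sub: "{z \<in> space (PiP {..<N k}). \<epsilon> < perm_cdf_dist (N k) (S k) z} \<subseteq> A \<union> B"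
    proof (rule subsetI, rule ccontr)
      fix z assume z: "z \<in> {z \<in> space (PiP {..<N k}). \<epsilon> < perm_cdf_dist (N k) (S k) z}" "z \<notin> A \<union> B"
      have "perm_cdf_dist (N k) (S k) z \<le> \<epsilon> / 3 + \<epsilon> / 3 + ?d k z"
        unfolding perm_cdf_eq_perm_avg[symmetric]
      proof (rule perm_cdf_dist_le, unfold perm_cdf_eq_perm_avg, rule perm_avg_cdf_perturb)
        show "\<bar>perm_avg (N k) (\<lambda>\<pi>. of_bool (Lin k z \<pi> \<le> t)) - \<Phi> t\<bar> \<le> \<epsilon> / 3" for t
          by (rule cl) (use z in auto)
      qed (use \<epsilon> in simp)
      also have "\<dots> < \<epsilon>" using z by (auto simp: B_def)
      finally show False using z by auto
    qed
    have "measure ?M {z \<in> space (PiP {..<N k}). \<epsilon> < perm_cdf_dist (N k) (S k) z} \<le> measure ?M (A \<union> B)"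
      using A Bm by (intro PQ.finite_measure_mono sub) auto
    also have "\<dots> \<le> measure ?M A + measure ?M B" using A Bm by (intro measure_Un_le) auto
    also have "\<dots> < e" using A mB e by simp
    finally show ?case by simp
  qed
qed

end

section \<open>Transfer to the given random variables\<close>

lemma perm_cdf_dist_nonneg: "0 \<le> perm_cdf_dist N S z"
proof -
  have "bdd_above (range (\<lambda>t. \<bar>perm_cdf N S z t - \<Phi> t\<bar>))"
    unfolding perm_cdf_eq_cdf
    by (rule cdf_diff_SUP_Rats(2)[OF real_distribution_perm_law real_dist_normal_dist])
  then show ?thesis
    unfolding perm_cdf_dist_def by (rule cSUP_upper2[of _ _ 0]) auto
qed

text \<open>\<open>pooled\<close> is defined at all indices, whereas points of the product space are
  \<open>undefined\<close> beyond the sample. Permutations of \<open>{..<m + n}\<close> never bring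
  outside indices into either sample.\<close>

lemma perm_cdf_dist_restrict:
  "perm_cdf_dist (m + n) (S_stat \<theta>h \<sigma>h m n) (\<lambda>i\<in>{..<m + n}. z i) = perm_cdf_dist (m + n) (S_stat \<theta>h \<sigma>h m n) z"
proof -
  have "S_stat \<theta>h \<sigma>h m n (\<lambda>i. (\<lambda>i\<in>{..<m + n}. z i) (\<pi> i)) = S_stat \<theta>h \<sigma>h m n (\<lambda>i. z (\<pi> i))"
    if \<pi>: "\<pi> permutes {..<m + n}" for \<pi>
  proof -
    have lt: "\<pi> i < m + n \<longleftrightarrow> i < m + n" for i using permutes_in_image[OF \<pi>, of i] by simp
    have "first_sample m (\<lambda>i. (\<lambda>i\<in>{..<m + n}. z i) (\<pi> i)) = first_sample m (\<lambda>i. z (\<pi> i))"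
      "second_sample m n (\<lambda>i. (\<lambda>i\<in>{..<m + n}. z i) (\<pi> i)) = second_sample m n (\<lambda>i. z (\<pi> i))"
      by (auto simp: first_sample_def second_sample_def lt intro!: restrict_ext)
    then show ?thesis by (simp only: S_stat_def T_stat_def V_stat_def)
  qed
  then have "perm_cdf (m + n) (S_stat \<theta>h \<sigma>h m n) (\<lambda>i\<in>{..<m + n}. z i) t
      = perm_cdf (m + n) (S_stat \<theta>h \<sigma>h m n) z t" for t
    unfolding perm_cdf_eq_perm_avg by (intro perm_avg_cong) simp
  then show ?thesis by (simp only: perm_cdf_dist_def)
qed

lemma (in prob_space) measure_iid_restrict:
  assumes "B \<in> sets (PiM {..<r} (\<lambda>_. M))"
  shows "measure (PiM {..<r} (\<lambda>_. M)) B = measure (iid_space M) {\<omega> \<in> space (iid_space M). restrict \<omega>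
      {..<r} \<in> B}"
proof -
  have "distr (iid_space M) (PiM {..<r} (\<lambda>_. M)) (\<lambda>\<omega>. \<lambda>i\<in>{..<r}. \<omega> i) = PiM {..<r} (\<lambda>_. M)"
    using distr_PiM_reindex[of UNIV "\<lambda>_. M" "\<lambda>i. i" "{..<r}"] prob_space_axioms by auto
  then have "measure (PiM {..<r} (\<lambda>_. M)) B
      = measure (distr (iid_space M) (PiM {..<r} (\<lambda>_. M)) (\<lambda>\<omega>. restrict \<omega> {..<r})) B"
    by simp
  also have "\<dots> = measure (iid_space M) ((\<lambda>\<omega>. restrict \<omega> {..<r}) -` B \<inter> space (iid_space M))"
    using assms by (intro measure_distr measurable_restrict_subset) auto
  also have "(\<lambda>\<omega>. restrict \<omega> {..<r}) -` B \<inter> space (iid_space M)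
      = {\<omega> \<in> space (iid_space M). restrict \<omega> {..<r} \<in> B}" by auto
  finally show ?thesis .
qed

text \<open>The asymptotic assumptions live on infinite sequences, \<open>contiguity\<close> on
  finite products; the restriction to the first \<open>r\<close> coordinates carries one law to the
  other.\<close>

lemma (in prob_space) tendsto_prob_iid_restrict:
  assumes lim: "tendsto_prob (\<lambda>_. iid_space M) (\<lambda>r \<omega>. g r (restrict \<omega> {..<r})) c"
    and g: "\<And>r. g r \<in> borel_measurable (PiM {..<r} (\<lambda>_. M))" and \<delta>: "0 < \<delta>"
  shows "(\<lambda>r. measure (PiM {..<r} (\<lambda>_. M)) {x \<in> space (PiM {..<r} (\<lambda>_. M)). \<delta> < \<bar>g r x - c\<bar>}) \<longlonglongrightarrow> 0"
proof -
  have "measure (PiM {..<r} (\<lambda>_. M)) {x \<in> space (PiM {..<r} (\<lambda>_. M)). \<delta> < \<bar>g r x - c\<bar>}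
     = measure (iid_space M) {\<omega> \<in> space (iid_space M). \<delta> < \<bar>g r (restrict \<omega> {..<r}) - c\<bar>}" for r
  proof -
    note [measurable] = g[of r]
    have "{x \<in> space (PiM {..<r} (\<lambda>_. M)). \<delta> < \<bar>g r x - c\<bar>} \<in> sets (PiM {..<r} (\<lambda>_. M))" by measurable
    moreover have "{\<omega> \<in> space (iid_space M). restrict \<omega> {..<r} \<in> {x \<in> space (PiM {..<r} (\<lambda>_. M)). \<delta>
        < \<bar>g r x - c\<bar>}}
      = {\<omega> \<in> space (iid_space M). \<delta> < \<bar>g r (restrict \<omega> {..<r}) - c\<bar>}"
      by (auto simp: space_PiM)
    ultimately show ?thesis by (simp only: measure_iid_restrict)
  qed
  then show ?thesis using lim \<delta> by (simp add: tendsto_prob_def)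
qed

text \<open>Independence identifies the joint law over the disjoint sum of the index sets as a
  product; \<open>pooled\<close> is a reindexing of it along the injection \<open>g\<close>.\<close>

lemma (in two_sample) distr_pooled:
  fixes X Y :: "nat \<Rightarrow> 'w \<Rightarrow> 'a"
  assumes "prob_space \<Omega>" and M: "sets M = sets P" and mn: "0 < m + n"
    and ind: "prob_space.indep_vars \<Omega> (\<lambda>_. M) (case_sum X Y) ({..<m} <+> {..<n})"
    and X: "\<And>i. i < m \<Longrightarrow> distr \<Omega> M (X i) = P" and Y: "\<And>j. j < n \<Longrightarrow> distr \<Omega> M (Y j) = Q"
  shows "distr \<Omega> (PiP {..<m + n}) (\<lambda>\<omega>. \<lambda>i\<in>{..<m + n}. pooled m (\<lambda>i. X i \<omega>) (\<lambda>j. Y j \<omega>) i)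
      = prodPQ {..<m + n} {..<m}"
proof -
  interpret \<Omega>: prob_space \<Omega> by fact
  define I where "I = {..<m} <+> {..<n}"
  define g where "g i = (if i < m then Inl i else Inr (i - m) :: nat + nat)" for i
  define R where "R = case_sum (\<lambda>_::nat. P) (\<lambda>_::nat. Q)"
  define Z where "Z \<omega> = (\<lambda>i\<in>I. case_sum X Y i \<omega>)" for \<omega>
  have rv: "case_sum X Y i \<in> \<Omega> \<rightarrow>\<^sub>M M" if "i \<in> I" for i
    using ind that unfolding \<Omega>.indep_vars_def I_def by blast
  have ne: "I \<noteq> {}" using mn by (auto simp: I_def)
  have "distr \<Omega> (PiM I (\<lambda>_. M)) Z = PiM I (\<lambda>i. distr \<Omega> M (case_sum X Y i))"
    using ind unfolding Z_def I_def[symmetric] by (subst (asm) \<Omega>.indep_vars_iff_distr_eq_PiM'[OF ne rv]) auto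
  also have "\<dots> = PiM I R"
    by (intro PiM_cong refl) (auto simp: I_def R_def X Y)
  finally have law: "distr \<Omega> (PiM I (\<lambda>_. M)) Z = PiM I R" .
  have sR: "sets (PiM I R) = sets (PiM I (\<lambda>_. M))"
    by (intro sets_PiM_cong) (auto simp: R_def M sets_Q split: sum.splits)
  have gI: "inj_on g {..<m + n}" "g \<in> {..<m + n} \<rightarrow> I"
    by (auto simp: inj_on_def g_def I_def split: if_splits)
  have R: "prob_space (R i)" for i by (cases i) (auto simp: R_def P Q)
  have Rg: "R (g i) = (if i \<in> {..<m} then P else Q)" for i by (simp add: R_def g_def)
  have sg: "sets (PiM {..<m + n} (\<lambda>i. R (g i))) = sets (PiP {..<m + n})"
    unfolding Rg by (intro sets_PiM_cong) (auto simp: sets_Q)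
  have Zm: "Z \<in> \<Omega> \<rightarrow>\<^sub>M PiM I (\<lambda>_. M)" unfolding Z_def by (intro measurable_restrict rv)
  have rm: "(\<lambda>z. \<lambda>i\<in>{..<m + n}. z (g i)) \<in> PiM I (\<lambda>_. M) \<rightarrow>\<^sub>M PiP {..<m + n}"
  proof (rule measurable_restrict)
    fix i assume "i \<in> {..<m + n}"
    then have "(\<lambda>z. z (g i)) \<in> PiM I (\<lambda>_. M) \<rightarrow>\<^sub>M M" using gI(2) by (intro measurable_component_singleton) auto
    then show "(\<lambda>z. z (g i)) \<in> PiM I (\<lambda>_. M) \<rightarrow>\<^sub>M P" by (simp only: measurable_cong_sets[OF refl M])
  qed
  have "(\<lambda>\<omega>. \<lambda>i\<in>{..<m + n}. pooled m (\<lambda>i. X i \<omega>) (\<lambda>j. Y j \<omega>) i) = (\<lambda>z. \<lambda>i\<in>{..<m + n}. z (g i)) \<circ> Z"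
    by (auto simp: fun_eq_iff pooled_def Z_def g_def I_def restrict_def)
  then have "distr \<Omega> (PiP {..<m + n}) (\<lambda>\<omega>. \<lambda>i\<in>{..<m + n}. pooled m (\<lambda>i. X i \<omega>) (\<lambda>j. Y j \<omega>) i)
     = distr (PiM I R) (PiP {..<m + n}) (\<lambda>z. \<lambda>i\<in>{..<m + n}. z (g i))"
    unfolding law[symmetric] using distr_distr[OF rm Zm] by simp
  also have "\<dots> = distr (PiM I R) (PiM {..<m + n} (\<lambda>i. R (g i))) (\<lambda>z. \<lambda>i\<in>{..<m + n}. z (g i))"
    by (intro distr_cong refl sg[symmetric])
  also have "\<dots> = PiM {..<m + n} (\<lambda>i. R (g i))"
    by (intro distr_PiM_reindex R gI)
  also have "\<dots> = prodPQ {..<m + n} {..<m}" unfolding prodPQ_def Rg ..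
  finally show ?thesis .
qed

lemma measurable_pooled:
  assumes "prob_space \<Omega>" and M: "sets M = sets P"
    and ind: "prob_space.indep_vars \<Omega> (\<lambda>_. M) (case_sum X Y) ({..<m} <+> {..<n})"
  shows "(\<lambda>\<omega>. \<lambda>i\<in>{..<m + n}. pooled m (\<lambda>i. X i \<omega>) (\<lambda>j. Y j \<omega>) i) \<in> \<Omega> \<rightarrow>\<^sub>M PiM {..<m + n} (\<lambda>_. P)"
proof (rule measurable_restrict)
  interpret \<Omega>: prob_space \<Omega> by fact
  have rv: "case_sum X Y j \<in> \<Omega> \<rightarrow>\<^sub>M P" if "j \<in> {..<m} <+> {..<n}" for j
    using ind that unfolding \<Omega>.indep_vars_def measurable_cong_sets[OF refl M] by blast
  fix i assume i: "i \<in> {..<m + n}"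
  show "(\<lambda>\<omega>. pooled m (\<lambda>i. X i \<omega>) (\<lambda>j. Y j \<omega>) i) \<in> \<Omega> \<rightarrow>\<^sub>M P"
  proof (cases "i < m")
    case True
    then show ?thesis using rv[of "Inl i"] by (auto simp: pooled_def)
  next
    case False
    then have "Inr (i - m) \<in> {..<m} <+> {..<n}" using i by auto
    then show ?thesis using rv[of "Inr (i - m)"] False by (auto simp: pooled_def)
  qed
qed

theorem theorem2p2:
  fixes M P Q :: "'a measure"
    and \<P> :: "'a measure set"
    and \<theta> :: "'a measure \<Rightarrow> real"
    and \<theta>h \<sigma>h :: "'a estimator"
    and f :: "'a measure \<Rightarrow> 'a \<Rightarrow> real"
    and p :: real
    and m n :: "nat \<Rightarrow> nat"
    and \<Omega> :: "nat \<Rightarrow> 'w measure"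
    and X Y :: "nat \<Rightarrow> nat \<Rightarrow> 'w \<Rightarrow> 'a"
  assumes "\<P> \<subseteq> space (prob_algebra M)"
    and "P \<in> \<P>" and "Q \<in> \<P>" and "mixture p P Q \<in> \<P>"
    and "\<And>r. \<theta>h r \<in> borel_measurable (PiM {..<r} (\<lambda>_. M))"
    and "\<And>r. \<sigma>h r \<in> borel_measurable (PiM {..<r} (\<lambda>_. M))"
    and "filterlim m at_top sequentially" and "filterlim n at_top sequentially"
    and "0 < p" and "p < 1"
    and "(\<lambda>k. real (m k) / real (m k + n k)) \<longlonglongrightarrow> p"
    and "(\<lambda>k. real (m k) / real (m k + n k) - p) \<in> O(\<lambda>k. real (m k + n k) powr (-1/2))"
    and "\<And>k. prob_space (\<Omega> k)"
    and "\<And>k. prob_space.indep_vars (\<Omega> k) (\<lambda>_. M) (case_sum (X k) (Y k)) ({..<m k} <+> {..<n k})"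
    and "\<And>k i. i < m k \<Longrightarrow> distr (\<Omega> k) M (X k i) = P"
    and "\<And>k j. j < n k \<Longrightarrow> distr (\<Omega> k) M (Y k j) = Q"
    and "\<And>R. R \<in> {P, Q, mixture p P Q} \<Longrightarrow> asymptotically_linear \<theta>h \<theta> R (f R)"
    and "\<And>R. R \<in> {P, Q, mixture p P Q} \<Longrightarrow> consistent_at \<sigma>h R (sqrt (\<integral>x. (f R x)\<^sup>2 \<partial>R))"
  shows "tendsto_prob \<Omega>
    (\<lambda>k \<omega>. SUP t. \<bar>perm_cdf (m k + n k) (S_stat \<theta>h \<sigma>h (m k) (n k))
                      (pooled (m k) (\<lambda>i. X k i \<omega>) (\<lambda>j. Y k j \<omega>)) t
                    - cdf std_normal_distribution t\<bar>) 0"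
proof -
  have PM: "prob_space P" "sets P = sets M" and QM: "prob_space Q" "sets Q = sets M"
    using assms(1-3) by (auto simp: space_prob_algebra)
  interpret two_sample P Q p
    using PM QM assms(9,10) by (simp add: two_sample_def)
  have al: "asymptotically_linear \<theta>h \<theta> Pb (f Pb)"
    and co: "consistent_at \<sigma>h Pb (sqrt (\<integral>x. (f Pb x)\<^sup>2 \<partial>Pb))"
    using assms(17)[of Pb] assms(18)[of Pb] by simp_all
  have f: "integrable Pb (f Pb)" "(\<integral>x. f Pb x \<partial>Pb) = 0" "integrable Pb (\<lambda>x. (f Pb x)\<^sup>2)" "0
      < (\<integral>x. (f Pb x)\<^sup>2 \<partial>Pb)"
    and al': "tendsto_prob (\<lambda>_. iid_space Pb) (\<lambda>r v. sqrt (real r) * (\<theta>h r (restrict v {..<r}) - \<theta> Pb)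
        - (\<Sum>i<r. f Pb (v i)) / sqrt (real r)) 0"
    using al unfolding asymptotically_linear_def by auto
  have sets_r: "sets (PiM {..<r} (\<lambda>_. M)) = sets (PiP {..<r})" for r :: nat
    by (intro sets_PiM_cong) (auto simp: PM)
  have \<theta>m: "\<theta>h r \<in> borel_measurable (PiP {..<r})" and \<sigma>m: "\<sigma>h r \<in> borel_measurable (PiP {..<r})" for r
    using assms(5)[of r] assms(6)[of r] by (simp_all only: measurable_cong_sets[OF sets_r refl])
  \<comment> \<open>Multiplied by N, this rate becomes |m - N p| \<le> D sqrt N, the form used by
    the binomial bounds and by the coupling.\<close>
  obtain D where D: "0 < D" "eventually (\<lambda>k. norm (real (m k) / real (m k + n k) - p)
      \<le> D * norm (real (m k + n k) powr (-1/2))) sequentially"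
    using assms(12) by (elim landau_o.bigE) auto
  have "eventually (\<lambda>k. 0 < m k) sequentially"
    using filterlim_at_top[THEN iffD1, OF assms(7), rule_format, of 1] by eventually_elim auto
  then have D': "eventually (\<lambda>k. \<bar>real (m k) - real (m k + n k) * p\<bar> \<le> D * sqrt (m k + n k)) sequentially"
    using D(2)
  proof eventually_elim
    case (elim k)
    define x where "x = real (m k + n k)"
    have x: "0 < x" using elim by (simp add: x_def)
    have pw: "x powr (-1/2) = 1 / sqrt x"
      using x by (simp add: powr_minus_divide powr_half_sqrt flip: minus_divide_left)
    have "\<bar>real (m k) - x * p\<bar> = x * \<bar>real (m k) / x - p\<bar>"
      using x by (simp add: abs_mult_pos' right_diff_distrib)
    also have "\<dots> \<le> x * (D * (1 / sqrt x))"
      using elim(2) x unfolding x_def[symmetric] pw by (intro mult_left_mono) auto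
    also have "\<dots> = D * (x / sqrt x)" by simp
    also have "x / sqrt x = sqrt x" using x by (simp add: real_div_sqrt)
    finally show ?case by (simp add: x_def)
  qed
  interpret two_sample_limit P Q p "f Pb" m n D
    using f assms(7,8,11) D(1) D' by unfold_locales auto
  have lin: "(\<lambda>r. measure (PiPb {..<r}) {x \<in> space (PiP {..<r}). \<delta> < \<bar>lin_error \<theta>h (\<theta> Pb) (f Pb) r x\<bar>}) \<longlonglongrightarrow> 0"
    if "0 < \<delta>" for \<delta>
  proof -
    have "tendsto_prob (\<lambda>_. iid_space Pb) (\<lambda>r \<omega>. lin_error \<theta>h (\<theta> Pb) (f Pb) r (restrict \<omega> {..<r})) 0"
      using al' by (simp add: lin_error_def)
    moreover have "lin_error \<theta>h (\<theta> Pb) (f Pb) r \<in> borel_measurable (PiPb {..<r})" for r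
    proof -
      note [measurable] = \<theta>m[of r] fP
      have "lin_error \<theta>h (\<theta> Pb) (f Pb) r \<in> borel_measurable (PiP {..<r})" unfolding lin_error_def by measurable
      then show ?thesis by measurable
    qed
    ultimately show ?thesis using Pb.tendsto_prob_iid_restrict[of "lin_error \<theta>h (\<theta> Pb) (f Pb)" 0 \<delta>] that by simp
  qed
  have cons: "(\<lambda>r. measure (PiPb {..<r}) {x \<in> space (PiP {..<r}). \<delta> < \<bar>\<sigma>h r x - sqrt v\<bar>}) \<longlonglongrightarrow> 0" if "0 < \<delta>" for \<delta>
  proof -
    have "\<sigma>h r \<in> borel_measurable (PiPb {..<r})" for r using \<sigma>m[of r] by measurable
    then show ?thesis
      using Pb.tendsto_prob_iid_restrict[of \<sigma>h "sqrt v" \<delta>] co that by (simp add: consistent_at_def v_def)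
  qed
  interpret two_sample_estimators P Q p "f Pb" m n D \<theta>h \<sigma>h "\<theta> Pb"
    using \<theta>m \<sigma>m lin cons by unfold_locales auto
  let ?Z = "\<lambda>k \<omega>. \<lambda>i\<in>{..<N k}. pooled (m k) (\<lambda>i. X k i \<omega>) (\<lambda>j. Y k j \<omega>) i"
  have Zm: "?Z k \<in> \<Omega> k \<rightarrow>\<^sub>M PiP {..<N k}" for k
    using measurable_pooled[OF assms(13) PM(2)[symmetric] assms(14)] .
  have eq: "(SUP t. \<bar>perm_cdf (N k) (S k) (pooled (m k) (\<lambda>i. X k i \<omega>) (\<lambda>j. Y k j \<omega>)) t - \<Phi> t\<bar>)
     = perm_cdf_dist (N k) (S k) (?Z k \<omega>)" for k \<omega>
    unfolding perm_cdf_dist_restrict by (simp only: perm_cdf_dist_def)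
  show ?thesis
    unfolding tendsto_prob_def eq
  proof (intro conjI allI impI)
    fix k show "(\<lambda>\<omega>. perm_cdf_dist (N k) (S k) (?Z k \<omega>)) \<in> borel_measurable (\<Omega> k)"
      by (rule measurable_compose[OF Zm measurable_perm_cdf_dist_S])
  next
    fix \<epsilon> :: real assume \<epsilon>: "0 < \<epsilon>"
    \<comment> \<open>The equality is claimed eventually only, since \<open>distr_pooled\<close>
      asks for a nonempty pooled sample.\<close>
    have "eventually (\<lambda>k. measure (Law k) {z \<in> space (PiP {..<N k}). \<epsilon> < perm_cdf_dist (N k) (S k) z}
        = measure (\<Omega> k) {\<omega> \<in> space (\<Omega> k). \<epsilon> < \<bar>perm_cdf_dist (N k) (S k) (?Z k \<omega>) - 0\<bar>}) sequentially"
      using ev_mn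
    proof eventually_elim
      case (elim k)
      let ?B = "{z \<in> space (PiP {..<N k}). \<epsilon> < perm_cdf_dist (N k) (S k) z}"
      have B: "?B \<in> sets (PiP {..<N k})" using measurable_perm_cdf_dist_S[of k] by measurable
      have "measure (Law k) ?B = measure (distr (\<Omega> k) (PiP {..<N k}) (?Z k)) ?B"
        using elim by (subst distr_pooled[OF assms(13) PM(2)[symmetric] _ assms(14-16)]) auto
      also have "\<dots> = measure (\<Omega> k) (?Z k -` ?B \<inter> space (\<Omega> k))"
        by (rule measure_distr[OF Zm B])
      also have "?Z k -` ?B \<inter> space (\<Omega> k) = {\<omega> \<in> space (\<Omega> k). \<epsilon> < \<bar>perm_cdf_dist (N k) (S k) (?Z k \<omega>) - 0\<bar>}"
        using measurable_space[OF Zm[of k]] by (auto simp: abs_of_nonneg[OF perm_cdf_dist_nonneg])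
      finally show ?case .
    qed
    then show "(\<lambda>k. measure (\<Omega> k) {\<omega> \<in> space (\<Omega> k). \<epsilon> < \<bar>perm_cdf_dist (N k) (S k) (?Z k \<omega>) - 0\<bar>}) \<longlonglongrightarrow> 0"
      by (rule Lim_transform_eventually[OF perm_cdf_dist_tendsto[OF \<epsilon>]])
  qed
qed

end
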